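(* Let $R$ be a finite commutative ring with non-zero unity such that the total graph $\mathrm{T}(\Gamma(R))$ is toroidal. Then the following statements hold: (a) If $R$ is a local ring, then $R$ is isomorphic to $\mathbb{Z}_9$ or $\mathbb{Z}_{3}[X]/(X^{2})$. (b) If $R$ is not a local ring, then $R$ is isomorphic to one of the following rings: $$\mathbb{Z}_{2}\times \mathbb{F}_{4},\quad \mathbb{Z}_{3}\times \mathbb{Z}_{3},\quad \mathbb{Z}_{2}\times \mathbb{Z}_{4},\quad \mathbb{Z}_{2}\times \mathbb{Z}_{2}[X]/(X^2),\quad \mathbb{Z}_{2}\times \mathbb{Z}_{2}\times \mathbb{Z}_{2}.$$
   Context: For a commutative ring $R$ with non-zero unity, $\mathrm{Z}(R)$ denotes the set of zero-divisors of $R$ (including $0$). The total graph of $R$, denoted $\mathrm{T}(\Gamma(R))$, is the simple undirected graph whose vertices are all elements of $R$, in which two distinct elements $x,y\in R$ are adjacent if and only if $x+y\in \mathrm{Z}(R)$. For a non-negative integer $k$, let $S_k$ be the sphere with $k$ handles (the oriented surface of genus $k$). The genus $\gamma(G)$ of a graph $G$ is the minimum integer $n$ such that $G$ can be embedded in $S_n$ (drawn without edge crossings). A graph $G$ is toroidal if $\gamma(G)=1$ (in particular, a toroidal graph is non-planar). $\mathbb{Z}_n$ denotes the ring of integers modulo $n$, and $\mathbb{F}_q$ denotes the field with $q$ elements. *)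

theory Defs
  imports
    "HOL-Analysis.Analysis"
    "HOL-Algebra.Algebra"
    "HOL-Number_Theory.Residues"
    "HOL-Library.Extended_Nat"
begin

section \<open>Simple graphs drawn on surfaces\<close>

text \<open>A simple undirected graph is a pair of a vertex set and a set of two-element sets of
  vertices.\<close>

type_synonym 'a ugraph = "'a set \<times> 'a set set"

text \<open>
  The sphere with \<open>k\<close> handles, realised as a surface in \<open>\<complex> \<times> \<real>\<close>, i.e. in three-space. Let \<open>P\<close> be
  the closed disc of radius \<open>3k + 1\<close> around \<open>0\<close> with the open unit discs around the \<open>k\<close> points
  \<open>0, 3, ..., 3(k-1)\<close> removed. The holes have disjoint closures lying inside the open disc of
  radius \<open>3k + 1\<close>, so at most one factor of the right-hand side below can be \<open>\<le> 0\<close> at any point: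
  the right-hand side is positive in the interior of \<open>P\<close>, has a simple zero along each boundary
  circle of \<open>P\<close>, and is negative off \<open>P\<close>. Hence the surface is smooth, and it consists of two
  copies of \<open>P\<close> (\<open>z \<ge> 0\<close> and \<open>z \<le> 0\<close>) glued along their \<open>k + 1\<close> boundary circles: it is the
  boundary of a solid body with \<open>k\<close> holes. For \<open>k = 0\<close> it is the unit sphere, and for \<open>k = 1\<close> it
  is a torus of revolution; see the two lemmas following the definition.
\<close>

definition handle_sphere :: "nat \<Rightarrow> (complex \<times> real) set" where
  "handle_sphere k =
     {(p, z). z\<^sup>2 = ((3 * real k + 1)\<^sup>2 - (cmod p)\<^sup>2) *
                    (\<Prod>j<k. (cmod (p - of_real (3 * real j)))\<^sup>2 - 1)}"

lemma handle_sphere_0: "handle_sphere 0 = sphere 0 1"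
  by (auto simp: handle_sphere_def norm_Pair algebra_simps)

lemma handle_sphere_1:
  "handle_sphere 1 homeomorphic (sphere 0 1 \<times> sphere 0 1 :: (complex \<times> complex) set)"
proof -
  define f :: "complex \<times> real \<Rightarrow> complex \<times> complex" where
    "f = (\<lambda>q. (fst q / of_real (cmod (fst q)),
               Complex (((cmod (fst q))\<^sup>2 - 17/2) * (2/15)) (snd q * (2/15))))"
  define g :: "complex \<times> complex \<Rightarrow> complex \<times> real" where
    "g = (\<lambda>q. (fst q * of_real (sqrt (17/2 + 15/2 * Re (snd q))), 15/2 * Im (snd q)))"
  define T where "T = handle_sphere 1"
  have S: "(p, z) \<in> T \<longleftrightarrow> z\<^sup>2 = (16 - (cmod p)\<^sup>2) * ((cmod p)\<^sup>2 - 1)" for p z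
    by (simp add: T_def handle_sphere_def)
  have nz: "p \<noteq> 0" if "(p, z) \<in> T" for p z
  proof
    assume "p = 0"
    with that have "z\<^sup>2 = -16" by (simp add: S)
    then show False using zero_le_power2[of z] by linarith
  qed
  have circ: "cmod w = 1 \<longleftrightarrow> (Re w)\<^sup>2 + (Im w)\<^sup>2 = 1" for w
    by (simp add: cmod_def)
  have bd: "17/2 + 15/2 * Re w > 0" if "cmod w = 1" for w
    using abs_Re_le_cmod[of w] that by linarith
  have img1: "f q \<in> sphere 0 1 \<times> sphere 0 1" if "q \<in> T" for q
  proof -
    obtain p z where q: "q = (p, z)" by force
    have "z * z = (16 - (cmod p)\<^sup>2) * ((cmod p)\<^sup>2 - 1)"
      using that by (simp add: q S power2_eq_square[of z])
    then show ?thesis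
      using nz[of p z] that
      by (auto simp: f_def q circ norm_divide power_mult_distrib power2_eq_square[of z])
        (simp add: power2_eq_square field_simps)
  qed
  have img2: "g q \<in> T" if "q \<in> sphere 0 1 \<times> sphere 0 1" for q
  proof -
    obtain u w where q: "q = (u, w)" by force
    with that have u: "cmod u = 1" and w: "cmod w = 1" by auto
    have "Im w * Im w = 1 - Re w * Re w"
      using w by (simp add: circ power2_eq_square)
    then show ?thesis
      using bd[OF w] u
      by (auto simp: g_def q S norm_mult power_mult_distrib)
        (simp add: power2_eq_square algebra_simps)
  qed
  have gf: "g (f q) = q" if "q \<in> T" for q
  proof -
    have "17/2 + 15/2 * (((cmod (fst q))\<^sup>2 - 17/2) * (2/15)) = (cmod (fst q))\<^sup>2"
      by (simp add: field_simps)
    then show ?thesis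
      using nz[of "fst q" "snd q"] that
      by (simp add: f_def g_def prod_eq_iff del: times_divide_eq_left times_divide_eq_right) simp
  qed
  have fg: "f (g q) = q" if "q \<in> sphere 0 1 \<times> sphere 0 1" for q
  proof -
    obtain u w where q: "q = (u, w)" by force
    with that have u: "cmod u = 1" and w: "cmod w = 1" by auto
    then show ?thesis
      using bd[OF w] by (auto simp: f_def g_def q complex_eq_iff norm_mult)
  qed
  have "continuous_on (T) f"
    unfolding f_def Complex_eq by (intro continuous_intros) (use nz in force)
  moreover have "continuous_on (sphere 0 1 \<times> sphere 0 1) g"
    unfolding g_def by (intro continuous_intros)
  ultimately have "homeomorphism (T) (sphere 0 1 \<times> sphere 0 1) f g"
    using img1 img2 gf fg by (intro homeomorphismI) (blast | force)+
  then show ?thesis unfolding homeomorphic_def T_def by blast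
qed

definition embeds_in :: "'a ugraph \<Rightarrow> 'b::topological_space set \<Rightarrow> bool" where
  "embeds_in G S \<longleftrightarrow>
     (\<exists>(pt :: 'a \<Rightarrow> 'b) (curve :: 'a set \<Rightarrow> real \<Rightarrow> 'b).
        inj_on pt (fst G) \<and> pt ` fst G \<subseteq> S \<and>
        (\<forall>e\<in>snd G. arc (curve e) \<and> path_image (curve e) \<subseteq> S \<and>
            {pathstart (curve e), pathfinish (curve e)} = pt ` e \<and>
            path_image (curve e) \<inter> pt ` fst G = pt ` e) \<and>
        (\<forall>e\<in>snd G. \<forall>e'\<in>snd G. e \<noteq> e' \<longrightarrow>
            path_image (curve e) \<inter> path_image (curve e') = pt ` (e \<inter> e')))"

text \<open>The infimum is the least such \<open>k\<close>, and \<open>\<infinity>\<close> for a graph that embeds in no \<open>handle_sphere k\<close>.\<close>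

definition genus :: "'a ugraph \<Rightarrow> enat" where
  "genus G = (INF k \<in> {k. embeds_in G (handle_sphere k)}. enat k)"

definition toroidal :: "'a ugraph \<Rightarrow> bool" where
  "toroidal G \<longleftrightarrow> genus G = 1"


section \<open>Total graphs of commutative rings\<close>

definition zero_divisors :: "('a, 'b) ring_scheme \<Rightarrow> 'a set" where
  "zero_divisors R =
     {a \<in> carrier R. \<exists>b\<in>carrier R. b \<noteq> \<zero>\<^bsub>R\<^esub> \<and> a \<otimes>\<^bsub>R\<^esub> b = \<zero>\<^bsub>R\<^esub>}"

definition total_graph :: "('a, 'b) ring_scheme \<Rightarrow> 'a ugraph" where
  "total_graph R =
     (carrier R,
      {{x, y} | x y. x \<in> carrier R \<and> y \<in> carrier R \<and> x \<noteq> y \<and>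
                     x \<oplus>\<^bsub>R\<^esub> y \<in> zero_divisors R})"

definition local_ring :: "('a, 'b) ring_scheme \<Rightarrow> bool" where
  "local_ring R \<longleftrightarrow> (\<exists>!M. maximalideal M R)"

abbreviation Zmod :: "int \<Rightarrow> int ring" where
  "Zmod n \<equiv> residue_ring n"

text \<open>\<open>\<int>\<^sub>n[X]/(X\<^sup>2)\<close>\<close>

definition Zmod_dual :: "int \<Rightarrow> int list set ring" where
  "Zmod_dual n =
     (let P = univ_poly (Zmod n) (carrier (Zmod n))
      in P Quot (PIdl\<^bsub>P\<^esub> (X\<^bsub>Zmod n\<^esub> [^]\<^bsub>P\<^esub> (2::nat))))"

end

theory Submission
  imports Defs
begin

text \<open>
  A drawing on the torus is lifted to the universal cover \<open>\<complex>\<close>. The periods of a connected drawn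
  subgraph are the Gaussian integers by which a path component of its preimage can be translated.
  If they are all collinear, the lifted drawing projects injectively to an annulus and the subgraph
  is planar. Periods of disjoint subgraphs, on the other hand, are collinear. Hence a graph on the
  torus does not contain two disjoint connected nonplanar subgraphs.

  In a total graph, a proper ideal \<open>I\<close> is a clique, and the cosets of \<open>1\<close> and \<open>-1\<close> form a clique or
  are completely joined. So if \<open>I\<close> has at least five elements, then there are two disjoint nonplanar
  subgraphs. If all proper ideals have at most four elements, a local ring that is not in the list
  has a total graph whose components have at most four vertices, and a nonlocal ring is a product of
  two rings with at most four elements each. Products of order at most 6 have planar total graphs;
  orders 12 and 16 are excluded by disjoint subgraphs again.
\<close>

section \<open>Crossing chords and Kuratowski graphs\<close>

text \<open>Genus is defined through arbitrary arcs on a surface, so counting faces by Euler's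
  formula would first require them to be cells. Periods avoid this: apart from lifting paths, the
  topology takes place in the plane and rests on the Jordan curve theorem, theta curves and
  Fashoda's theorem. Toroidality is used only as an embedding in the torus together with
  nonplanarity, so that besides obstructions only plane drawings of small graphs are needed.

  A nonplanar part has two periods that are not parallel. Periods of a disjoint part are parallel to
  both and hence zero. This stronger form serves order 12, where the graph contains a K4 linked to a
  K44: removing a K33 from the K44 leaves a planar piece, but one that lifts to the plane without
  monodromy, and these pieces overlap enough to lift the whole K44.

  Five elements of an ideal are what a K5 needs. At order 16 a row of four is planar, and only two
  rows together give a nonplanar part.\<close>

lemma arc_continuous_image:
  assumes "arc q" "continuous_on (path_image q) f" "inj_on f (path_image q)"
  shows "arc (f \<circ> q)"
  using assms unfolding arc_def
  by (auto simp: path_image_def intro: path_continuous_image comp_inj_on)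

text \<open>Inversion at a point inside exchanges the two sides. The punctured inside has a
  connected image that is unbounded near \<open>z0\<close>, so it lies outside the new curve. The
  new inside is not empty, and no points are left for it but the images of the outside and 0, the
  image of infinity; together these form one connected set.\<close>

lemma inversion_outside_subset_inside:
  fixes z0 :: complex
  assumes sp: "simple_path J" and loop: "pathfinish J = pathstart J"
    and z0: "z0 \<in> inside (path_image J)"
  shows "(\<lambda>z. inverse (z - z0)) ` outside (path_image J)
         \<subseteq> inside ((\<lambda>z. inverse (z - z0)) ` path_image J)"
proof -
  define f where "f = (\<lambda>z. inverse (z - z0))"
  define g where "g = (\<lambda>w. z0 + inverse w)"
  define I O' where "I = inside (path_image J)" and "O' = outside (path_image J)"
  have JIO: "I \<noteq> {}" "open I" "connected I" "O' \<noteq> {}" "open O'" "connected O'"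
      "bounded I" "\<not> bounded O'" "I \<inter> O' = {}" "I \<union> O' = - path_image J"
    using Jordan_inside_outside[OF sp loop] unfolding I_def O'_def by auto
  have z0I: "z0 \<in> I" using z0 I_def by simp
  have z0n: "z0 \<notin> path_image J" "z0 \<notin> O'" using z0I JIO by blast+
  have inj: "inj f" unfolding f_def inj_def by simp
  \<comment> \<open>Since \<open>inverse 0 = 0\<close>, this holds at \<open>w = 0\<close> as well,
    where \<open>g w\<close> is \<open>z0\<close>; that is why 0 is treated separately
    below.\<close>
  have fg: "f (g w) = w" for w by (simp add: f_def g_def)
  have cont: "continuous_on (- {z0}) f" unfolding f_def by (intro continuous_intros) auto
  have spJ: "simple_path (f \<circ> J)"
    by (rule simple_path_continuous_image[OF sp])
       (use z0n in \<open>auto intro: inj_on_subset[OF inj] continuous_on_subset[OF cont]\<close>)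
  have loopJ: "pathfinish (f \<circ> J) = pathstart (f \<circ> J)"
    using loop by (simp add: pathfinish_compose pathstart_compose)
  have im: "path_image (f \<circ> J) = f ` path_image J" by (rule path_image_compose)
  define I2 O2 where "I2 = inside (f ` path_image J)" and "O2 = outside (f ` path_image J)"
  have JIO2: "I2 \<noteq> {}" "open I2" "connected I2" "O2 \<noteq> {}" "open O2" "connected O2"
      "bounded I2" "\<not> bounded O2" "I2 \<inter> O2 = {}" "I2 \<union> O2 = - (f ` path_image J)"
    using Jordan_inside_outside[OF spJ loopJ] unfolding I2_def O2_def im by auto
  have "connected (f ` (I - {z0}))"
    by (rule connected_continuous_image)
       (use JIO in \<open>auto intro!: connected_open_delete intro: continuous_on_subset[OF cont]\<close>)
  moreover have "f ` (I - {z0}) \<subseteq> I2 \<union> O2"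
    using JIO2(10) JIO(10) inj by (auto dest: injD)
  moreover have "f ` (I - {z0}) \<inter> O2 \<noteq> {}"
  proof -
    obtain e where e: "e > 0" "ball z0 e \<subseteq> I" using JIO(2) z0I open_contains_ball by blast
    obtain w where w: "w \<in> O2" "norm w > inverse e"
      using JIO2(8) unfolding bounded_iff by (meson not_le)
    have w0: "w \<noteq> 0" using w(2) e(1) by auto
    have "norm (inverse w) < e"
      using less_imp_inverse_less[OF w(2)] e(1) by (simp add: norm_inverse)
    then have "g w \<in> I - {z0}" using e(2) w0 by (auto simp: g_def dist_norm)
    then show ?thesis using w(1) fg[of w] by (metis IntI empty_iff imageI)
  qed
  ultimately have IO: "f ` (I - {z0}) \<subseteq> O2"
    using JIO2(2,5,9) connectedD[of "f ` (I - {z0})" I2 O2] by blast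
  have "connected (f ` O')"
    by (rule connected_continuous_image)
       (use JIO z0n in \<open>auto intro: continuous_on_subset[OF cont]\<close>)
  then have con0: "connected (insert 0 (f ` O'))"
  proof (rule connected_intermediate_closure)
    show "f ` O' \<subseteq> insert 0 (f ` O')" by auto
    have "0 \<in> closure (f ` O')"
      unfolding closure_approachable
    proof (intro allI impI)
      fix e :: real assume e: "e > 0"
      obtain w where w: "w \<in> O'" "norm w > norm z0 + inverse e"
        using JIO(8) unfolding bounded_iff by (meson not_le)
      have "norm (w - z0) > inverse e" using w(2) norm_triangle_ineq2[of w z0] by linarith
      then have "norm (f w) < e"
        using less_imp_inverse_less[of "inverse e" "norm (w - z0)"] e by (simp add: f_def norm_inverse)
      then show "\<exists>y\<in>f ` O'. dist y 0 < e" using w(1) by auto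
    qed
    then show "insert 0 (f ` O') \<subseteq> closure (f ` O')" using closure_subset[of "f ` O'"] by simp
  qed
  have "0 \<notin> f ` path_image J" using z0n by (auto simp: f_def)
  moreover have "f ` O' \<inter> f ` path_image J = {}"
    using JIO(10) image_Int[OF inj, of O' "path_image J"] by auto
  ultimately have sub: "insert 0 (f ` O') \<subseteq> I2 \<union> O2"
    unfolding JIO2(10) by (simp add: disjoint_eq_subset_Compl)
  obtain w where w: "w \<in> I2" using JIO2(1) by blast
  have "w \<in> insert 0 (f ` O')"
  proof (cases "w = 0")
    case False
    have w': "w = f (g w)" by (simp add: fg)
    have "w \<notin> f ` path_image J" using w JIO2(10) by blast
    then have "g w \<notin> path_image J" using w' by blast
    moreover have "w \<notin> f ` (I - {z0})" using IO w JIO2(9) by blast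
    then have "g w \<notin> I - {z0}" using w' by blast
    moreover have "g w \<noteq> z0" using False by (simp add: g_def)
    ultimately have "g w \<in> O'" using JIO(10) by blast
    then show ?thesis using w' by blast
  qed auto
  then have "insert 0 (f ` O') \<subseteq> I2"
    using w sub con0 JIO2(2,5,9) connectedD[of "insert 0 (f ` O')" I2 O2] by blast
  then show ?thesis unfolding f_def I2_def O'_def by blast
qed

text \<open>The chord \<open>P\<close> cuts the inside into two regions. Apart from \<open>a\<close>
  and \<open>c\<close>, one has only points of \<open>c1\<close> and \<open>P\<close> on its border,
  the other only points of \<open>c2\<close> and \<open>P\<close>. The connected set
  \<open>K\<close>, an open arc in the applications, lies in one region and cannot accumulate at
  both \<open>b\<close> and \<open>d\<close>.\<close>

lemma crossing_chords_inside:
  fixes c1 :: "real \<Rightarrow> complex"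
  assumes c1: "arc c1" "pathstart c1 = a" "pathfinish c1 = c"
    and c2: "arc c2" "pathstart c2 = a" "pathfinish c2 = c"
    and P: "arc P" "pathstart P = a" "pathfinish P = c"
    and c1c2: "path_image c1 \<inter> path_image c2 = {a, c}"
    and c1P: "path_image c1 \<inter> path_image P = {a, c}"
    and c2P: "path_image c2 \<inter> path_image P = {a, c}"
    and b: "b \<in> path_image c1 - {a, c}" and d: "d \<in> path_image c2 - {a, c}"
    and K: "connected K" "b \<in> closure K" "d \<in> closure K"
      "K \<inter> (path_image c1 \<union> path_image c2 \<union> path_image P) = {}"
    and Pin: "path_image P \<inter> inside (path_image c1 \<union> path_image c2) \<noteq> {}"
    and Kin: "K \<inter> inside (path_image c1 \<union> path_image c2) \<noteq> {}"
  shows False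
proof -
  let ?J = "path_image c1 \<union> path_image c2"
  let ?I1 = "inside (path_image c1 \<union> path_image P)" and ?I2 = "inside (path_image c2 \<union> path_image P)"
  have ac: "a \<noteq> c" using arc_distinct_ends[OF c1(1)] c1 by simp
  have cl: "closed ?J" "closed (path_image c1 \<union> path_image P)" "closed (path_image c2 \<union> path_image P)"
    using c1 c2 P by (auto intro: closed_arc_image)
  have op: "open (inside ?J)" "open (outside ?J)" "open ?I1" "open ?I2"
    using cl by (auto intro: open_inside open_outside)
  have "K \<subseteq> inside ?J \<union> outside ?J"
    using K(4) unfolding inside_Un_outside by blast
  then have KJ: "K \<subseteq> inside ?J"
    using connectedD[OF K(1) op(1,2)] Kin inside_Int_outside[of ?J] by blast
  have split: "?I1 \<inter> ?I2 = {}" "?I1 \<union> ?I2 \<union> (path_image P - {a, c}) = inside ?J"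
    using split_inside_simple_closed_curve[of c1 a c c2 P] c1 c2 P c1c2 c1P c2P Pin ac
    by (metis arc_imp_simple_path)+
  have "K \<subseteq> ?I1 \<union> ?I2" using KJ K(4) split(2) by blast
  then consider "K \<subseteq> ?I1" | "K \<subseteq> ?I2"
    using connectedD[OF K(1) op(3,4)] split(1) by blast
  then show False
  proof cases
    case 1
    then have "d \<in> closure ?I1" using K(3) closure_mono by blast
    then have "d \<in> ?I1 \<union> (path_image c1 \<union> path_image P)"
      using closure_inside_subset[OF cl(2)] by blast
    then have "d \<in> inside ?J" using d c1c2 c2P split(2) by blast
    then show False using d inside_no_overlap[of ?J] by blast
  next
    case 2
    then have "b \<in> closure ?I2" using K(2) closure_mono by blast
    then have "b \<in> ?I2 \<union> (path_image c2 \<union> path_image P)"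
      using closure_inside_subset[OF cl(3)] by blast
    then have "b \<in> inside ?J" using b c1c2 c1P split(2) by blast
    then show False using b inside_no_overlap[of ?J] by blast
  qed
qed

text \<open>The inversion at a point inside the closed curve reduces this to chords running inside.\<close>

lemma crossing_chords_outside:
  fixes c1 :: "real \<Rightarrow> complex"
  assumes c1: "arc c1" "pathstart c1 = a" "pathfinish c1 = c"
    and c2: "arc c2" "pathstart c2 = a" "pathfinish c2 = c"
    and P: "arc P" "pathstart P = a" "pathfinish P = c"
    and c1c2: "path_image c1 \<inter> path_image c2 = {a, c}"
    and c1P: "path_image c1 \<inter> path_image P = {a, c}"
    and c2P: "path_image c2 \<inter> path_image P = {a, c}"
    and b: "b \<in> path_image c1 - {a, c}" and d: "d \<in> path_image c2 - {a, c}"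
    and K: "connected K" "b \<in> closure K" "d \<in> closure K"
      "K \<inter> (path_image c1 \<union> path_image c2 \<union> path_image P) = {}"
    and Pout: "path_image P \<inter> inside (path_image c1 \<union> path_image c2) = {}"
    and Kout: "K \<inter> inside (path_image c1 \<union> path_image c2) = {}"
  shows False
proof -
  define J where "J = c1 +++ reversepath c2"
  have ac: "a \<noteq> c" using arc_distinct_ends[OF c1(1)] c1 by simp
  have spJ: "simple_path J" "pathfinish J = pathstart J"
    using c1 c2 c1c2 unfolding J_def
    by (auto simp: simple_path_join_loop_eq arc_reversepath)
  have imJ: "path_image J = path_image c1 \<union> path_image c2"
    using c1 c2 unfolding J_def by (simp add: path_image_join)
  obtain z0 where z0: "z0 \<in> inside (path_image J)"
    using Jordan_inside_outside[OF spJ] by blast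
  define f where "f = (\<lambda>z. inverse (z - z0))"
  have inj: "inj f" unfolding f_def inj_def by simp
  have z0J: "z0 \<notin> path_image c1" "z0 \<notin> path_image c2"
    using z0 inside_no_overlap[of "path_image J"] unfolding imJ by blast+
  have z0P: "z0 \<notin> path_image P" and z0K: "z0 \<notin> K" using Pout Kout z0 imJ by auto
  have cont: "continuous_on (- {z0}) f" unfolding f_def by (intro continuous_intros) auto
  have arcf: "arc (f \<circ> q)" if "arc q" "z0 \<notin> path_image q" for q
    by (rule arc_continuous_image[OF that(1)])
       (use that in \<open>auto intro: inj_on_subset[OF inj] continuous_on_subset[OF cont]\<close>)
  have int: "f ` A \<inter> f ` B = f ` (A \<inter> B)" for A B using inj by (simp add: image_Int)
  have unI: "f ` path_image c1 \<union> f ` path_image c2 = f ` path_image J" using imJ by auto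
  have out: "f ` outside (path_image J) \<subseteq> inside (f ` path_image J)"
    using inversion_outside_subset_inside[OF spJ z0] unfolding f_def .
  have clos: "f x \<in> closure (f ` K)" if xK: "x \<in> closure K" "x \<noteq> z0" for x
  proof -
    have isC: "isCont f x" unfolding f_def using that(2) by (intro continuous_intros) auto
    obtain s where s: "\<forall>n. s n \<in> K" "s \<longlonglongrightarrow> x"
      using xK(1) unfolding closure_sequential by blast
    have "(\<lambda>n. f (s n)) \<longlonglongrightarrow> f x"
      by (rule isCont_tendsto_compose[OF isC s(2)])
    with s(1) show ?thesis
      unfolding closure_sequential by (intro exI[of _ "\<lambda>n. f (s n)"]) simp
  qed
  have sides: "- path_image J = inside (path_image J) \<union> outside (path_image J)"
    by simp
  show False
  proof (rule crossing_chords_inside[of "f \<circ> c1" "f a" "f c" "f \<circ> c2" "f \<circ> P" "f b" "f d" "f ` K"])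
    show "arc (f \<circ> c1)" "arc (f \<circ> c2)" "arc (f \<circ> P)" using arcf c1 c2 P z0J z0P by auto
    show "pathstart (f \<circ> c1) = f a" "pathstart (f \<circ> c2) = f a" "pathstart (f \<circ> P) = f a"
      "pathfinish (f \<circ> c1) = f c" "pathfinish (f \<circ> c2) = f c" "pathfinish (f \<circ> P) = f c"
      using c1 c2 P by (auto simp: pathstart_compose pathfinish_compose)
    show "path_image (f \<circ> c1) \<inter> path_image (f \<circ> c2) = {f a, f c}"
      "path_image (f \<circ> c1) \<inter> path_image (f \<circ> P) = {f a, f c}"
      "path_image (f \<circ> c2) \<inter> path_image (f \<circ> P) = {f a, f c}"
      by (auto simp: path_image_compose int c1c2 c1P c2P)
    show "f b \<in> path_image (f \<circ> c1) - {f a, f c}" "f d \<in> path_image (f \<circ> c2) - {f a, f c}"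
      using b d inj by (auto simp: path_image_compose dest: injD)
    show "connected (f ` K)"
      by (rule connected_continuous_image) (use K(1) z0K cont continuous_on_subset in blast)+
    show "f b \<in> closure (f ` K)" "f d \<in> closure (f ` K)"
      using clos K(2,3) b d z0J by auto
    show "f ` K \<inter> (path_image (f \<circ> c1) \<union> path_image (f \<circ> c2) \<union> path_image (f \<circ> P)) = {}"
      using K(4) inj by (auto simp: path_image_compose dest: injD)
    \<comment> \<open>One point of the chord off its ends suffices: it lies outside the closed
      curve, so its image lies inside, as the inner version demands.\<close>
    have "path_image P - {a, c} \<noteq> {}"
    proof -
      have "connected (path_image P)" using P by (simp add: connected_arc_image)
      moreover have "a \<in> path_image P" "c \<in> path_image P"
        using P pathstart_in_path_image pathfinish_in_path_image by blast+
      ultimately have "infinite (path_image P)"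
        using ac connected_finite_iff_sing by (metis empty_iff singletonD)
      then show ?thesis by (metis finite.emptyI finite.insertI finite_Diff2)
    qed
    then obtain p where p: "p \<in> path_image P" "p \<notin> {a,c}" by blast
    then have "p \<notin> path_image J" using c1P c2P imJ by blast
    then have "p \<in> outside (path_image J)" using p Pout sides unfolding imJ by blast
    then show "path_image (f \<circ> P) \<inter> inside (path_image (f \<circ> c1) \<union> path_image (f \<circ> c2)) \<noteq> {}"
      using out p by (auto simp: path_image_compose unI)
    obtain k where k: "k \<in> K" using K(2) by fastforce
    then have "k \<in> outside (path_image J)" using K(4) Kout sides unfolding imJ by blast
    then show "f ` K \<inter> inside (path_image (f \<circ> c1) \<union> path_image (f \<circ> c2)) \<noteq> {}"
      using out k by (auto simp: path_image_compose unI)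
  qed
qed

lemma arc_interior_connected:
  fixes q :: "real \<Rightarrow> 'a::{real_normed_vector}"
  assumes "arc q"
  defines "K \<equiv> path_image q - {pathstart q, pathfinish q}"
  shows "connected K" "pathstart q \<in> closure K" "pathfinish q \<in> closure K"
proof -
  show "connected K"
    unfolding K_def by (rule connected_simple_path_endless[OF arc_imp_simple_path[OF assms(1)]])
  have ends: "pathstart q \<in> path_image q" "pathfinish q \<in> path_image q" by auto
  then have lim: "x islimpt path_image q" if "x \<in> path_image q" for x
    using ends arc_distinct_ends[OF assms(1)]
    by (intro connected_imp_perfect connected_arc_image assms(1) that) (metis singletonD)
  have "path_image q = insert (pathstart q) (insert (pathfinish q) K)"
    using ends unfolding K_def by blast
  then have "x islimpt K" if "x \<in> path_image q" for x
    using lim[OF that] by (simp add: islimpt_insert)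
  then show "pathstart q \<in> closure K" "pathfinish q \<in> closure K"
    using ends by (auto simp: closure_def)
qed

text \<open>A vertex in the middle of an arc decides the side of the whole arc. In K5 this puts both
  paths through the fifth vertex on the same side.\<close>

lemma arc_side_of_interior_point:
  fixes q :: "real \<Rightarrow> complex"
  assumes "arc q" "closed J" "path_image q \<inter> J \<subseteq> {pathstart q, pathfinish q}"
    and "x \<in> path_image q - {pathstart q, pathfinish q}" "pathstart q \<in> J" "pathfinish q \<in> J"
  shows "path_image q \<inter> inside J \<noteq> {} \<longleftrightarrow> x \<in> inside J"
proof -
  define K where "K = path_image q - {pathstart q, pathfinish q}"
  have "connected K" using arc_interior_connected(1)[OF assms(1)] unfolding K_def .
  moreover have "K \<subseteq> inside J \<union> outside J"
    using assms(3) unfolding inside_Un_outside K_def by blast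
  ultimately have "K \<subseteq> inside J \<or> K \<subseteq> outside J"
    using connectedD[of K "inside J" "outside J"] open_inside[OF assms(2)] open_outside[OF assms(2)]
      inside_Int_outside[of J] by blast
  then show ?thesis
    using assms(4-6) inside_no_overlap[of J] inside_Int_outside[of J] unfolding K_def by blast
qed

text \<open>Chords whose ends alternate on a closed curve cannot be on the same side. In the form of
  an inequality of truth values, an odd cycle of such pairs is contradictory by propositional logic
  alone.\<close>

lemma crossing_chords:
  fixes c1 :: "real \<Rightarrow> complex"
  assumes c1: "arc c1" "pathstart c1 = a" "pathfinish c1 = c"
    and c2: "arc c2" "pathstart c2 = a" "pathfinish c2 = c"
    and P: "arc P" "pathstart P = a" "pathfinish P = c"
    and Q: "arc Q" "pathstart Q = b" "pathfinish Q = d"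
    and c1c2: "path_image c1 \<inter> path_image c2 \<subseteq> {a, c}"
    and c1P: "path_image c1 \<inter> path_image P \<subseteq> {a, c}"
    and c2P: "path_image c2 \<inter> path_image P \<subseteq> {a, c}"
    and bd: "b \<in> path_image c1" "d \<in> path_image c2" and PQ: "path_image P \<inter> path_image Q = {}"
    and QJ: "path_image Q \<inter> path_image c1 \<subseteq> {b}" "path_image Q \<inter> path_image c2 \<subseteq> {d}"
  shows "(path_image P \<inter> inside (path_image c1 \<union> path_image c2) \<noteq> {}) \<noteq>
         (path_image Q \<inter> inside (path_image c1 \<union> path_image c2) \<noteq> {})"
proof -
  define K where "K = path_image Q - {b, d}"
  have K: "connected K" "b \<in> closure K" "d \<in> closure K"
    using arc_interior_connected[OF Q(1)] unfolding K_def Q(2,3) by auto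
  have ends: "a \<in> path_image c1" "c \<in> path_image c1" "a \<in> path_image c2" "c \<in> path_image c2"
    "a \<in> path_image P" "c \<in> path_image P" "b \<in> path_image Q" "d \<in> path_image Q"
    using pathstart_in_path_image[of c1] pathfinish_in_path_image[of c1]
      pathstart_in_path_image[of c2] pathfinish_in_path_image[of c2]
      pathstart_in_path_image[of P] pathfinish_in_path_image[of P]
      pathstart_in_path_image[of Q] pathfinish_in_path_image[of Q] c1 c2 P Q by simp_all
  have Kd: "K \<inter> (path_image c1 \<union> path_image c2 \<union> path_image P) = {}"
    using QJ PQ unfolding K_def by blast
  have eqs: "path_image c1 \<inter> path_image c2 = {a, c}"  "path_image c1 \<inter> path_image P = {a, c}"
    "path_image c2 \<inter> path_image P = {a, c}" using c1c2 c1P c2P ends by auto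
  have bd': "b \<in> path_image c1 - {a, c}" "d \<in> path_image c2 - {a, c}"
    using bd ends PQ by auto
  have QK: "path_image Q \<inter> inside (path_image c1 \<union> path_image c2) =
            K \<inter> inside (path_image c1 \<union> path_image c2)"
    using bd inside_no_overlap[of "path_image c1 \<union> path_image c2"] unfolding K_def by blast
  show ?thesis
    using crossing_chords_inside[OF c1 c2 P eqs bd' K Kd]
      crossing_chords_outside[OF c1 c2 P eqs bd' K Kd] unfolding QK by blast
qed

section \<open>Nonplanarity of K33 and K5\<close>

definition K33_arcs :: "(nat \<Rightarrow> 'b) \<Rightarrow> (nat \<Rightarrow> 'b) \<Rightarrow> (nat \<Rightarrow> nat \<Rightarrow> real \<Rightarrow> 'b::topological_space) \<Rightarrow> bool"
  where "K33_arcs u v g \<longleftrightarrow>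
    (\<forall>i<3. \<forall>j<3. arc (g i j) \<and> pathstart (g i j) = u i \<and> pathfinish (g i j) = v j \<and>
      (\<forall>k<3. \<forall>l<3. (i, j) \<noteq> (k, l) \<longrightarrow>
         path_image (g i j) \<inter> path_image (g k l) \<subseteq>
           (if i = k then {u i} else {}) \<union> (if j = l then {v j} else {})))"

lemma K33_arcsD:
  assumes "K33_arcs u v g" "i < 3" "j < 3"
  shows "arc (g i j)" "pathstart (g i j) = u i" "pathfinish (g i j) = v j"
    "\<lbrakk>k < 3; l < 3; (i, j) \<noteq> (k, l)\<rbrakk> \<Longrightarrow> path_image (g i j) \<inter> path_image (g k l) \<subseteq>
       (if i = k then {u i} else {}) \<union> (if j = l then {v j} else {})"
proof -
  have "arc (g i j) \<and> pathstart (g i j) = u i \<and> pathfinish (g i j) = v j \<and>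
      (\<forall>k<3. \<forall>l<3. (i, j) \<noteq> (k, l) \<longrightarrow>
         path_image (g i j) \<inter> path_image (g k l) \<subseteq>
           (if i = k then {u i} else {}) \<union> (if j = l then {v j} else {}))"
    using assms unfolding K33_arcs_def by blast
  then show "arc (g i j)" "pathstart (g i j) = u i" "pathfinish (g i j) = v j"
    "\<lbrakk>k < 3; l < 3; (i, j) \<noteq> (k, l)\<rbrakk> \<Longrightarrow> path_image (g i j) \<inter> path_image (g k l) \<subseteq>
       (if i = k then {u i} else {}) \<union> (if j = l then {v j} else {})" by presburger+
qed

text \<open>\<open>J\<close> is the hexagon through \<open>u 0\<close>, \<open>v 0\<close>,
  \<open>u 1\<close>, \<open>v 1\<close>, \<open>u 2\<close>, \<open>v 2\<close>, and the three arcs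
  not in it are its long diagonals. The paths \<open>c1\<close> and \<open>c2\<close> are its halves
  between the ends of the first diagonal.\<close>

lemma K33_crossing_chords:
  fixes u :: "nat \<Rightarrow> complex"
  assumes K: "K33_arcs u v g"
  defines "A \<equiv> \<lambda>i j. path_image (g i j)"
  defines "J \<equiv> (A 0 0 \<union> A 1 0 \<union> A 1 1) \<union> (A 0 2 \<union> A 2 2 \<union> A 2 1)"
  shows "(A 0 1 \<inter> inside J \<noteq> {}) \<noteq> (A 1 2 \<inter> inside J \<noteq> {})"
proof -
  have g: "arc (g i j)" "pathstart (g i j) = u i" "pathfinish (g i j) = v j" if "i < 3" "j < 3" for i j
    using K33_arcsD[OF K that] by auto
  have I: "A i j \<inter> A k l \<subseteq> (if i = k then {u i} else {}) \<union> (if j = l then {v j} else {})"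
    if "i < 3" "j < 3" "k < 3" "l < 3" "(i, j) \<noteq> (k, l)" for i j k l
    using K33_arcsD(4)[OF K that] unfolding A_def .
  have ends: "u i \<in> A i j" "v j \<in> A i j" if "i < 3" "j < 3" for i j
    using g[OF that] pathstart_in_path_image[of "g i j"] pathfinish_in_path_image[of "g i j"]
    unfolding A_def by simp_all
  define c1 where "c1 = g 0 0 +++ (reversepath (g 1 0) +++ g 1 1)"
  define c2 where "c2 = g 0 2 +++ (reversepath (g 2 2) +++ g 2 1)"
  have im: "path_image c1 = A 0 0 \<union> A 1 0 \<union> A 1 1" "path_image c2 = A 0 2 \<union> A 2 2 \<union> A 2 1"
    unfolding c1_def c2_def A_def by (simp_all add: g path_image_join Un_assoc)
  note II = I[of 0 0 1 0] I[of 0 0 1 1] I[of 1 0 1 1] I[of 0 2 2 2] I[of 0 2 2 1] I[of 2 2 2 1]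
    I[of 0 0 0 2] I[of 0 0 2 2] I[of 0 0 2 1] I[of 1 0 0 2] I[of 1 0 2 2] I[of 1 0 2 1]
    I[of 1 1 0 2] I[of 1 1 2 2] I[of 1 1 2 1]
    I[of 0 1 0 0] I[of 0 1 1 0] I[of 0 1 1 1] I[of 0 1 0 2] I[of 0 1 2 2] I[of 0 1 2 1] I[of 0 1 1 2]
    I[of 1 2 0 0] I[of 1 2 1 0] I[of 1 2 1 1] I[of 1 2 0 2] I[of 1 2 2 2] I[of 1 2 2 1]
  note III = II[simplified]
  have arcs: "arc c1" "arc c2"
    unfolding c1_def c2_def using III(1-6) unfolding A_def
    by (auto intro!: arc_join arc_reversepath simp: path_image_join g)
  have "(path_image (g 0 1) \<inter> inside (path_image c1 \<union> path_image c2) \<noteq> {}) \<noteq>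
        (path_image (g 1 2) \<inter> inside (path_image c1 \<union> path_image c2) \<noteq> {})"
  proof (rule crossing_chords[of c1 "u 0" "v 1" c2 "g 0 1" "g 1 2" "u 1" "v 2"])
    show "pathstart c1 = u 0" "pathstart c2 = u 0" "pathfinish c1 = v 1" "pathfinish c2 = v 1"
      unfolding c1_def c2_def by (simp_all add: g)
    show "path_image c1 \<inter> path_image c2 \<subseteq> {u 0, v 1}" unfolding im using III(7-15) by auto
    show "path_image c1 \<inter> path_image (g 0 1) \<subseteq> {u 0, v 1}"
      "path_image c2 \<inter> path_image (g 0 1) \<subseteq> {u 0, v 1}"
      "path_image (g 0 1) \<inter> path_image (g 1 2) = {}"
      unfolding im using III(16-22) unfolding A_def by auto
    show "u 1 \<in> path_image c1" "v 2 \<in> path_image c2" unfolding im using ends by auto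
    show "path_image (g 1 2) \<inter> path_image c1 \<subseteq> {u 1}" "path_image (g 1 2) \<inter> path_image c2 \<subseteq> {v 2}"
      unfolding im using III(23-28) unfolding A_def by auto
  qed (simp_all add: g arcs)
  then show ?thesis unfolding im J_def A_def .
qed

text \<open>The shift takes the hexagon to itself and permutes its long diagonals cyclically, so
  that the statement about one pair of diagonals yields all three.\<close>

lemma K33_arcs_rotate:
  assumes "K33_arcs u v g"
  shows "K33_arcs (\<lambda>i. u (Suc i mod 3)) (\<lambda>j. v (Suc j mod 3)) (\<lambda>i j. g (Suc i mod 3) (Suc j mod 3))"
proof -
  have s: "Suc i mod 3 < 3" "Suc i mod 3 = Suc k mod 3 \<longleftrightarrow> i = k" if "i < 3" "k < 3" for i k :: nat
    using that by (auto simp: mod_Suc)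
  show ?thesis
    unfolding K33_arcs_def
  proof (intro allI impI conjI)
    fix i j k l :: nat assume ij: "i < 3" "j < 3" and kl: "k < 3" "l < 3" "(i, j) \<noteq> (k, l)"
    then have "(Suc i mod 3, Suc j mod 3) \<noteq> (Suc k mod 3, Suc l mod 3)" using s(2) by auto
    from K33_arcsD(4)[OF assms s(1)[OF ij(1) ij(1)] s(1)[OF ij(2) ij(2)] s(1)[OF kl(1) kl(1)] s(1)[OF kl(2) kl(2)] this]
    show "path_image (g (Suc i mod 3) (Suc j mod 3)) \<inter> path_image (g (Suc k mod 3) (Suc l mod 3)) \<subseteq>
       (if i = k then {u (Suc i mod 3)} else {}) \<union> (if j = l then {v (Suc j mod 3)} else {})"
      unfolding s(2)[OF ij(1) kl(1)] s(2)[OF ij(2) kl(2)] .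
  qed (use K33_arcsD[OF assms] s(1) in auto)
qed

text \<open>The three long diagonals of the hexagon would have to lie on pairwise different sides,
  and there are only two sides.\<close>

theorem K33_nonplanar_arcs:
  fixes u :: "nat \<Rightarrow> complex"
  shows "\<not> K33_arcs u v g"
proof
  assume K: "K33_arcs u v g"
  define A where "A i j = path_image (g i j)" for i j
  define J where "J = (A 0 0 \<union> A 1 0 \<union> A 1 1) \<union> (A 0 2 \<union> A 2 2 \<union> A 2 1)"
  have m: "Suc (Suc 0) mod 3 = 2" "Suc 2 mod 3 = 0" "Suc 1 mod 3 = 2" by auto
  have J': "J = (A 1 1 \<union> A 2 1 \<union> A 2 2) \<union> (A 1 0 \<union> A 0 0 \<union> A 0 2)"
    "J = (A 2 2 \<union> A 0 2 \<union> A 0 0) \<union> (A 2 1 \<union> A 1 1 \<union> A 1 0)"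
    unfolding J_def by blast+
  have "(A 0 1 \<inter> inside J \<noteq> {}) \<noteq> (A 1 2 \<inter> inside J \<noteq> {})"
    using K33_crossing_chords[OF K] unfolding J_def A_def .
  moreover have "(A 1 2 \<inter> inside J \<noteq> {}) \<noteq> (A 2 0 \<inter> inside J \<noteq> {})"
    using K33_crossing_chords[OF K33_arcs_rotate[OF K]] unfolding J'(1) A_def by (simp add: m)
  moreover have "(A 2 0 \<inter> inside J \<noteq> {}) \<noteq> (A 0 1 \<inter> inside J \<noteq> {})"
    using K33_crossing_chords[OF K33_arcs_rotate[OF K33_arcs_rotate[OF K]]] unfolding J'(2) A_def
    by (simp add: m)
  ultimately show False by blast
qed

definition K5_arcs :: "(nat \<Rightarrow> 'b) \<Rightarrow> (nat \<Rightarrow> nat \<Rightarrow> real \<Rightarrow> 'b::topological_space) \<Rightarrow> bool"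
  where "K5_arcs p g \<longleftrightarrow>
    (\<forall>i j. i < j \<and> j < 5 \<longrightarrow> arc (g i j) \<and> pathstart (g i j) = p i \<and> pathfinish (g i j) = p j \<and>
      (\<forall>k l. k < l \<and> l < 5 \<and> (i, j) \<noteq> (k, l) \<longrightarrow>
         path_image (g i j) \<inter> path_image (g k l) \<subseteq> p ` ({i, j} \<inter> {k, l})))"

text \<open>Let \<open>J\<close> be the 4-cycle through \<open>p 0\<close>, \<open>p 1\<close>,
  \<open>p 2\<close>, \<open>p 3\<close>. Its diagonals \<open>g 0 2\<close> and
  \<open>g 1 3\<close> are on different sides. The path \<open>P\<close> through \<open>p 4\<close>
  cannot be on the side of \<open>g 1 3\<close>, nor the path \<open>Q\<close> through
  \<open>p 4\<close> on the side of \<open>g 0 2\<close>, so no side is left for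
  \<open>p 4\<close>.\<close>

theorem K5_nonplanar_arcs:
  fixes p :: "nat \<Rightarrow> complex"
  shows "\<not> K5_arcs p g"
proof
  assume K: "K5_arcs p g"
  define A where "A i j = path_image (g i j)" for i j
  have g: "arc (g i j)" "pathstart (g i j) = p i" "pathfinish (g i j) = p j" if "i < j" "j < 5" for i j
    using K[unfolded K5_arcs_def, rule_format, of i j] that by auto
  have I: "A i j \<inter> A k l \<subseteq> p ` ({i, j} \<inter> {k, l})"
    if "i < j" "j < 5" "k < l" "l < 5" "(i, j) \<noteq> (k, l)" for i j k l
    using K[unfolded K5_arcs_def, rule_format, of i j] that unfolding A_def by simp
  have ends: "p i \<in> A i j" "p j \<in> A i j" if "i < j" "j < 5" for i j
    using g[OF that] pathstart_in_path_image[of "g i j"] pathfinish_in_path_image[of "g i j"]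
    unfolding A_def by simp_all
  define c1 where "c1 = g 0 1 +++ g 1 2"
  define c2 where "c2 = g 0 3 +++ reversepath (g 2 3)"
  define P where "P = g 0 4 +++ reversepath (g 2 4)"
  define Q where "Q = g 1 4 +++ reversepath (g 3 4)"
  have im: "path_image c1 = A 0 1 \<union> A 1 2" "path_image c2 = A 0 3 \<union> A 2 3"
    "path_image P = A 0 4 \<union> A 2 4" "path_image Q = A 1 4 \<union> A 3 4"
    unfolding c1_def c2_def P_def Q_def A_def by (simp_all add: g path_image_join)
  note II = I[of 0 1 1 2] I[of 0 3 2 3] I[of 0 4 2 4] I[of 1 4 3 4]
    I[of 0 1 0 3] I[of 0 1 2 3] I[of 1 2 0 3] I[of 1 2 2 3]
    I[of 0 1 0 4] I[of 0 1 2 4] I[of 1 2 0 4] I[of 1 2 2 4]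
    I[of 0 3 0 4] I[of 0 3 2 4] I[of 2 3 0 4] I[of 2 3 2 4]
    I[of 0 1 1 4] I[of 0 1 3 4] I[of 1 2 1 4] I[of 1 2 3 4]
    I[of 0 3 1 4] I[of 0 3 3 4] I[of 2 3 1 4] I[of 2 3 3 4]
    I[of 0 1 0 2] I[of 1 2 0 2] I[of 0 3 0 2] I[of 2 3 0 2]
    I[of 0 1 1 3] I[of 1 2 1 3] I[of 0 3 1 3] I[of 2 3 1 3]
    I[of 0 2 1 3] I[of 0 2 1 4] I[of 0 2 3 4] I[of 0 4 1 3] I[of 2 4 1 3]
  note III = II[simplified]
  have arcs: "arc c1" "arc c2" "arc P" "arc Q"
    unfolding c1_def c2_def P_def Q_def using III(1-4) unfolding A_def
    by (auto intro!: arc_join arc_reversepath simp: g)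
  have ends': "pathstart c1 = p 0" "pathfinish c1 = p 2" "pathstart c2 = p 0" "pathfinish c2 = p 2"
    "pathstart P = p 0" "pathfinish P = p 2" "pathstart Q = p 1" "pathfinish Q = p 3"
    unfolding c1_def c2_def P_def Q_def by (simp_all add: g)
  have c12: "path_image c1 \<inter> path_image c2 \<subseteq> {p 0, p 2}"
    unfolding im using III(5-8) by auto
  have cP: "path_image c1 \<inter> path_image P \<subseteq> {p 0, p 2}" "path_image c2 \<inter> path_image P \<subseteq> {p 0, p 2}"
    "path_image c1 \<inter> path_image (g 0 2) \<subseteq> {p 0, p 2}"
    "path_image c2 \<inter> path_image (g 0 2) \<subseteq> {p 0, p 2}"
    using III(9-16,25-28) unfolding im A_def by auto
  have cQ: "path_image Q \<inter> path_image c1 \<subseteq> {p 1}" "path_image Q \<inter> path_image c2 \<subseteq> {p 3}"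
    "path_image (g 1 3) \<inter> path_image c1 \<subseteq> {p 1}" "path_image (g 1 3) \<inter> path_image c2 \<subseteq> {p 3}"
    using III(17-24,29-32) unfolding im A_def by auto
  have PQ: "path_image (g 0 2) \<inter> path_image (g 1 3) = {}" "path_image P \<inter> path_image (g 1 3) = {}"
    "path_image (g 0 2) \<inter> path_image Q = {}"
    using III(33-37) unfolding im A_def by auto
  have pc: "p 1 \<in> path_image c1" "p 3 \<in> path_image c2" unfolding im using ends by auto
  define J where "J = path_image c1 \<union> path_image c2"
  have 1: "(path_image (g 0 2) \<inter> inside J \<noteq> {}) \<noteq> (path_image (g 1 3) \<inter> inside J \<noteq> {})"
    unfolding J_def
    by (rule crossing_chords[OF arcs(1) ends'(1,2) arcs(2) ends'(3,4) g[of 0 2] g[of 1 3] c12 cP(3,4) pc PQ(1) cQ(3,4)]) auto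
  have 2: "(path_image P \<inter> inside J \<noteq> {}) \<noteq> (path_image (g 1 3) \<inter> inside J \<noteq> {})"
    unfolding J_def
    by (rule crossing_chords[OF arcs(1) ends'(1,2) arcs(2) ends'(3,4) arcs(3) ends'(5,6) g[of 1 3] c12 cP(1,2) pc PQ(2) cQ(3,4)]) auto
  have 3: "(path_image (g 0 2) \<inter> inside J \<noteq> {}) \<noteq> (path_image Q \<inter> inside J \<noteq> {})"
    unfolding J_def
    by (rule crossing_chords[OF arcs(1) ends'(1,2) arcs(2) ends'(3,4) g[of 0 2] arcs(4) ends'(7,8) c12 cP(3,4) pc PQ(3) cQ(1,2)]) auto
  have clJ: "closed J" unfolding J_def using arcs by (intro closed_Un closed_arc_image) auto
  have e: "p 0 \<in> J" "p 1 \<in> J" "p 2 \<in> J" "p 3 \<in> J"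
    unfolding J_def im using ends by auto
  \<comment> \<open>If \<open>p 4\<close> were on \<open>J\<close>, it would be an end of both
    \<open>g 0 2\<close> and \<open>g 1 3\<close>, which are disjoint.\<close>
  have p4J: "p 4 \<notin> J"
  proof
    assume "p 4 \<in> J"
    then have "p 4 \<in> {p 0, p 2}" "p 4 \<in> {p 1, p 3}"
      using cP cQ ends[of 0 4] ends[of 1 4] unfolding J_def im by auto
    moreover have "p 0 \<in> A 0 2" "p 2 \<in> A 0 2" "p 1 \<in> A 1 3" "p 3 \<in> A 1 3" using ends by auto
    ultimately show False using III(33) by auto
  qed
  have PJ: "path_image P \<inter> J \<subseteq> {p 0, p 2}" "path_image Q \<inter> J \<subseteq> {p 1, p 3}"
    using cP cQ unfolding J_def by blast+
  have p4: "p 4 \<in> path_image P - {p 0, p 2}" "p 4 \<in> path_image Q - {p 1, p 3}"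
    using ends[of 0 4] ends[of 1 4] p4J e unfolding im by auto
  have "path_image P \<inter> inside J \<noteq> {} \<longleftrightarrow> p 4 \<in> inside J"
    using arc_side_of_interior_point[OF arcs(3) clJ, of "p 4", unfolded ends', OF PJ(1) p4(1) e(1,3)] .
  moreover have "path_image Q \<inter> inside J \<noteq> {} \<longleftrightarrow> p 4 \<in> inside J"
    using arc_side_of_interior_point[OF arcs(4) clJ, of "p 4", unfolded ends', OF PJ(2) p4(2) e(2,4)] .
  ultimately show False using 1 2 3 by blast
qed

section \<open>Periods of subsets of the torus\<close>

definition torus :: "(complex \<times> complex) set" where
  "torus = sphere 0 1 \<times> sphere 0 1"

definition torus_cover :: "complex \<Rightarrow> complex \<times> complex" where
  "torus_cover w = (cis (2 * pi * Re w), cis (2 * pi * Im w))"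

text \<open>The translations by these numbers are the deck transformations of the covering
  \<open>torus_cover\<close>.\<close>

definition gauss_ints :: "complex set" where
  "gauss_ints = {w. Re w \<in> \<int> \<and> Im w \<in> \<int>}"

lemma gauss_ints_iff: "w \<in> gauss_ints \<longleftrightarrow> (\<exists>a b. w = Complex (of_int a) (of_int b))"
  unfolding gauss_ints_def by (auto simp: complex_eq_iff elim!: Ints_cases)

lemma gauss_ints_closed:
  "0 \<in> gauss_ints" "x \<in> gauss_ints \<Longrightarrow> - x \<in> gauss_ints"
  "\<lbrakk>x \<in> gauss_ints; y \<in> gauss_ints\<rbrakk> \<Longrightarrow> x + y \<in> gauss_ints"
  "x \<in> gauss_ints \<Longrightarrow> of_int k * x \<in> gauss_ints"
  by (auto simp: gauss_ints_def)

lemma cis_2pi_eq_iff: "cis (2 * pi * a) = cis (2 * pi * b) \<longleftrightarrow> a - b \<in> \<int>"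
proof -
  have "cis (2 * pi * a) = cis (2 * pi * b) \<longleftrightarrow> cis (2 * pi * a) / cis (2 * pi * b) = 1"
    by (simp add: cis_neq_zero)
  also have "\<dots> \<longleftrightarrow> cis (2 * pi * (a - b)) = 1" by (simp add: cis_divide right_diff_distrib)
  also have "\<dots> \<longleftrightarrow> cos (2 * pi * (a - b)) = 1"
    by (auto simp: complex_eq_iff cos_one_sin_zero)
  also have "\<dots> \<longleftrightarrow> (\<exists>k::int. a - b = k)"
    by (auto simp: cos_one_2pi_int)
  also have "\<dots> \<longleftrightarrow> a - b \<in> \<int>" by (auto elim: Ints_cases)
  finally show ?thesis .
qed

lemma torus_cover_eq_iff: "torus_cover x = torus_cover y \<longleftrightarrow> x - y \<in> gauss_ints"
  unfolding torus_cover_def gauss_ints_def by (simp add: cis_2pi_eq_iff)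

lemma torus_cover_add: "z \<in> gauss_ints \<Longrightarrow> torus_cover (x + z) = torus_cover x"
  by (simp add: torus_cover_eq_iff)

text \<open>The path is lifted through the exponential map onto the punctured plane. Over the unit
  circle the real part of the lift vanishes, and its imaginary part is the angle.\<close>

lemma circle_lift:
  assumes "path g" "path_image g \<subseteq> sphere 0 1" "pathstart g = cis (2 * pi * a)"
  obtains h :: "real \<Rightarrow> real" where "path h" "pathstart h = a" "\<And>t. t \<in> {0..1} \<Longrightarrow> cis (2 * pi * h t) = g t"
proof -
  have "path_image g \<subseteq> - {0}" using assms(2) by auto
  moreover have "pathstart g = exp (\<i> * of_real (2 * pi * a))" using assms(3) by (simp add: cis_conv_exp)
  ultimately obtain k :: "real \<Rightarrow> complex" where k: "path k" "path_image k \<subseteq> UNIV"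
      "pathstart k = \<i> * of_real (2 * pi * a)" "\<And>t. t \<in> {0..1} \<Longrightarrow> exp (k t) = g t"
    by (rule covering_space_lift_path_strong[OF covering_space_exp_punctured_plane UNIV_I assms(1)]) blast
  define h where "h = (\<lambda>t. Im (k t) / (2 * pi))"
  have "path h" unfolding path_def h_def
    by (intro continuous_on_divide continuous_on_Im continuous_on_const k(1)[unfolded path_def]) auto
  moreover have "pathstart h = a" using k(3) by (simp add: h_def pathstart_def)
  moreover have "cis (2 * pi * h t) = g t" if "t \<in> {0..1}" for t
  proof -
    have "g t \<in> path_image g" using that by (simp add: path_image_def)
    then have "g t \<in> sphere 0 1" using assms(2) by blast
    then have "norm (exp (k t)) = 1" using k(4)[OF that] by simp
    then have "Re (k t) = 0" by simp
    then have "exp (k t) = cis (Im (k t))" by (simp add: exp_eq_polar)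
    then show ?thesis using k(4)[OF that] by (simp add: h_def)
  qed
  ultimately show ?thesis using that by blast
qed

lemma torus_lift:
  assumes g: "path g" "path_image g \<subseteq> torus" "pathstart g = torus_cover a"
  obtains h where "path h" "pathstart h = a" "\<And>t. t \<in> {0..1} \<Longrightarrow> torus_cover (h t) = g t"
proof -
  have fs: "path (fst \<circ> g)" "path (snd \<circ> g)"
    using g(1) unfolding path_def o_def by (auto intro: continuous_on_fst continuous_on_snd)
  have im: "path_image (fst \<circ> g) \<subseteq> sphere 0 1" "path_image (snd \<circ> g) \<subseteq> sphere 0 1"
    using g(2) unfolding torus_def path_image_def by (force simp: mem_Times_iff)+
  have st: "pathstart (fst \<circ> g) = cis (2 * pi * Re a)" "pathstart (snd \<circ> g) = cis (2 * pi * Im a)"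
    using g(3) unfolding torus_cover_def pathstart_def by auto
  obtain h where h: "path h" "pathstart h = Re a" "\<And>t. t \<in> {0..1} \<Longrightarrow> cis (2 * pi * h t) = (fst \<circ> g) t"
    by (rule circle_lift[OF fs(1) im(1) st(1)]) blast
  obtain k where k: "path k" "pathstart k = Im a" "\<And>t. t \<in> {0..1} \<Longrightarrow> cis (2 * pi * k t) = (snd \<circ> g) t"
    by (rule circle_lift[OF fs(2) im(2) st(2)]) blast
  show ?thesis
  proof
    show "path (\<lambda>t. Complex (h t) (k t))"
      unfolding path_def
      by (intro continuous_on_Complex h(1)[unfolded path_def] k(1)[unfolded path_def])
    show "pathstart (\<lambda>t. Complex (h t) (k t)) = a" using h(2) k(2) unfolding pathstart_def by (simp add: complex_eq_iff)
    show "\<And>t. t \<in> {0..1} \<Longrightarrow> torus_cover (Complex (h t) (k t)) = g t"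
      using h(3) k(3) by (simp add: torus_cover_def)
  qed
qed

lemma torus_cover_surj:
  assumes "q \<in> torus" obtains x where "torus_cover x = q"
proof -
  obtain a b where q: "q = (a, b)" "cmod a = 1" "cmod b = 1"
    using assms unfolding torus_def by (cases q) auto
  have arg: "cis (Arg c) = c" if "cmod c = 1" for c
  proof -
    have "c \<noteq> 0" using that by auto
    then show ?thesis using cis_Arg[of c] that by (simp add: sgn_div_norm)
  qed
  then have "torus_cover (Complex (Arg a / (2 * pi)) (Arg b / (2 * pi))) = q"
    unfolding torus_cover_def q(1) using arg[OF q(2)] arg[OF q(3)] by simp
  then show ?thesis using that by blast
qed

text \<open>The translations that carry some point of the preimage of \<open>A\<close> to a point of the same path
  component; these are the homology classes of the loops in \<open>A\<close>.\<close>

definition periods :: "(complex \<times> complex) set \<Rightarrow> complex set" where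
  "periods A = {z \<in> gauss_ints. \<exists>x. path_component (torus_cover -` A) x (x + z)}"

text \<open>Successive translates of \<open>p\<close> by multiples of \<open>z\<close> fit together.
  There are \<open>Suc n\<close> of them, with offsets from 0 to \<open>n\<close>; the description
  of the image keeps the long path near a line in direction \<open>z\<close>.\<close>

lemma path_iterate_period:
  fixes p :: "real \<Rightarrow> complex"
  assumes p: "path p" "pathfinish p = pathstart p + z"
  shows "\<exists>P. path P \<and> pathstart P = pathstart p \<and> pathfinish P = pathstart p + of_nat (Suc n) * z \<and>
             path_image P \<subseteq> {x + of_nat k * z | x k. x \<in> path_image p \<and> k \<le> n}"
proof (induction n)
  case 0
  have "path_image p \<subseteq> {x + of_nat k * z | x k. x \<in> path_image p \<and> k \<le> 0}" by auto
  then show ?case using p by (intro exI[of _ p]) simp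
next
  case (Suc n)
  then obtain P where P: "path P" "pathstart P = pathstart p" "pathfinish P = pathstart p + of_nat (Suc n) * z"
    "path_image P \<subseteq> {x + of_nat k * z | x k. x \<in> path_image p \<and> k \<le> n}" by blast
  define q where "q = (\<lambda>t. p t + of_nat (Suc n) * z)"
  have "path q" unfolding path_def q_def
    by (intro continuous_on_add continuous_on_const p(1)[unfolded path_def])
  then have q: "path q" "pathstart q = pathstart p + of_nat (Suc n) * z"
    "pathfinish q = pathstart p + of_nat (Suc (Suc n)) * z"
    "path_image q = (\<lambda>x. x + of_nat (Suc n) * z) ` path_image p"
    using p(2) unfolding q_def pathstart_def pathfinish_def path_image_def
    by (auto simp: algebra_simps image_image)
  have "path_image (P +++ q) = path_image P \<union> path_image q"
    using P q by (simp add: path_image_join)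
  also have "\<dots> \<subseteq> {x + of_nat k * z | x k. x \<in> path_image p \<and> k \<le> Suc n}"
  proof (rule Un_least)
    show "path_image P \<subseteq> {x + of_nat k * z | x k. x \<in> path_image p \<and> k \<le> Suc n}"
      using P(4) by (rule subset_trans) (blast intro: le_SucI)
    show "path_image q \<subseteq> {x + of_nat k * z | x k. x \<in> path_image p \<and> k \<le> Suc n}"
      unfolding q(4) by blast
  qed
  finally show ?case using P q by (intro exI[of _ "P +++ q"]) simp
qed

lemma closed_segment_component_bounds:
  fixes a :: "real^'n"
  assumes "z \<in> closed_segment a b" "a $ i \<le> b $ i"
  shows "a $ i \<le> z $ i" "z $ i \<le> b $ i"
proof -
  obtain u where "z = (1 - u) *\<^sub>R a + u *\<^sub>R b" "0 \<le> u" "u \<le> 1"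
    using assms(1) unfolding in_segment by blast
  then have "z $ i \<in> closed_segment (a $ i) (b $ i)" unfolding in_segment by (intro exI[of _ u]) simp
  then show "a $ i \<le> z $ i" "z $ i \<le> b $ i"
    unfolding closed_segment_eq_real_ivl1[OF assms(2)] by auto
qed

text \<open>Otherwise the lifts of \<open>A\<close> and \<open>B\<close> contain long curves in two transversal directions, each
  staying close to a straight line; after a linear change of coordinates and an extension by
  straight segments to the boundary of a box, they meet by Fashoda's theorem.\<close>

lemma disjoint_periods_parallel:
  assumes AB: "A \<inter> B = {}" and z: "z \<in> periods A" and w: "w \<in> periods B"
  shows "Im (cnj z * w) = 0"
proof (rule ccontr)
  define D where "D = Im (cnj z * w)"
  assume "Im (cnj z * w) \<noteq> 0"
  then have D: "D \<noteq> 0" by (simp add: D_def)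
  obtain p where p: "path p" "path_image p \<subseteq> torus_cover -` A" "pathfinish p = pathstart p + z"
    using z unfolding periods_def path_component_def by auto
  obtain q where q: "path q" "path_image q \<subseteq> torus_cover -` B" "pathfinish q = pathstart q + w"
    using w unfolding periods_def path_component_def by auto
  have zw: "z \<in> gauss_ints" "w \<in> gauss_ints" using z w unfolding periods_def by auto
  \<comment> \<open>By Cramer's rule, \<open>s\<close> and \<open>t\<close> are the real coordinates
    with respect to the basis \<open>z\<close>, \<open>w\<close>.\<close>
  define s where "s x = Im (cnj x * w) / D" for x
  define t where "t x = Im (cnj z * x) / D" for x
  have lin: "s (x + of_real c * y) = s x + c * s y" "t (x + of_real c * y) = t x + c * t y" for x y c
    unfolding s_def t_def using D by (auto simp: field_simps)
  have st: "s z = 1" "t z = 0" "s w = 0" "t w = 1"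
    unfolding s_def t_def using D by (auto simp: D_def)
  have st_inj: "x = y" if "s x = s y" "t x = t y" for x y
  proof -
    define a b where "a = Re x - Re y" and "b = Im x - Im y"
    have e: "a * Im w = b * Re w" "a * Im z = b * Re z"
      using that D unfolding s_def t_def a_def b_def by (auto simp: field_simps)
    have D': "D = Re z * Im w - Im z * Re w" by (simp add: D_def)
    have "a * D = Re z * (a * Im w) - (a * Im z) * Re w" by (simp add: D' algebra_simps)
    then have aD: "a * D = 0" unfolding e by (simp add: algebra_simps)
    have "b * D = (b * Re z) * Im w - Im z * (b * Re w)" by (simp add: D' algebra_simps)
    then have bD: "b * D = 0" unfolding e[symmetric] by (simp add: algebra_simps)
    have "a = 0" "b = 0" using D aD bD by auto
    then show ?thesis by (simp add: complex_eq_iff a_def b_def)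
  qed
  have cst: "continuous_on S s" "continuous_on S t" for S
    unfolding s_def[abs_def] t_def[abs_def]
    by (intro continuous_on_divide continuous_on_Im
        continuous_on_mult continuous_on_const continuous_on_cnj continuous_on_id, use D in simp)+
  have "compact (path_image p \<union> path_image q)" using p q by (intro compact_Un compact_path_image)
  then have "bounded (s ` (path_image p \<union> path_image q) \<union> t ` (path_image p \<union> path_image q))"
    using cst by (intro bounded_Un[THEN iffD2] conjI compact_imp_bounded compact_continuous_image) auto
  then obtain b where b: "\<And>x. x \<in> path_image p \<union> path_image q \<Longrightarrow> \<bar>s x\<bar> \<le> b \<and> \<bar>t x\<bar> \<le> b"
    unfolding bounded_iff by fastforce
  \<comment> \<open>\<open>b\<close> bounds the coordinates of both loops. With \<open>N\<close>
    periods to either side, the ends of each long curve lie beyond the strip of half-width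
    \<open>b\<close> that contains the other one.\<close>
  obtain N :: nat where N: "real N > 2 * b + 1" using reals_Archimedean2 by blast
  have p0: "pathstart p \<in> path_image p \<union> path_image q" "pathstart q \<in> path_image p \<union> path_image q" by auto
  have b0: "b \<ge> 0" using b[OF p0(1)] by linarith
  \<comment> \<open>\<open>path_iterate_period\<close> counts \<open>Suc n\<close> translates, and
    \<open>2 * N\<close> of them are wanted.\<close>
  have N0: "Suc (2 * N - 1) = 2 * N" using N b0 by auto
  obtain P where P: "path P" "pathstart P = pathstart p" "pathfinish P = pathstart p + of_nat (2 * N) * z"
    "path_image P \<subseteq> {x + of_nat k * z | x k. x \<in> path_image p \<and> k \<le> 2 * N - 1}"
    using path_iterate_period[OF p(1,3), of "2 * N - 1"] unfolding N0 by blast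
  obtain Q where Q: "path Q" "pathstart Q = pathstart q" "pathfinish Q = pathstart q + of_nat (2 * N) * w"
    "path_image Q \<subseteq> {x + of_nat k * w | x k. x \<in> path_image q \<and> k \<le> 2 * N - 1}"
    using path_iterate_period[OF q(1,3), of "2 * N - 1"] unfolding N0 by blast
  define \<Phi> :: "complex \<Rightarrow> real^2" where "\<Phi> x = s x *\<^sub>R axis 1 1 + t x *\<^sub>R axis 2 1" for x
  have \<Phi>: "\<Phi> x $ 1 = s x" "\<Phi> x $ 2 = t x" for x unfolding \<Phi>_def by (auto simp: axis_def)
  define M where "M = real N"
  \<comment> \<open>Offsets from \<open>- N\<close> to \<open>N - 1\<close> periods and a deviation
    of at most \<open>b\<close> stay within \<open>L\<close>, the half-side of the box.\<close>
  define L where "L = M + b"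
  have Mb: "M > 2 * b + 1" using N M_def by simp
  define f where "f = (\<lambda>\<tau>. \<Phi> (P \<tau> + of_real (- M) * z))"
  define g where "g = (\<lambda>\<tau>. \<Phi> (Q \<tau> + of_real (- M) * w))"
  have cPhi: "continuous_on S (\<lambda>x. \<Phi> (h x))" if "continuous_on S h" for S and h :: "real \<Rightarrow> complex"
    unfolding \<Phi>_def s_def t_def
    by (intro continuous_on_add continuous_on_scaleR continuous_on_divide continuous_on_Im
        continuous_on_mult continuous_on_const continuous_on_cnj that) (use D in auto)
  have fg: "path f" "path g" unfolding f_def g_def path_def
    by (intro cPhi continuous_on_add continuous_on_const P(1)[unfolded path_def] Q(1)[unfolded path_def])+
  have fim: "\<exists>x. torus_cover x \<in> A \<and> y = \<Phi> x \<and> \<bar>t x\<bar> \<le> b \<and> \<bar>s x\<bar> \<le> L" if yf: "y \<in> path_image f" for y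
  proof -
    obtain x where x: "x \<in> path_image P" "y = \<Phi> (x + of_real (- M) * z)"
      using yf unfolding f_def path_image_def by blast
    obtain x' k where k: "x = x' + of_nat k * z" "x' \<in> path_image p" "k \<le> 2 * N - 1" using x(1) P(4) by blast
    \<comment> \<open>The real form of the offset serves the linear coordinates, the integral form
      the invariance of \<open>torus_cover\<close>.\<close>
    have e: "x + of_real (- M) * z = x' + of_real (real k - M) * z" by (simp add: k algebra_simps)
    have e': "x + of_real (- M) * z = x' + of_int (int k - int N) * z" by (simp add: k M_def algebra_simps)
    have "torus_cover (x + of_real (- M) * z) \<in> A"
      unfolding e' torus_cover_add[OF gauss_ints_closed(4)[OF zw(1)]] using k(2) p(2) by auto
    moreover have "\<bar>t (x + of_real (- M) * z)\<bar> \<le> b" "\<bar>s (x + of_real (- M) * z)\<bar> \<le> L"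
      unfolding e lin st L_def using b[of x'] k(2,3) N0 unfolding M_def by auto
    ultimately show ?thesis using x by blast
  qed
  have gim: "\<exists>x. torus_cover x \<in> B \<and> y = \<Phi> x \<and> \<bar>s x\<bar> \<le> b \<and> \<bar>t x\<bar> \<le> L" if yg: "y \<in> path_image g" for y
  proof -
    obtain x where x: "x \<in> path_image Q" "y = \<Phi> (x + of_real (- M) * w)"
      using yg unfolding g_def path_image_def by blast
    obtain x' k where k: "x = x' + of_nat k * w" "x' \<in> path_image q" "k \<le> 2 * N - 1" using x(1) Q(4) by blast
    have e: "x + of_real (- M) * w = x' + of_real (real k - M) * w" by (simp add: k algebra_simps)
    have e': "x + of_real (- M) * w = x' + of_int (int k - int N) * w" by (simp add: k M_def algebra_simps)
    have "torus_cover (x + of_real (- M) * w) \<in> B"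
      unfolding e' torus_cover_add[OF gauss_ints_closed(4)[OF zw(2)]] using k(2) q(2) by auto
    moreover have "\<bar>s (x + of_real (- M) * w)\<bar> \<le> b" "\<bar>t (x + of_real (- M) * w)\<bar> \<le> L"
      unfolding e lin st L_def using b[of x'] k(2,3) N0 unfolding M_def by auto
    ultimately show ?thesis using x by blast
  qed
  define x0 y0 where "x0 = pathstart p" and "y0 = pathstart q"
  have b_ends: "\<bar>s x0\<bar> \<le> b" "\<bar>t x0\<bar> \<le> b" "\<bar>s y0\<bar> \<le> b" "\<bar>t y0\<bar> \<le> b"
    using b[OF p0(1)] b[OF p0(2)] unfolding x0_def y0_def by blast+
  have f_ends: "pathstart f $ 1 = s x0 - M" "pathstart f $ 2 = t x0"
      "pathfinish f $ 1 = s x0 + M" "pathfinish f $ 2 = t x0"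
  proof -
    have "pathfinish f = \<Phi> (x0 + of_real M * z)" "pathstart f = \<Phi> (x0 + of_real (- M) * z)"
      using P(2,3) unfolding f_def x0_def pathfinish_def pathstart_def by (auto simp: M_def algebra_simps)
    then show "pathstart f $ 1 = s x0 - M" "pathstart f $ 2 = t x0"
      "pathfinish f $ 1 = s x0 + M" "pathfinish f $ 2 = t x0" by (simp_all only: \<Phi> lin st)
  qed
  have g_ends: "pathstart g $ 1 = s y0" "pathstart g $ 2 = t y0 - M"
      "pathfinish g $ 1 = s y0" "pathfinish g $ 2 = t y0 + M"
  proof -
    have "pathfinish g = \<Phi> (y0 + of_real M * w)" "pathstart g = \<Phi> (y0 + of_real (- M) * w)"
      using Q(2,3) unfolding g_def y0_def pathfinish_def pathstart_def by (auto simp: M_def algebra_simps)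
    then show "pathstart g $ 1 = s y0" "pathstart g $ 2 = t y0 - M"
      "pathfinish g $ 1 = s y0" "pathfinish g $ 2 = t y0 + M" by (simp_all only: \<Phi> lin st)
  qed
  define pr :: "real \<Rightarrow> real \<Rightarrow> real^2" where "pr a c = a *\<^sub>R axis 1 1 + c *\<^sub>R axis 2 1" for a c
  have pr: "pr a c $ 1 = a" "pr a c $ 2 = c" for a c unfolding pr_def by (auto simp: axis_def)
  \<comment> \<open>Straight extensions to the sides of the box: the second coordinate is constant
    along those of \<open>f\<close>, the first along those of \<open>g\<close>.\<close>
  define l1 l2 where "l1 = linepath (pr (- L) (t x0)) (pathstart f)" and "l2 = linepath (pathfinish f) (pr L (t x0))"
  define m1 m2 where "m1 = linepath (pr (s y0) (- L)) (pathstart g)" and "m2 = linepath (pathfinish g) (pr (s y0) L)"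
  have l: "\<bar>y $ 1\<bar> > b \<and> \<bar>y $ 1\<bar> \<le> L \<and> y $ 2 = t x0" if "y \<in> path_image l1 \<union> path_image l2" for y
    using that
  proof
    assume "y \<in> path_image l1"
    then have "y \<in> closed_segment (pr (- L) (t x0)) (pathstart f)" unfolding l1_def by simp
    from closed_segment_component_bounds[OF this, of 1] closed_segment_component_bounds[OF this, of 2]
    have "- L \<le> y $ 1" "y $ 1 \<le> s x0 - M" "y $ 2 = t x0" using b_ends unfolding f_ends pr L_def by linarith+
    then show ?thesis using b_ends Mb b0 unfolding L_def by linarith
  next
    assume "y \<in> path_image l2"
    then have "y \<in> closed_segment (pathfinish f) (pr L (t x0))" unfolding l2_def by simp
    from closed_segment_component_bounds[OF this, of 1] closed_segment_component_bounds[OF this, of 2]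
    have "s x0 + M \<le> y $ 1" "y $ 1 \<le> L" "y $ 2 = t x0" using b_ends unfolding f_ends pr L_def by linarith+
    then show ?thesis using b_ends Mb b0 unfolding L_def by linarith
  qed
  have m: "\<bar>y $ 2\<bar> > b \<and> \<bar>y $ 2\<bar> \<le> L \<and> y $ 1 = s y0" if "y \<in> path_image m1 \<union> path_image m2" for y
    using that
  proof
    assume "y \<in> path_image m1"
    then have "y \<in> closed_segment (pr (s y0) (- L)) (pathstart g)" unfolding m1_def by simp
    from closed_segment_component_bounds[OF this, of 1] closed_segment_component_bounds[OF this, of 2]
    have "- L \<le> y $ 2" "y $ 2 \<le> t y0 - M" "y $ 1 = s y0" using b_ends unfolding g_ends pr L_def by linarith+
    then show ?thesis using b_ends Mb b0 unfolding L_def by linarith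
  next
    assume "y \<in> path_image m2"
    then have "y \<in> closed_segment (pathfinish g) (pr (s y0) L)" unfolding m2_def by simp
    from closed_segment_component_bounds[OF this, of 1] closed_segment_component_bounds[OF this, of 2]
    have "t y0 + M \<le> y $ 2" "y $ 2 \<le> L" "y $ 1 = s y0" using b_ends unfolding g_ends pr L_def by linarith+
    then show ?thesis using b_ends Mb b0 unfolding L_def by linarith
  qed
  have f': "\<bar>y $ 2\<bar> \<le> b \<and> \<bar>y $ 1\<bar> \<le> L" if "y \<in> path_image f" for y
    using fim[OF that] \<Phi> by auto
  have g': "\<bar>y $ 1\<bar> \<le> b \<and> \<bar>y $ 2\<bar> \<le> L" if "y \<in> path_image g" for y
    using gim[OF that] \<Phi> by auto
  define F G where "F = l1 +++ (f +++ l2)" and "G = m1 +++ (g +++ m2)"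
  have FG: "path F" "path G" "path_image F = path_image l1 \<union> path_image f \<union> path_image l2"
    "path_image G = path_image m1 \<union> path_image g \<union> path_image m2"
    unfolding F_def G_def using fg unfolding l1_def l2_def m1_def m2_def
    by (auto simp: path_image_join)
  have bL: "b \<le> L" using Mb b0 L_def by simp
  have boxF: "path_image F \<subseteq> cbox (pr (- L) (- L)) (pr L L)"
  proof
    fix y assume "y \<in> path_image F"
    then consider "y \<in> path_image l1 \<union> path_image l2" | "y \<in> path_image f" using FG by blast
    then have "\<bar>y $ 1\<bar> \<le> L \<and> \<bar>y $ 2\<bar> \<le> L"
      by cases (use l[of y] f'[of y] b_ends bL in linarith)+
    then show "y \<in> cbox (pr (- L) (- L)) (pr L L)" by (auto simp: mem_box_cart forall_2 pr)
  qed
  have boxG: "path_image G \<subseteq> cbox (pr (- L) (- L)) (pr L L)"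
  proof
    fix y assume "y \<in> path_image G"
    then consider "y \<in> path_image m1 \<union> path_image m2" | "y \<in> path_image g" using FG by blast
    then have "\<bar>y $ 1\<bar> \<le> L \<and> \<bar>y $ 2\<bar> \<le> L"
      by cases (use m[of y] g'[of y] b_ends bL in linarith)+
    then show "y \<in> cbox (pr (- L) (- L)) (pr L L)" by (auto simp: mem_box_cart forall_2 pr)
  qed
  obtain y where y: "y \<in> path_image F" "y \<in> path_image G"
    by (rule fashoda[OF FG(1,2) boxF boxG])
       (auto simp: F_def G_def l1_def l2_def m1_def m2_def pr)
  \<comment> \<open>Along the extensions of one curve the respective coordinate exceeds
    \<open>b\<close> in absolute value, while on the other curve and its extensions it never does.
    So the meeting point belongs to the translated lifts themselves.\<close>
  have "y \<notin> path_image l1 \<union> path_image l2"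
  proof
    assume a: "y \<in> path_image l1 \<union> path_image l2"
    have "\<bar>y $ 1\<bar> \<le> b" using y(2) m[of y] g'[of y] b_ends unfolding FG(4) by fastforce
    then show False using l[OF a] by simp
  qed
  moreover have "y \<notin> path_image m1 \<union> path_image m2"
  proof
    assume a: "y \<in> path_image m1 \<union> path_image m2"
    have "\<bar>y $ 2\<bar> \<le> b" using y(1) l[of y] f'[of y] b_ends unfolding FG(3) by fastforce
    then show False using m[OF a] by simp
  qed
  ultimately have "y \<in> path_image f" "y \<in> path_image g" using y FG by auto
  then obtain x x' where "torus_cover x \<in> A" "y = \<Phi> x" "torus_cover x' \<in> B" "y = \<Phi> x'"
    using fim gim by meson
  moreover from this have "x = x'" using st_inj \<Phi> by metis
  ultimately show False using AB by blast
qed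

section \<open>Graphs drawn on the torus\<close>

text \<open>\<open>embeds_in\<close> with its witnesses exposed: the periods of several subgraphs
  are compared within one and the same drawing.\<close>

definition drawing :: "'a ugraph \<Rightarrow> 'b::topological_space set \<Rightarrow> ('a \<Rightarrow> 'b) \<Rightarrow> ('a set \<Rightarrow> real \<Rightarrow> 'b) \<Rightarrow> bool" where
  "drawing G S pt curve \<longleftrightarrow>
     inj_on pt (fst G) \<and> pt ` fst G \<subseteq> S \<and>
     (\<forall>e\<in>snd G. arc (curve e) \<and> path_image (curve e) \<subseteq> S \<and>
         {pathstart (curve e), pathfinish (curve e)} = pt ` e \<and>
         path_image (curve e) \<inter> pt ` fst G = pt ` e) \<and>
     (\<forall>e\<in>snd G. \<forall>e'\<in>snd G. e \<noteq> e' \<longrightarrow>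
         path_image (curve e) \<inter> path_image (curve e') = pt ` (e \<inter> e'))"

lemma embeds_in_iff_drawing: "embeds_in G S \<longleftrightarrow> (\<exists>pt curve. drawing G S pt curve)"
  unfolding embeds_in_def drawing_def ..

lemma drawingD:
  assumes "drawing (V, E) S pt curve"
  shows "inj_on pt V" "pt ` V \<subseteq> S"
    "e \<in> E \<Longrightarrow> arc (curve e)" "e \<in> E \<Longrightarrow> path_image (curve e) \<subseteq> S"
    "e \<in> E \<Longrightarrow> {pathstart (curve e), pathfinish (curve e)} = pt ` e"
    "e \<in> E \<Longrightarrow> path_image (curve e) \<inter> pt ` V = pt ` e"
    "\<lbrakk>e \<in> E; e' \<in> E; e \<noteq> e'\<rbrakk> \<Longrightarrow> path_image (curve e) \<inter> path_image (curve e') = pt ` (e \<inter> e')"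
proof -
  note d = assms[unfolded drawing_def fst_conv snd_conv]
  show "inj_on pt V" by (rule conjunct1[OF d])
  show "pt ` V \<subseteq> S" by (rule conjunct1[OF conjunct2[OF d]])
  note d1 = bspec[OF conjunct1[OF conjunct2[OF conjunct2[OF d]]]]
  show "e \<in> E \<Longrightarrow> arc (curve e)" "e \<in> E \<Longrightarrow> path_image (curve e) \<subseteq> S"
    "e \<in> E \<Longrightarrow> {pathstart (curve e), pathfinish (curve e)} = pt ` e"
    "e \<in> E \<Longrightarrow> path_image (curve e) \<inter> pt ` V = pt ` e"
    by (drule d1, elim conjE, assumption)+
  show "\<lbrakk>e \<in> E; e' \<in> E; e \<noteq> e'\<rbrakk> \<Longrightarrow> path_image (curve e) \<inter> path_image (curve e') = pt ` (e \<inter> e')"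
    by (rule conjunct2[OF conjunct2[OF conjunct2[OF d]], rule_format])
qed

definition simple_graph :: "'a ugraph \<Rightarrow> bool" where
  "simple_graph G \<longleftrightarrow> (\<forall>e\<in>snd G. \<exists>x\<in>fst G. \<exists>y\<in>fst G. x \<noteq> y \<and> e = {x, y})"

lemma drawing_mono:
  assumes d: "drawing (V, E) S pt curve" and V': "V' \<subseteq> V" and E': "E' \<subseteq> E" and s: "simple_graph (V', E')"
  shows "drawing (V', E') S pt curve"
proof -
  have sub: "e \<subseteq> V'" if "e \<in> E'" for e using s that unfolding simple_graph_def by auto
  have "path_image (curve e) \<inter> pt ` V' = pt ` e" if "e \<in> E'" for e
  proof -
    have eq: "path_image (curve e) \<inter> pt ` V = pt ` e" using drawingD(6)[OF d] that E' by blast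
    show ?thesis
    proof
      have "path_image (curve e) \<inter> pt ` V' \<subseteq> path_image (curve e) \<inter> pt ` V" using V' by blast
      then show "path_image (curve e) \<inter> pt ` V' \<subseteq> pt ` e" unfolding eq .
      have "pt ` e \<subseteq> path_image (curve e)" using eq by blast
      then show "pt ` e \<subseteq> path_image (curve e) \<inter> pt ` V'" using sub[OF that] by blast
    qed
  qed
  moreover have "inj_on pt V'" using drawingD(1)[OF d] V' by (rule inj_on_subset)
  moreover have "pt ` V' \<subseteq> S" using drawingD(2)[OF d] V' by blast
  ultimately show ?thesis
    using drawingD(3-5,7)[OF d] E' unfolding drawing_def fst_conv snd_conv by (meson subsetD)
qed

lemma embeds_in_mono:
  assumes "embeds_in (V, E) S" "V' \<subseteq> V" "E' \<subseteq> E" "simple_graph (V', E')"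
  shows "embeds_in (V', E') S"
proof -
  obtain pt curve where "drawing (V, E) S pt curve" using assms(1) unfolding embeds_in_iff_drawing by blast
  from drawing_mono[OF this assms(2-4)] show ?thesis unfolding embeds_in_iff_drawing by blast
qed

text \<open>This serves both the passage from the surface with one handle to the torus and that from
  the plane to the sphere.\<close>

lemma embeds_in_continuous_injection:
  assumes G: "embeds_in G S" and f: "continuous_on S f" "inj_on f S" "f ` S \<subseteq> S'"
  shows "embeds_in G S'"
proof -
  obtain V E where VE: "G = (V, E)" by (cases G)
  obtain pt curve where d: "drawing (V, E) S pt curve" using G unfolding embeds_in_iff_drawing VE by blast
  note D = drawingD[OF d]
  have fint: "f ` A \<inter> f ` B = f ` (A \<inter> B)" if "A \<subseteq> S" "B \<subseteq> S" for A B
    using inj_on_image_Int[OF f(2) that] by simp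
  have "drawing (V, E) S' (f \<circ> pt) (\<lambda>e. f \<circ> curve e)"
    unfolding drawing_def fst_conv snd_conv
  proof (intro conjI ballI impI)
    show "inj_on (f \<circ> pt) V" using D(1,2) f(2) by (auto intro: comp_inj_on inj_on_subset)
    show "(f \<circ> pt) ` V \<subseteq> S'" using D(2) f(3) by auto
    fix e assume e: "e \<in> E"
    show "arc (f \<circ> curve e)"
      using D(3,4)[OF e] f by (intro arc_continuous_image) (auto intro: continuous_on_subset inj_on_subset)
    show "path_image (f \<circ> curve e) \<subseteq> S'" unfolding path_image_compose using D(4)[OF e] f(3) by blast
    have "{pathstart (f \<circ> curve e), pathfinish (f \<circ> curve e)} = f ` {pathstart (curve e), pathfinish (curve e)}"
      by (simp add: pathstart_compose pathfinish_compose)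
    then show "{pathstart (f \<circ> curve e), pathfinish (f \<circ> curve e)} = (f \<circ> pt) ` e"
      unfolding D(5)[OF e] by (simp add: image_comp)
    show "path_image (f \<circ> curve e) \<inter> (f \<circ> pt) ` V = (f \<circ> pt) ` e"
      unfolding path_image_compose image_comp[symmetric] fint[OF D(4)[OF e] D(2)] D(6)[OF e] ..
    fix e' assume e': "e' \<in> E" "e \<noteq> e'"
    show "path_image (f \<circ> curve e) \<inter> path_image (f \<circ> curve e') = (f \<circ> pt) ` (e \<inter> e')"
      unfolding path_image_compose image_comp[symmetric] fint[OF D(4)[OF e] D(4)[OF e'(1)]] D(7)[OF e e'] ..
  qed
  then show ?thesis unfolding embeds_in_iff_drawing VE by blast
qed

text \<open>The curve of an edge comes without a direction; lifting it from a chosen point over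
  \<open>pt x\<close> requires it to start at \<open>pt x\<close>.\<close>

definition oriented :: "('a \<Rightarrow> 'b) \<Rightarrow> ('a set \<Rightarrow> real \<Rightarrow> 'b) \<Rightarrow> 'a \<Rightarrow> 'a \<Rightarrow> real \<Rightarrow> 'b::topological_space" where
  "oriented pt curve x y =
     (if pathstart (curve {x, y}) = pt x then curve {x, y} else reversepath (curve {x, y}))"

lemma oriented:
  assumes "drawing (V, E) S pt curve" "{x, y} \<in> E"
  shows "arc (oriented pt curve x y)" "pathstart (oriented pt curve x y) = pt x"
    "pathfinish (oriented pt curve x y) = pt y"
    "path_image (oriented pt curve x y) = path_image (curve {x, y})"
proof -
  note D = drawingD[OF assms(1)]
  have e: "{pathstart (curve {x, y}), pathfinish (curve {x, y})} = {pt x, pt y}"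
    using D(5)[OF assms(2)] by simp
  show "arc (oriented pt curve x y)" "pathstart (oriented pt curve x y) = pt x"
    "pathfinish (oriented pt curve x y) = pt y"
    "path_image (oriented pt curve x y) = path_image (curve {x, y})"
    using D(3)[OF assms(2)] e unfolding oriented_def
    by (auto simp: arc_reversepath doubleton_eq_iff)
qed

lemma oriented_disjoint:
  assumes "drawing (V, E) S pt curve" "{x, y} \<in> E" "{x', y'} \<in> E" "{x, y} \<noteq> {x', y'}"
  shows "path_image (oriented pt curve x y) \<inter> path_image (oriented pt curve x' y') = pt ` ({x, y} \<inter> {x', y'})"
  unfolding oriented(4)[OF assms(1,2)] oriented(4)[OF assms(1,3)] by (rule drawingD(7)[OF assms])

definition drawn :: "'a ugraph \<Rightarrow> ('a \<Rightarrow> 'b) \<Rightarrow> ('a set \<Rightarrow> real \<Rightarrow> 'b) \<Rightarrow> 'b::topological_space set" where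
  "drawn G pt curve = pt ` fst G \<union> (\<Union>e\<in>snd G. path_image (curve e))"

lemma drawn_disjoint:
  assumes d: "drawing (V, E) S pt curve" and "V1 \<subseteq> V" "V2 \<subseteq> V" "E1 \<subseteq> E" "E2 \<subseteq> E"
    and "simple_graph (V1, E1)" "simple_graph (V2, E2)" and V: "V1 \<inter> V2 = {}"
  shows "drawn (V1, E1) pt curve \<inter> drawn (V2, E2) pt curve = {}"
proof -
  note D = drawingD[OF d]
  have s1: "e \<subseteq> V1 \<and> e \<noteq> {}" if "e \<in> E1" for e using assms(6) that unfolding simple_graph_def by auto
  have s2: "e \<subseteq> V2 \<and> e \<noteq> {}" if "e \<in> E2" for e using assms(7) that unfolding simple_graph_def by auto
  have int: "pt ` A \<inter> pt ` B = pt ` (A \<inter> B)" if "A \<subseteq> V" "B \<subseteq> V" for A B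
    using inj_on_image_Int[OF D(1) that] by simp
  have 1: "pt ` V1 \<inter> pt ` V2 = {}" using int assms(2,3) V by simp
  have 2: "path_image (curve e) \<inter> pt ` V2 = {}" if "e \<in> E1" for e
    using D(6)[of e] that assms(2-4) s1[OF that] 1 by blast
  have 3: "pt ` V1 \<inter> path_image (curve e) = {}" if "e \<in> E2" for e
    using D(6)[of e] that assms(2-5) s2[OF that] 1 by blast
  have 4: "path_image (curve e) \<inter> path_image (curve e') = {}" if "e \<in> E1" "e' \<in> E2" for e e'
  proof -
    have "e \<inter> e' = {}" "e \<noteq> e'" using s1[OF that(1)] s2[OF that(2)] V by blast+
    then show ?thesis using D(7)[of e e'] that assms(4,5) by auto
  qed
  define U1 U2 where "U1 = (\<Union>e\<in>E1. path_image (curve e))" and "U2 = (\<Union>e\<in>E2. path_image (curve e))"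
  have "U1 \<inter> pt ` V2 = {}" unfolding U1_def using 2 by blast
  moreover have "pt ` V1 \<inter> U2 = {}" unfolding U2_def using 3 by blast
  moreover have "U1 \<inter> U2 = {}" unfolding U1_def U2_def using 4 by blast
  ultimately show ?thesis
    unfolding drawn_def fst_conv snd_conv U1_def[symmetric] U2_def[symmetric]
    by (simp only: Int_Un_distrib Int_Un_distrib2 1 Un_empty_left)
qed

text \<open>The map \<open>\<psi> z = exp (2 \<pi> \<i> z / w)\<close> identifies exactly the points that differ by integer
  multiples of \<open>w\<close>. Since these have the same image on the torus, \<open>\<psi>\<close> turns the lifted curves
  into a drawing in the plane.\<close>

lemma planar_of_lift:
  assumes d: "drawing (V, E) torus pt curve" and s: "simple_graph (V, E)"
    and Q: "\<And>v. v \<in> V \<Longrightarrow> torus_cover (Q v) = pt v"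
    and w: "w \<in> gauss_ints" "w \<noteq> 0"
    and L: "\<And>e. e \<in> E \<Longrightarrow> \<exists>x y h k. e = {x, y} \<and> path h \<and> pathstart h = Q x \<and>
               pathfinish h = Q y + of_int k * w \<and>
               (\<forall>t\<in>{0..1}. torus_cover (h t) = oriented pt curve x y t)"
  shows "embeds_in (V, E) (UNIV :: complex set)"
proof -
  note D = drawingD[OF d]
  define \<psi> where "\<psi> z = exp (2 * pi * \<i> * (z / w))" for z
  have \<psi>_eq: "\<psi> a = \<psi> b \<longleftrightarrow> (\<exists>k::int. a = b + of_int k * w)" for a b
  proof -
    have "\<psi> a = \<psi> b \<longleftrightarrow> (\<exists>k::int. 2 * pi * \<i> * (a / w) = 2 * pi * \<i> * (b / w) + of_int (2 * k) * pi * \<i>)"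
      unfolding \<psi>_def exp_eq by simp
    also have "\<dots> \<longleftrightarrow> (\<exists>k::int. a / w = b / w + of_int k)"
    proof (rule ex_cong1)
      fix k :: int
      have "2 * pi * \<i> * (b / w) + of_int (2 * k) * pi * \<i> = 2 * pi * \<i> * (b / w + of_int k)"
        by (simp add: algebra_simps)
      then show "(2 * pi * \<i> * (a / w) = 2 * pi * \<i> * (b / w) + of_int (2 * k) * pi * \<i>) =
                 (a / w = b / w + of_int k)"
        using mult_left_cancel[of "2 * pi * \<i>" "a / w" "b / w + of_int k"] by (simp only:) simp
    qed
    also have "\<dots> \<longleftrightarrow> (\<exists>k::int. a = b + of_int k * w)"
      using w(2) by (simp add: field_simps)
    finally show ?thesis .
  qed
  have \<psi>_cover: "torus_cover a = torus_cover b" if ab: "\<psi> a = \<psi> b" for a b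
  proof -
    obtain k :: int where "a = b + of_int k * w" using ab unfolding \<psi>_eq by blast
    then show ?thesis using torus_cover_add[OF gauss_ints_closed(4)[OF w(1)]] by simp
  qed
  have c\<psi>: "continuous_on S \<psi>" for S
    unfolding \<psi>_def[abs_def]
    by (intro continuous_on_exp continuous_on_mult continuous_on_divide continuous_on_const continuous_on_id)
       (use w in auto)
  obtain fx fy fh where L': "\<And>e. e \<in> E \<Longrightarrow> e = {fx e, fy e} \<and> path (fh e) \<and> pathstart (fh e) = Q (fx e) \<and>
               (\<exists>k. pathfinish (fh e) = Q (fy e) + of_int k * w) \<and>
               (\<forall>t\<in>{0..1}. torus_cover (fh e t) = oriented pt curve (fx e) (fy e) t)"
    using L by metis
  define pt' where "pt' v = \<psi> (Q v)" for v
  define g where "g e = oriented pt curve (fx e) (fy e)" for e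
  define c where "c e = \<psi> \<circ> fh e" for e
  have g: "arc (g e)" "pathstart (g e) = pt (fx e)" "pathfinish (g e) = pt (fy e)"
    "path_image (g e) = path_image (curve e)" if e: "e \<in> E" for e
  proof -
    have "{fx e, fy e} = e" using L'[OF e] by blast
    then show "arc (g e)" "pathstart (g e) = pt (fx e)" "pathfinish (g e) = pt (fy e)"
    "path_image (g e) = path_image (curve e)"
      using oriented[OF d, of "fx e" "fy e"] e unfolding g_def by auto
  qed
  have cov: "torus_cover (fh e t) = g e t" if "e \<in> E" "t \<in> {0..1}" for e t
    using L'[OF that(1)] that(2) unfolding g_def by blast
  have c_ends: "pathstart (c e) = pt' (fx e)" "pathfinish (c e) = pt' (fy e)" if e: "e \<in> E" for e
  proof -
    show "pathstart (c e) = pt' (fx e)" using L'[OF e] unfolding c_def pt'_def by (simp add: pathstart_compose)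
    have "\<psi> (pathfinish (fh e)) = \<psi> (Q (fy e))" using L'[OF e] unfolding \<psi>_eq by blast
    then show "pathfinish (c e) = pt' (fy e)" unfolding c_def pt'_def by (simp add: pathfinish_compose)
  qed
  \<comment> \<open>Two curves may meet over a vertex of the torus. The point of \<open>c e\<close>
    there is the chosen \<open>pt' v\<close> and not the image of another lift of that vertex,
    because a curve passes a vertex only at its ends.\<close>
  have key: "c e t = pt' v" if e: "e \<in> E" and t: "t \<in> {0..1}" and v: "v \<in> V" "g e t = pt v" for e t v
  proof -
    have "g e t \<in> path_image (g e)" using t by (simp add: path_image_def)
    then have "pt v \<in> path_image (curve e) \<inter> pt ` V" using g(4)[OF e] v by simp
    then have "pt v \<in> pt ` e" using D(6)[OF e] by blast
    then obtain x where x: "x \<in> e" "pt v = pt x" by blast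
    have e2: "e = {fx e, fy e}" using L'[OF e] by blast
    have "x = fx e \<or> x = fy e" using x(1) by (subst (asm) e2) blast
    then have "pt v = pt (fx e) \<or> pt v = pt (fy e)" using x(2) by blast
    moreover have "e \<subseteq> V" using s e unfolding simple_graph_def by auto
    moreover have "fx e \<in> e" "fy e \<in> e" by (subst (2) e2, simp)+
    ultimately have "v = fx e \<or> v = fy e" using inj_onD[OF D(1)] v(1) by blast
    then show ?thesis
    proof
      assume vx: "v = fx e"
      then have "g e t = g e 0" using g(2)[OF e] v(2) by (simp add: pathstart_def)
      then have "t = 0" using arcD[OF g(1)[OF e]] t by auto
      then show ?thesis using c_ends(1)[OF e] vx by (simp add: pathstart_def)
    next
      assume vy: "v = fy e"
      then have "g e t = g e 1" using g(3)[OF e] v(2) by (simp add: pathfinish_def)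
      then have "t = 1" using arcD[OF g(1)[OF e]] t by auto
      then show ?thesis using c_ends(2)[OF e] vy by (simp add: pathfinish_def)
    qed
  qed
  have pt'_pt: "torus_cover x = pt v" if "\<psi> x = pt' v" "v \<in> V" for x v
    using \<psi>_cover[of x "Q v"] that Q[OF that(2)] unfolding pt'_def by simp
  have pt'_end: "pt' ` e \<subseteq> path_image (c e)" if e: "e \<in> E" for e
  proof -
    have e2: "e = {fx e, fy e}" using L'[OF e] by blast
    have "pt' (fx e) \<in> path_image (c e)" "pt' (fy e) \<in> path_image (c e)"
      using c_ends[OF e] pathstart_in_path_image[of "c e"] pathfinish_in_path_image[of "c e"] by auto
    then show ?thesis by (subst e2) simp
  qed
  have "drawing (V, E) UNIV pt' c"
    unfolding drawing_def fst_conv snd_conv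
  proof (intro conjI ballI impI)
    show "inj_on pt' V"
    proof (rule inj_onI)
      fix u v assume uv: "u \<in> V" "v \<in> V" "pt' u = pt' v"
      then have "pt u = pt v" using pt'_pt[of "Q u" v] Q[of u] unfolding pt'_def by simp
      then show "u = v" using D(1) uv by (auto dest: inj_onD)
    qed
    fix e assume e: "e \<in> E"
    show "arc (c e)"
      unfolding arc_def
    proof
      show "path (c e)" unfolding c_def using L'[OF e] c\<psi> by (blast intro: path_continuous_image)
      show "inj_on (c e) {0..1}"
      proof (rule inj_onI)
        fix a b assume ab: "a \<in> {0..1}" "b \<in> {0..1}" "c e a = c e b"
        then have "g e a = g e b" using \<psi>_cover[of "fh e a" "fh e b"] cov[OF e] unfolding c_def by simp
        then show "a = b" using arcD[OF g(1)[OF e]] ab by blast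
      qed
    qed
    have e2: "e = {fx e, fy e}" using L'[OF e] by blast
    have "{pathstart (c e), pathfinish (c e)} = pt' ` {fx e, fy e}" using c_ends[OF e] by simp
    then show "{pathstart (c e), pathfinish (c e)} = pt' ` e" by (subst (3) e2)
    show "path_image (c e) \<inter> pt' ` V = pt' ` e"
    proof
      show "path_image (c e) \<inter> pt' ` V \<subseteq> pt' ` e"
      proof
        fix z assume "z \<in> path_image (c e) \<inter> pt' ` V"
        then obtain t v where tv: "t \<in> {0..1}" "v \<in> V" "z = c e t" "z = pt' v" by (auto simp: path_image_def)
        then have "g e t = pt v" using pt'_pt[of "fh e t" v] cov[OF e] unfolding c_def by simp
        moreover have "g e t \<in> path_image (g e)" using tv(1) by (simp add: path_image_def)
        ultimately have "pt v \<in> path_image (curve e) \<inter> pt ` V" using g(4)[OF e] tv(2) by simp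
        then have "pt v \<in> pt ` e" using D(6)[OF e] by blast
        moreover have "e \<subseteq> V" using s e unfolding simple_graph_def by auto
        ultimately have "v \<in> e" using D(1) tv(2) by (auto dest: inj_onD)
        then show "z \<in> pt' ` e" using tv by blast
      qed
      have "e \<subseteq> V" using s e unfolding simple_graph_def by auto
      then show "pt' ` e \<subseteq> path_image (c e) \<inter> pt' ` V" using pt'_end[OF e] by blast
    qed
    fix e' assume e': "e' \<in> E" "e \<noteq> e'"
    show "path_image (c e) \<inter> path_image (c e') = pt' ` (e \<inter> e')"
    proof
      show "pt' ` (e \<inter> e') \<subseteq> path_image (c e) \<inter> path_image (c e')"
        using pt'_end[OF e] pt'_end[OF e'(1)] by blast
      show "path_image (c e) \<inter> path_image (c e') \<subseteq> pt' ` (e \<inter> e')"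
      proof
        fix z assume "z \<in> path_image (c e) \<inter> path_image (c e')"
        then obtain a b where ab: "a \<in> {0..1}" "b \<in> {0..1}" "z = c e a" "z = c e' b" by (auto simp: path_image_def)
        then have gab: "g e a = g e' b" using \<psi>_cover[of "fh e a" "fh e' b"] cov[OF e] cov[OF e'(1)] unfolding c_def by simp
        moreover have "g e a \<in> path_image (g e)" "g e' b \<in> path_image (g e')"
          using ab(1,2) by (simp_all add: path_image_def)
        ultimately have "g e a \<in> path_image (curve e) \<inter> path_image (curve e')"
          using g(4)[OF e] g(4)[OF e'(1)] by simp
        then obtain v where v: "v \<in> e" "v \<in> e'" "g e a = pt v" using D(7)[OF e e'] by auto
        have "v \<in> V" using s e v unfolding simple_graph_def by auto
        then show "z \<in> pt' ` (e \<inter> e')" using key[OF e ab(1) _ v(3)] ab(3) v by blast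
      qed
    qed
  qed auto
  then show ?thesis unfolding embeds_in_iff_drawing by blast
qed

text \<open>Dividing the coordinates of a nonzero element of \<open>P\<close> by their gcd gives a
  primitive vector \<open>w\<close>, which need not lie in \<open>P\<close>. A Bezout relation
  between the coordinates of \<open>w\<close> then computes the factor \<open>k\<close> for any
  parallel lattice vector.\<close>

lemma gauss_ints_collinear_cyclic:
  assumes P: "P \<subseteq> gauss_ints" and par: "\<And>x y. \<lbrakk>x \<in> P; y \<in> P\<rbrakk> \<Longrightarrow> Im (cnj x * y) = 0"
  shows "\<exists>w\<in>gauss_ints. w \<noteq> 0 \<and> (\<forall>x\<in>P. \<exists>k::int. x = of_int k * w)"
proof (cases "P \<subseteq> {0}")
  case True
  then have "\<forall>x\<in>P. \<exists>k::int. x = of_int k * 1" by (intro ballI exI[of _ 0]) auto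
  moreover have "1 \<in> gauss_ints" by (simp add: gauss_ints_def)
  ultimately show ?thesis by (metis zero_neq_one)
next
  case False
  then obtain z where z: "z \<in> P" "z \<noteq> 0" by blast
  then obtain a b where ab: "z = Complex (of_int a) (of_int b)" using P gauss_ints_iff by blast
  define d where "d = gcd a b"
  have d: "d \<noteq> 0" using z(2) ab unfolding d_def by (auto simp: complex_eq_iff)
  obtain a' b' where a'b': "a = a' * d" "b = b' * d"
    unfolding d_def by (metis gcd_dvd1 gcd_dvd2 dvdE mult.commute)
  obtain u v where uv: "u * a + v * b = d" using bezout_int unfolding d_def by blast
  have "(u * a' + v * b') * d = 1 * d" using uv unfolding a'b' by (simp add: algebra_simps)
  then have uv1: "u * a' + v * b' = 1" using d by (metis mult_right_cancel)
  define w where "w = Complex (of_int a') (of_int b')"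
  have "w \<in> gauss_ints" unfolding w_def gauss_ints_iff by blast
  moreover have "w \<noteq> 0"
  proof
    assume "w = 0"
    then have "a' = 0" "b' = 0" unfolding w_def by (auto simp: complex_eq_iff)
    then show False using uv1 by simp
  qed
  moreover have "\<exists>k::int. x = of_int k * w" if x: "x \<in> P" for x
  proof -
    obtain c e where ce: "x = Complex (of_int c) (of_int e)" using x P gauss_ints_iff by blast
    have "real_of_int (a * e - b * c) = 0" using par[OF z(1) x] unfolding ab ce by simp
    then have "a * e - b * c = 0" by linarith
    then have "(a' * e - b' * c) * d = 0" unfolding a'b' by (simp add: algebra_simps)
    then have eq: "a' * e = b' * c" using d by simp
    have "(u * c + v * e) * a' = u * a' * c + v * (a' * e)" by (simp add: algebra_simps)
    also have "\<dots> = (u * a' + v * b') * c" unfolding eq by (simp add: algebra_simps)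
    finally have 1: "(u * c + v * e) * a' = c" using uv1 by simp
    have "(u * c + v * e) * b' = u * (b' * c) + v * b' * e" by (simp add: algebra_simps)
    also have "\<dots> = (u * a' + v * b') * e" unfolding eq[symmetric] by (simp add: algebra_simps)
    finally have 2: "(u * c + v * e) * b' = e" using uv1 by simp
    define k where "k = u * c + v * e"
    have "x = of_int k * w"
      unfolding ce w_def using 1 2 unfolding k_def[symmetric]
      by (simp add: complex_eq_iff flip: of_int_mult)
    then show ?thesis by blast
  qed
  ultimately show ?thesis by blast
qed

lemma edge_lift:
  assumes d: "drawing (V, E) torus pt curve" and e: "{x, y} \<in> E" and a: "torus_cover a = pt x"
  obtains h where "path h" "pathstart h = a" "\<forall>t\<in>{0..1}. torus_cover (h t) = oriented pt curve x y t"
    "torus_cover (pathfinish h) = pt y" "path_image h \<subseteq> torus_cover -` path_image (curve {x, y})"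
proof -
  note o = oriented[OF d e]
  have "path_image (oriented pt curve x y) \<subseteq> torus" using o(4) drawingD(4)[OF d e] by simp
  then obtain h where h: "path h" "pathstart h = a" "\<And>t. t \<in> {0..1} \<Longrightarrow> torus_cover (h t) = oriented pt curve x y t"
    using torus_lift[OF arc_imp_path[OF o(1)], of a] o(2) a by metis
  moreover have "torus_cover (pathfinish h) = pt y"
    using h(3)[of 1] o(3) by (simp add: pathfinish_def)
  moreover have "path_image h \<subseteq> torus_cover -` path_image (curve {x, y})"
  proof
    fix z assume "z \<in> path_image h"
    then obtain t where t: "t \<in> {0..1}" "z = h t" unfolding path_image_def by blast
    then have "torus_cover z = oriented pt curve x y t" using h(3) by blast
    also have "\<dots> \<in> path_image (oriented pt curve x y)" using t(1) unfolding path_image_def by blast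
    finally show "z \<in> torus_cover -` path_image (curve {x, y})" unfolding o(4) by simp
  qed
  ultimately show ?thesis using that by blast
qed

definition connected_graph :: "'a ugraph \<Rightarrow> bool" where
  "connected_graph G \<longleftrightarrow> (\<exists>r\<in>fst G. \<forall>x\<in>fst G. (r, x) \<in> {(x, y). {x, y} \<in> snd G}\<^sup>*)"

lemma path_component_of_path_in:
  assumes "path h" "path_image h \<subseteq> S"
  shows "path_component S (pathstart h) (pathfinish h)"
  using assms unfolding path_component_def by blast

text \<open>All vertices are lifted into one path component of the preimage. The lift of an edge
  that starts at \<open>Q x\<close> then ends at \<open>Q y\<close> plus a period, and parallel
  periods are multiples of a single \<open>w\<close>, as \<open>planar_of_lift\<close>
  requires.\<close>

lemma planar_of_parallel_periods:
  assumes d: "drawing (V, E) torus pt curve" and s: "simple_graph (V, E)"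
    and con: "connected_graph (V, E)"
    and par: "\<And>x y. \<lbrakk>x \<in> periods (drawn (V, E) pt curve); y \<in> periods (drawn (V, E) pt curve)\<rbrakk>
                     \<Longrightarrow> Im (cnj x * y) = 0"
  shows "embeds_in (V, E) (UNIV :: complex set)"
proof -
  define A where "A = drawn (V, E) pt curve"
  define T where "T = torus_cover -` A"
  obtain r where r: "r \<in> V" "\<And>x. x \<in> V \<Longrightarrow> (r, x) \<in> {(x, y). {x, y} \<in> E}\<^sup>*"
    using con unfolding connected_graph_def by auto
  have curve: "torus_cover -` path_image (curve e) \<subseteq> T" if "e \<in> E" for e
    using that unfolding T_def A_def drawn_def by auto
  obtain q0 where q0: "torus_cover q0 = pt r"
    using torus_cover_surj[of "pt r"] drawingD(2)[OF d] r(1) by blast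
  have q0T: "q0 \<in> T" using q0 r(1) unfolding T_def A_def drawn_def by auto
  have "\<exists>q. torus_cover q = pt x \<and> path_component T q0 q" if "x \<in> V" for x
    using r(2)[OF that]
  proof (induction rule: rtrancl_induct)
    case base
    then show ?case using q0 q0T path_component_refl by blast
  next
    case (step x y)
    then obtain q where q: "torus_cover q = pt x" "path_component T q0 q" by blast
    have e: "{x, y} \<in> E" using step(2) by simp
    obtain h where h: "path h" "pathstart h = q" "torus_cover (pathfinish h) = pt y"
      "path_image h \<subseteq> torus_cover -` path_image (curve {x, y})"
      using edge_lift[OF d e q(1)] by metis
    then have "path_component T q (pathfinish h)"
      using path_component_of_path_in[of h T] curve[OF e] by blast
    then show ?case using h(3) q(2) path_component_trans by blast
  qed
  then obtain Q where Q: "\<And>x. x \<in> V \<Longrightarrow> torus_cover (Q x) = pt x" "\<And>x. x \<in> V \<Longrightarrow> path_component T q0 (Q x)"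
    by metis
  obtain w where w: "w \<in> gauss_ints" "w \<noteq> 0" "\<And>x. x \<in> periods A \<Longrightarrow> \<exists>k::int. x = of_int k * w"
    using gauss_ints_collinear_cyclic[of "periods A"] par unfolding A_def periods_def by blast
  show ?thesis
  proof (rule planar_of_lift[OF d s Q(1) w(1,2)])
    fix e assume e: "e \<in> E"
    then obtain x y where xy: "x \<in> V" "y \<in> V" "e = {x, y}" using s unfolding simple_graph_def by auto
    obtain h where h: "path h" "pathstart h = Q x" "\<forall>t\<in>{0..1}. torus_cover (h t) = oriented pt curve x y t"
      "torus_cover (pathfinish h) = pt y" "path_image h \<subseteq> torus_cover -` path_image (curve {x, y})"
      using edge_lift[OF d e[unfolded xy(3)] Q(1)[OF xy(1)]] by metis
    have "path_component T (Q x) (pathfinish h)"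
      using path_component_of_path_in[OF h(1), of T] h(2,5) curve[OF e] xy(3) by auto
    then have "path_component T (Q y) (Q y + (pathfinish h - Q y))"
      using Q(2)[OF xy(1)] Q(2)[OF xy(2)] by (metis add.commute diff_add_cancel path_component_sym path_component_trans)
    moreover have "pathfinish h - Q y \<in> gauss_ints"
      using h(4) Q(1)[OF xy(2)] torus_cover_eq_iff by metis
    ultimately have "pathfinish h - Q y \<in> periods A" unfolding periods_def T_def by blast
    then obtain k :: int where "pathfinish h - Q y = of_int k * w" using w(3) by blast
    then have "pathfinish h = Q y + of_int k * w" by (simp add: algebra_simps)
    then show "\<exists>x y h k. e = {x, y} \<and> path h \<and> pathstart h = Q x \<and> pathfinish h = Q y + of_int k * w \<and>
         (\<forall>t\<in>{0..1}. torus_cover (h t) = oriented pt curve x y t)"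
      using xy(3) h(1-3) by blast
  qed
qed

text \<open>Connectedness lets one path component of the preimage contain lifts of all vertices. The
  vertex set is exactly \<open>W\<close>, so that disjoint sets give disjoint drawings, while the
  edges may be any part of \<open>E\<close>.\<close>

definition nonplanar_on :: "'a set set \<Rightarrow> 'a set \<Rightarrow> bool" where
  "nonplanar_on E W \<longleftrightarrow> (\<exists>E'\<subseteq>E. simple_graph (W, E') \<and> connected_graph (W, E') \<and>
      \<not> embeds_in (W, E') (UNIV :: complex set))"

lemma nonplanar_on_periods:
  assumes d: "drawing (V, E) torus pt curve" and W: "W \<subseteq> V" "nonplanar_on E W"
  obtains E' x y where "E' \<subseteq> E" "simple_graph (W, E')" "x \<in> periods (drawn (W, E') pt curve)"
    "y \<in> periods (drawn (W, E') pt curve)" "Im (cnj x * y) \<noteq> 0"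
proof -
  obtain E' where E': "E' \<subseteq> E" "simple_graph (W, E')" "connected_graph (W, E')"
      "\<not> embeds_in (W, E') (UNIV :: complex set)"
    using W(2) unfolding nonplanar_on_def by blast
  have "drawing (W, E') torus pt curve" using drawing_mono[OF d W(1) E'(1,2)] .
  then show ?thesis using planar_of_parallel_periods[OF _ E'(2,3), of pt curve] E'(4) that[OF E'(1,2)] by blast
qed

lemma parallel_trans:
  assumes "Im (cnj x * z) = 0" "Im (cnj y * z) = 0" "z \<noteq> 0"
  shows "Im (cnj x * y) = 0"
proof -
  have e: "Re x * Im z = Im x * Re z" "Re y * Im z = Im y * Re z" using assms(1,2) by auto
  have "(Re x * Im y - Im x * Re y) * Re z = Re x * (Im y * Re z) - (Im x * Re z) * Re y" by (simp add: algebra_simps)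
  also have "\<dots> = 0" unfolding e[symmetric] by simp
  finally have 1: "(Re x * Im y - Im x * Re y) * Re z = 0" .
  have "(Re x * Im y - Im x * Re y) * Im z = (Re x * Im z) * Im y - Im x * (Re y * Im z)" by (simp add: algebra_simps)
  also have "\<dots> = 0" unfolding e by simp
  finally have 2: "(Re x * Im y - Im x * Re y) * Im z = 0" .
  show ?thesis using 1 2 assms(3) by (auto simp: complex_eq_iff)
qed

text \<open>Only 0 is parallel to two vectors that are not parallel to each other.\<close>

lemma periods_trivial_of_disjoint_nonplanar:
  assumes d: "drawing (V, E) torus pt curve" and W: "W \<subseteq> V" "nonplanar_on E W"
    and W': "W' \<subseteq> V" "W \<inter> W' = {}" "E' \<subseteq> E" "simple_graph (W', E')"
  shows "periods (drawn (W', E') pt curve) \<subseteq> {0}"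
proof
  fix z assume z: "z \<in> periods (drawn (W', E') pt curve)"
  obtain F x y where F: "F \<subseteq> E" "simple_graph (W, F)" "x \<in> periods (drawn (W, F) pt curve)"
    "y \<in> periods (drawn (W, F) pt curve)" "Im (cnj x * y) \<noteq> 0"
    using nonplanar_on_periods[OF d W] by metis
  have "drawn (W, F) pt curve \<inter> drawn (W', E') pt curve = {}"
    by (rule drawn_disjoint[OF d W(1) W'(1) F(1) W'(3) F(2) W'(4) W'(2)])
  then have "Im (cnj x * z) = 0" "Im (cnj y * z) = 0"
    using disjoint_periods_parallel F(3,4) z by blast+
  then show "z \<in> {0}" using parallel_trans F(5) by blast
qed

theorem torus_no_disjoint_nonplanar:
  assumes d: "drawing (V, E) torus pt curve" and W: "W \<subseteq> V" "nonplanar_on E W"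
    and W': "W' \<subseteq> V" "nonplanar_on E W'" and "W \<inter> W' = {}"
  shows False
proof -
  obtain F x y where F: "F \<subseteq> E" "simple_graph (W', F)" "x \<in> periods (drawn (W', F) pt curve)"
    "y \<in> periods (drawn (W', F) pt curve)" "Im (cnj x * y) \<noteq> 0"
    using nonplanar_on_periods[OF d W'] by metis
  then have "x = 0" using periods_trivial_of_disjoint_nonplanar[OF d W W'(1) assms(6) F(1,2)] by blast
  then show False using F(5) by simp
qed

section \<open>Kuratowski graphs as subgraphs\<close>

lemma embeds_K5_arcs:
  assumes d: "drawing (V, E) S pt curve" and p: "inj_on p {..<5}"
    and E: "\<And>i j. \<lbrakk>i < 5; j < 5; i \<noteq> j\<rbrakk> \<Longrightarrow> {p i, p j} \<in> E"
  shows "K5_arcs (pt \<circ> p) (\<lambda>i j. oriented pt curve (p i) (p j))"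
  unfolding K5_arcs_def
proof (intro allI impI conjI)
  fix i j :: nat assume ij: "i < j \<and> j < 5"
  then have e: "{p i, p j} \<in> E" using E by auto
  show "arc (oriented pt curve (p i) (p j))" "pathstart (oriented pt curve (p i) (p j)) = (pt \<circ> p) i"
    "pathfinish (oriented pt curve (p i) (p j)) = (pt \<circ> p) j"
    using oriented[OF d e] by auto
  fix k l :: nat assume kl: "k < l \<and> l < 5 \<and> (i, j) \<noteq> (k, l)"
  then have e': "{p k, p l} \<in> E" using E by auto
  have inj: "p a = p b \<longleftrightarrow> a = b" if "a < 5" "b < 5" for a b using inj_on_eq_iff[OF p] that by auto
  have i5: "i < 5" "j < 5" "k < 5" "l < 5" using ij kl by auto
  have "{p i, p j} \<noteq> {p k, p l}"
    using ij kl by (auto simp: doubleton_eq_iff inj i5)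
  then have "path_image (oriented pt curve (p i) (p j)) \<inter> path_image (oriented pt curve (p k) (p l))
      = pt ` ({p i, p j} \<inter> {p k, p l})" by (rule oriented_disjoint[OF d e e'])
  also have "{p i, p j} \<inter> {p k, p l} \<subseteq> p ` ({i, j} \<inter> {k, l})" using i5 by (auto simp: inj)
  finally show "path_image (oriented pt curve (p i) (p j)) \<inter> path_image (oriented pt curve (p k) (p l))
      \<subseteq> (pt \<circ> p) ` ({i, j} \<inter> {k, l})" by (auto simp: image_comp)
qed

lemma nonplanar_on_K5:
  fixes p :: "nat \<Rightarrow> 'a"
  assumes p: "inj_on p {..<5}" and E: "\<And>i j. \<lbrakk>i < 5; j < 5; i \<noteq> j\<rbrakk> \<Longrightarrow> {p i, p j} \<in> E"
  shows "nonplanar_on E (p ` {..<5})"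
proof -
  define F where "F = {{p i, p j} | i j. i < 5 \<and> j < 5 \<and> i \<noteq> j}"
  have inF: "{p i, p j} \<in> F" if "i < 5" "j < 5" "i \<noteq> j" for i j using that unfolding F_def by blast
  have "F \<subseteq> E" using E unfolding F_def by blast
  moreover have "simple_graph (p ` {..<5}, F)"
    unfolding simple_graph_def fst_conv snd_conv
  proof
    fix e assume "e \<in> F"
    then obtain i j where ij: "i < 5" "j < 5" "i \<noteq> j" "e = {p i, p j}" unfolding F_def by blast
    then have "p i \<noteq> p j" using inj_on_eq_iff[OF p, of i j] by simp
    then show "\<exists>x\<in>p ` {..<5}. \<exists>y\<in>p ` {..<5}. x \<noteq> y \<and> e = {x, y}"
      using ij by (intro bexI[of _ "p i"] bexI[of _ "p j"]) auto
  qed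
  moreover have "(p 0, p j) \<in> {(x, y). {x, y} \<in> F}\<^sup>*" if "j < 5" for j
    using inF[of 0 j] that by (cases "j = 0") auto
  then have "connected_graph (p ` {..<5}, F)"
    unfolding connected_graph_def by (intro bexI[of _ "p 0"]) auto
  moreover have "\<not> embeds_in (p ` {..<5}, F) (UNIV :: complex set)"
  proof
    assume "embeds_in (p ` {..<5}, F) (UNIV :: complex set)"
    then obtain pt :: "'a \<Rightarrow> complex" and curve where "drawing (p ` {..<5}, F) UNIV pt curve"
      unfolding embeds_in_iff_drawing by blast
    from embeds_K5_arcs[OF this p inF] show False using K5_nonplanar_arcs by blast
  qed
  ultimately show ?thesis unfolding nonplanar_on_def by blast
qed

lemma nonplanar_on_K33:
  fixes u v :: "nat \<Rightarrow> 'a"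
  assumes u: "inj_on u {..<3}" and v: "inj_on v {..<3}" and uv: "u ` {..<3} \<inter> v ` {..<3} = {}"
    and E: "\<And>i j. \<lbrakk>i < 3; j < 3\<rbrakk> \<Longrightarrow> {u i, v j} \<in> E"
  shows "nonplanar_on E (u ` {..<3} \<union> v ` {..<3})"
proof -
  define F where "F = {{u i, v j} | i j. i < 3 \<and> j < 3}"
  let ?W = "u ` {..<3} \<union> v ` {..<3}"
  have inF: "{u i, v j} \<in> F" if "i < 3" "j < 3" for i j using that unfolding F_def by blast
  have ne: "u i \<noteq> v j" "v j \<noteq> u i" if "i < 3" "j < 3" for i j using uv that by auto
  have inj: "u a = u b \<longleftrightarrow> a = b" "v a = v b \<longleftrightarrow> a = b" if "a < 3" "b < 3" for a b
    using inj_on_eq_iff[OF u] inj_on_eq_iff[OF v] that by auto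
  have "F \<subseteq> E" using E unfolding F_def by blast
  moreover have "simple_graph (?W, F)"
    unfolding simple_graph_def fst_conv snd_conv
  proof
    fix e assume "e \<in> F"
    then obtain i j where ij: "i < 3" "j < 3" "e = {u i, v j}" unfolding F_def by blast
    then show "\<exists>x\<in>?W. \<exists>y\<in>?W. x \<noteq> y \<and> e = {x, y}"
      using ne(1)[OF ij(1,2)] by (intro bexI[of _ "u i"] bexI[of _ "v j"]) auto
  qed
  moreover have "connected_graph (?W, F)"
  proof -
    let ?R = "{(x, y). {x, y} \<in> F}"
    have v: "(u 0, v j) \<in> ?R\<^sup>*" if "j < 3" for j using inF[of 0 j] that by auto
    have "(u 0, u j) \<in> ?R\<^sup>*" if "j < 3" for j
      using v[of 0] inF[of j 0] that by (auto simp: insert_commute intro: rtrancl.rtrancl_into_rtrancl)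
    then show ?thesis using v unfolding connected_graph_def by (intro bexI[of _ "u 0"]) auto
  qed
  moreover have "\<not> embeds_in (?W, F) (UNIV :: complex set)"
  proof
    assume "embeds_in (?W, F) (UNIV :: complex set)"
    then obtain pt :: "'a \<Rightarrow> complex" and curve where d: "drawing (?W, F) UNIV pt curve"
      unfolding embeds_in_iff_drawing by blast
    have "K33_arcs (pt \<circ> u) (pt \<circ> v) (\<lambda>i j. oriented pt curve (u i) (v j))"
      unfolding K33_arcs_def
    proof (intro allI impI conjI)
      fix i j :: nat assume ij: "i < 3" "j < 3"
      note e = inF[OF ij]
      show "arc (oriented pt curve (u i) (v j))" "pathstart (oriented pt curve (u i) (v j)) = (pt \<circ> u) i"
        "pathfinish (oriented pt curve (u i) (v j)) = (pt \<circ> v) j"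
        using oriented[OF d e] by auto
      fix k l :: nat assume kl: "k < 3" "l < 3" "(i, j) \<noteq> (k, l)"
      have n: "{u i, v j} \<noteq> {u k, v l}" using kl(3) ne ij kl(1,2) inj by (auto simp: doubleton_eq_iff)
      have "path_image (oriented pt curve (u i) (v j)) \<inter> path_image (oriented pt curve (u k) (v l))
          = pt ` ({u i, v j} \<inter> {u k, v l})" by (rule oriented_disjoint[OF d e inF[OF kl(1,2)] n])
      also have "\<dots> \<subseteq> (if i = k then {(pt \<circ> u) i} else {}) \<union> (if j = l then {(pt \<circ> v) j} else {})"
        using ne ij kl(1,2) inj by auto
      finally show "path_image (oriented pt curve (u i) (v j)) \<inter> path_image (oriented pt curve (u k) (v l))
         \<subseteq> (if i = k then {(pt \<circ> u) i} else {}) \<union> (if j = l then {(pt \<circ> v) j} else {})" .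
    qed
    then show False using K33_nonplanar_arcs by blast
  qed
  ultimately show ?thesis unfolding nonplanar_on_def by blast
qed

section \<open>Two-page book drawings\<close>

lemma simple_graph_edge:
  assumes "simple_graph (V, E)" "{x, y} \<in> E"
  shows "x \<in> V" "y \<in> V" "x \<noteq> y"
proof -
  obtain a b where "a \<in> V" "b \<in> V" "a \<noteq> b" "{x, y} = {a, b}"
    using assms unfolding simple_graph_def fst_conv snd_conv by blast
  then show "x \<in> V" "y \<in> V" "x \<noteq> y" by (auto simp: doubleton_eq_iff)
qed

text \<open>The vertices are placed on the real axis, and the edges are arcs of parabolas: those in \<open>D\<close>
  below the axis, the others above.\<close>

definition parabola :: "real \<Rightarrow> real \<Rightarrow> real \<Rightarrow> real \<Rightarrow> complex" where
  "parabola s a b t = (let x = a + t * (b - a) in Complex x (s * ((x - a) * (b - x))))"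

lemma parabola_image:
  assumes "a < b"
  shows "path_image (parabola s a b) = {Complex x (s * ((x - a) * (b - x))) | x. a \<le> x \<and> x \<le> b}"
proof (intro equalityI subsetI)
  fix z assume "z \<in> path_image (parabola s a b)"
  then obtain t where t: "0 \<le> t" "t \<le> 1" "z = parabola s a b t" unfolding path_image_def by auto
  have "0 \<le> t * (b - a)" "t * (b - a) \<le> 1 * (b - a)" using t assms by (auto intro: mult_right_mono)
  then show "z \<in> {Complex x (s * ((x - a) * (b - x))) | x. a \<le> x \<and> x \<le> b}"
    using t(3) unfolding parabola_def Let_def by (intro CollectI exI[of _ "a + t * (b - a)"]) auto
next
  fix z assume "z \<in> {Complex x (s * ((x - a) * (b - x))) | x. a \<le> x \<and> x \<le> b}"
  then obtain x where x: "a \<le> x" "x \<le> b" "z = Complex x (s * ((x - a) * (b - x)))" by blast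
  define t where "t = (x - a) / (b - a)"
  have "a + t * (b - a) = x" using assms by (simp add: t_def)
  then have "z = parabola s a b t" using x(3) unfolding parabola_def Let_def by simp
  moreover have "t \<in> {0..1}" using x assms by (auto simp: t_def)
  ultimately show "z \<in> path_image (parabola s a b)" unfolding path_image_def by blast
qed

lemma parabola_arc:
  assumes "a < b"
  shows "arc (parabola s a b)" "pathstart (parabola s a b) = of_real a" "pathfinish (parabola s a b) = of_real b"
proof -
  show "pathstart (parabola s a b) = of_real a" "pathfinish (parabola s a b) = of_real b"
    unfolding pathstart_def pathfinish_def parabola_def by (simp_all add: complex_eq_iff)
  have "path (parabola s a b)"
    unfolding path_def parabola_def[abs_def] Let_def
    by (intro continuous_on_Complex continuous_on_add continuous_on_mult continuous_on_diff
        continuous_on_const continuous_on_id)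
  moreover have "inj_on (parabola s a b) {0..1}"
    using assms by (auto simp: inj_on_def parabola_def Let_def)
  ultimately show "arc (parabola s a b)" unfolding arc_def by blast
qed

text \<open>Over an interior point of the smaller interval, enlarging the interval strictly
  increases the height of the parabola. Equal heights therefore occur only at an end of the smaller
  interval, where the height is 0, and hence at an end of the larger one too.\<close>

lemma nested_parabolas_meet:
  fixes x :: real
  assumes "a \<le> c" "c \<le> x" "x \<le> d" "d \<le> b" "(a, b) \<noteq> (c, d)"
    and eq: "(x - a) * (b - x) = (x - c) * (d - x)"
  shows "x \<in> {a, b} \<inter> {c, d}"
proof -
  have "\<not> (c < x \<and> x < d)"
  proof
    assume x: "c < x \<and> x < d"
    have 1: "(x - c) * (d - x) \<le> (x - c) * (b - x)" using assms x by (intro mult_left_mono) auto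
    have 2: "(x - c) * (b - x) \<le> (x - a) * (b - x)" using assms x by (intro mult_right_mono) auto
    have "(x - c) * (b - x) = (x - a) * (b - x)" "(x - c) * (d - x) = (x - c) * (b - x)" using 1 2 eq by auto
    then have "a = c" "b = d" using x assms by auto
    then show False using assms(5) by simp
  qed
  then have "x = c \<or> x = d" using assms by linarith
  then show ?thesis using eq by auto
qed

text \<open>On one page, intervals that do not interleave are nested or share at most an end. On
  different pages the heights have opposite signs, so a common point has height 0.\<close>

lemma parabolas_meet:
  fixes x :: real
  assumes "a < b" "c < d" "(a, b) \<noteq> (c, d)" and x: "a \<le> x" "x \<le> b" "c \<le> x" "x \<le> d"
    and s: "s = 1 \<or> s = - 1" "s' = 1 \<or> s' = - 1"
    and eq: "s * ((x - a) * (b - x)) = s' * ((x - c) * (d - x))"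
    and page: "s = s' \<Longrightarrow> \<not> (a < c \<and> c < b \<and> b < d) \<and> \<not> (c < a \<and> a < d \<and> d < b)"
  shows "x \<in> {a, b} \<inter> {c, d}"
proof (cases "s = s'")
  case True
  then have eq': "(x - a) * (b - x) = (x - c) * (d - x)" using eq s by auto
  consider "b \<le> c" | "d \<le> a" | "a \<le> c" "d \<le> b" | "c \<le> a" "b \<le> d"
    using page[OF True] assms(1,2) by linarith
  then show ?thesis
  proof cases
    case 3
    then show ?thesis using nested_parabolas_meet[OF 3(1) x(3,4) 3(2) assms(3) eq'] by simp
  next
    case 4
    then show ?thesis using nested_parabolas_meet[OF 4(1) x(1,2) 4(2) _ eq'[symmetric]] assms(3) by auto
  qed (use x in auto)
next
  case False
  have "0 \<le> (x - a) * (b - x)" "0 \<le> (x - c) * (d - x)" using x by auto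
  moreover have "(x - a) * (b - x) = - ((x - c) * (d - x))" using eq s False by auto
  ultimately have "(x - a) * (b - x) = 0" "(x - c) * (d - x) = 0" by linarith+
  then show ?thesis by auto
qed

lemma planar_of_two_page_book:
  fixes pos :: "'a \<Rightarrow> real"
  assumes s: "simple_graph (V, E)" and inj: "inj_on pos V"
    and book: "\<And>x y u v. \<lbrakk>{x, y} \<in> E; {u, v} \<in> E; pos x < pos u; pos u < pos y; pos y < pos v\<rbrakk>
                  \<Longrightarrow> ({x, y} \<in> D) \<noteq> ({u, v} \<in> D)"
  shows "embeds_in (V, E) (UNIV :: complex set)"
proof -
  define pt :: "'a \<Rightarrow> complex" where "pt v = of_real (pos v)" for v
  define sg where "sg e = (if e \<in> D then - 1 else 1 :: real)" for e
  \<comment> \<open>\<open>Min\<close> and \<open>Max\<close> make the curve depend on the edge as a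
    set, without a choice of order for its ends.\<close>
  define cv where "cv e = parabola (sg e) (Min (pos ` e)) (Max (pos ` e))" for e
  have edge: "\<exists>x y. x \<in> V \<and> y \<in> V \<and> e = {x, y} \<and> pos x < pos y" if "e \<in> E" for e
  proof -
    obtain x y where xy: "x \<in> V" "y \<in> V" "x \<noteq> y" "e = {x, y}"
      using s \<open>e \<in> E\<close> unfolding simple_graph_def fst_conv snd_conv by blast
    then have "pos x \<noteq> pos y" using inj by (auto dest: inj_onD)
    then consider "pos x < pos y" | "pos y < pos x" by linarith
    then show ?thesis using xy by cases (auto simp: insert_commute)
  qed
  have cv_eq: "cv {x, y} = parabola (sg {x, y}) (pos x) (pos y)" if "pos x < pos y" for x y
    using that unfolding cv_def by (simp add: min_def max_def)
  have pt_eq: "pt v = Complex (pos v) 0" for v unfolding pt_def by (simp add: complex_eq_iff)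
  have "drawing (V, E) UNIV pt cv"
    unfolding drawing_def fst_conv snd_conv
  proof (intro conjI ballI impI)
    show "inj_on pt V" using inj unfolding pt_def inj_on_def by simp
    fix e assume e: "e \<in> E"
    obtain x y where xy: "x \<in> V" "y \<in> V" "e = {x, y}" "pos x < pos y" using edge[OF e] by blast
    note A = parabola_arc[OF xy(4), of "sg e"]
    have im: "path_image (cv e) = {Complex z (sg e * ((z - pos x) * (pos y - z))) | z. pos x \<le> z \<and> z \<le> pos y}"
      unfolding xy(3) cv_eq[OF xy(4)] by (rule parabola_image[OF xy(4)])
    show "arc (cv e)" using A(1) unfolding xy(3) cv_eq[OF xy(4)] .
    show ends: "{pathstart (cv e), pathfinish (cv e)} = pt ` e"
      using A(2,3) unfolding xy(3) cv_eq[OF xy(4)] pt_def by simp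
    have pe: "pt ` e \<subseteq> path_image (cv e)"
      unfolding ends[symmetric] using pathstart_in_path_image[of "cv e"] pathfinish_in_path_image[of "cv e"] by blast
    show "path_image (cv e) \<inter> pt ` V = pt ` e"
    proof
      show "path_image (cv e) \<inter> pt ` V \<subseteq> pt ` e"
      proof
        fix z assume "z \<in> path_image (cv e) \<inter> pt ` V"
        then obtain v where v: "v \<in> V" "z = pt v" "z \<in> path_image (cv e)" by blast
        then have "sg e * ((pos v - pos x) * (pos y - pos v)) = 0" unfolding im pt_eq by auto
        then have "pos v = pos x \<or> pos v = pos y" unfolding sg_def by (auto split: if_splits)
        then have "v = x \<or> v = y" using inj_onD[OF inj] v(1) xy(1,2) by blast
        then show "z \<in> pt ` e" using v(2) xy(3) by blast
      qed
      show "pt ` e \<subseteq> path_image (cv e) \<inter> pt ` V" using pe xy(1-3) by blast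
    qed
    fix e' assume e': "e' \<in> E" "e \<noteq> e'"
    obtain u v where uv: "u \<in> V" "v \<in> V" "e' = {u, v}" "pos u < pos v" using edge[OF e'(1)] by blast
    have im': "path_image (cv e') = {Complex z (sg e' * ((z - pos u) * (pos v - z))) | z. pos u \<le> z \<and> z \<le> pos v}"
      unfolding uv(3) cv_eq[OF uv(4)] by (rule parabola_image[OF uv(4)])
    have ends': "{pathstart (cv e'), pathfinish (cv e')} = pt ` e'"
      using parabola_arc(2,3)[OF uv(4), of "sg e'"] unfolding uv(3) cv_eq[OF uv(4)] pt_def by simp
    have pe': "pt ` e' \<subseteq> path_image (cv e')"
      unfolding ends'[symmetric] using pathstart_in_path_image[of "cv e'"] pathfinish_in_path_image[of "cv e'"] by blast
    show "path_image (cv e) \<inter> path_image (cv e') = pt ` (e \<inter> e')"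
    proof
      show "pt ` (e \<inter> e') \<subseteq> path_image (cv e) \<inter> path_image (cv e')" using pe pe' by blast
      show "path_image (cv e) \<inter> path_image (cv e') \<subseteq> pt ` (e \<inter> e')"
      proof
        fix w assume "w \<in> path_image (cv e) \<inter> path_image (cv e')"
        then obtain z where z: "pos x \<le> z" "z \<le> pos y" "pos u \<le> z" "z \<le> pos v"
          "w = Complex z (sg e * ((z - pos x) * (pos y - z)))"
          "sg e * ((z - pos x) * (pos y - z)) = sg e' * ((z - pos u) * (pos v - z))"
          unfolding im im' by auto
        have "(pos x, pos y) \<noteq> (pos u, pos v)"
        proof
          assume "(pos x, pos y) = (pos u, pos v)"
          then have "x = u" "y = v" using inj_onD[OF inj] xy(1,2) uv(1,2) by blast+
          then show False using e'(2) xy(3) uv(3) by blast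
        qed
        moreover have "\<not> (pos x < pos u \<and> pos u < pos y \<and> pos y < pos v) \<and>
           \<not> (pos u < pos x \<and> pos x < pos v \<and> pos v < pos y)" if "sg e = sg e'"
          using that book[of x y u v] book[of u v x y] e e'(1) xy(3) uv(3) unfolding sg_def
          by (auto split: if_splits)
        moreover have "sg e = 1 \<or> sg e = - 1" "sg e' = 1 \<or> sg e' = - 1" unfolding sg_def by auto
        ultimately have zz: "z \<in> {pos x, pos y} \<inter> {pos u, pos v}"
          using parabolas_meet[OF xy(4) uv(4) _ z(1-4) _ _ z(6)] by blast
        then have "w = Complex z 0" using z(5) by auto
        moreover have "z \<in> pos ` e" "z \<in> pos ` e'" using zz xy(3) uv(3) by auto
        then obtain p q where pq: "p \<in> e" "q \<in> e'" "z = pos p" "z = pos q" by blast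
        moreover have "p \<in> V" "q \<in> V" using pq(1,2) xy(1-3) uv(1-3) by auto
        then have "p = q" using inj_onD[OF inj, of p q] pq(3,4) by simp
        ultimately show "w \<in> pt ` (e \<inter> e')" using pt_eq by auto
      qed
    qed
  qed auto
  then show ?thesis unfolding embeds_in_iff_drawing by blast
qed

text \<open>\<open>f\<close> is the inverse of the stereographic projection from the pole
  \<open>(0, 1)\<close>.\<close>

lemma embeds_in_sphere_of_planar:
  assumes "embeds_in G (UNIV :: complex set)"
  shows "embeds_in G (handle_sphere 0)"
proof -
  define f :: "complex \<Rightarrow> complex \<times> real" where
    "f w = ((2 / (1 + (cmod w)\<^sup>2)) *\<^sub>R w, ((cmod w)\<^sup>2 - 1) / (1 + (cmod w)\<^sup>2))" for w
  have pos: "1 + (cmod w)\<^sup>2 > 0" for w by (simp add: add_pos_nonneg)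
  have ne: "1 + (cmod w)\<^sup>2 \<noteq> 0" for w using pos[of w] by linarith
  show ?thesis
  proof (rule embeds_in_continuous_injection[OF assms, of f])
    show "continuous_on UNIV f"
      unfolding f_def[abs_def]
      by (intro continuous_on_Pair continuous_on_scaleR continuous_on_divide continuous_on_add continuous_on_diff
          continuous_on_power continuous_on_norm continuous_on_const continuous_on_id) (use ne in auto)
    have inv: "w = inverse (1 - snd (f w)) *\<^sub>R fst (f w)" for w
    proof -
      have "1 - snd (f w) = 2 / (1 + (cmod w)\<^sup>2)" unfolding f_def using ne[of w] by (simp add: field_simps)
      then have "inverse (1 - snd (f w)) * (2 / (1 + (cmod w)\<^sup>2)) = 1" using ne[of w] by simp
      then show ?thesis unfolding f_def by (simp only: fst_conv scaleR_scaleR scaleR_one)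
    qed
    show "inj_on f UNIV" by (rule inj_onI) (metis inv)
    show "f ` UNIV \<subseteq> handle_sphere 0"
    proof
      fix q assume "q \<in> f ` UNIV"
      then obtain w where q: "q = f w" by blast
      define r where "r = (cmod w)\<^sup>2"
      have r: "1 + r \<noteq> 0" using ne[of w] by (simp add: r_def)
      have "(cmod ((2 / (1 + r)) *\<^sub>R w))\<^sup>2 = (2 / (1 + r))\<^sup>2 * r"
        by (simp add: power_mult_distrib r_def power_divide)
      moreover have "((r - 1) / (1 + r))\<^sup>2 = 1 - (2 / (1 + r))\<^sup>2 * r"
      proof -
        have "(r - 1)\<^sup>2 + 4 * r = (1 + r)\<^sup>2" by (simp add: power2_eq_square algebra_simps)
        then have "((r - 1)\<^sup>2 + 4 * r) / (1 + r)\<^sup>2 = 1" using r by simp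
        then show ?thesis by (simp add: power_divide add_divide_distrib)
      qed
      ultimately show "q \<in> handle_sphere 0"
        unfolding q f_def handle_sphere_def r_def[symmetric] by simp
    qed
  qed
qed

text \<open>Each cell receives four consecutive places on the axis. Edges of different cells do not
  interleave, and within a cell only the edges 0-2 and 1-3 do; the latter form the second
  page.\<close>

lemma planar_of_small_cells:
  fixes cell :: "'a \<Rightarrow> 'c"
  assumes s: "simple_graph (V, E)" and fin: "finite V"
    and cell: "\<And>x y. {x, y} \<in> E \<Longrightarrow> cell x = cell y"
    and small: "\<And>x. x \<in> V \<Longrightarrow> card {y \<in> V. cell y = cell x} \<le> 4"
  shows "embeds_in (V, E) (UNIV :: complex set)"
proof -
  have finc: "finite (cell ` V)" using fin by simp
  obtain idx :: "'c \<Rightarrow> nat" where idx: "inj_on idx (cell ` V)"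
    using finite_imp_inj_to_nat_seg[OF finc] by metis
  have "\<exists>f::'a \<Rightarrow> nat. inj_on f {y \<in> V. cell y = c} \<and> f ` {y \<in> V. cell y = c} \<subseteq> {..<4}" for c
  proof (cases "{y \<in> V. cell y = c} = {}")
    case True then show ?thesis unfolding True by simp
  next
    case False
    then obtain x where x: "x \<in> V" "c = cell x" by blast
    have "finite {y \<in> V. cell y = c}" "card {y \<in> V. cell y = c} \<le> card {..<4::nat}"
      using fin small[OF x(1)] x(2) by auto
    then show ?thesis using card_le_inj[of "{y \<in> V. cell y = c}" "{..<4::nat}"] by blast
  qed
  then obtain loc :: "'c \<Rightarrow> 'a \<Rightarrow> nat" where loc: "\<And>c. inj_on (loc c) {y \<in> V. cell y = c}"
      "\<And>c. loc c ` {y \<in> V. cell y = c} \<subseteq> {..<4}" by metis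
  define l where "l v = loc (cell v) v" for v
  have l: "l v < 4" if "v \<in> V" for v using loc(2)[of "cell v"] that unfolding l_def by auto
  define pos where "pos v = real (4 * idx (cell v) + l v)" for v
  define D where "D = {{x, y} | x y. l x = 1 \<and> l y = 3}"
  show ?thesis
  proof (rule planar_of_two_page_book[OF s, of pos D])
    show "inj_on pos V"
    proof (rule inj_onI)
      fix x y assume xy: "x \<in> V" "y \<in> V" "pos x = pos y"
      then have "4 * idx (cell x) + l x = 4 * idx (cell y) + l y" unfolding pos_def by linarith
      then have "idx (cell x) = idx (cell y)" "l x = l y" using l[OF xy(1)] l[OF xy(2)] by presburger+
      then have "cell x = cell y" using idx xy by (auto dest: inj_onD)
      then show "x = y" using loc(1)[of "cell x"] xy \<open>l x = l y\<close> unfolding l_def by (auto dest: inj_onD)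
    qed
    fix x y u v assume h: "{x, y} \<in> E" "{u, v} \<in> E" "pos x < pos u" "pos u < pos y" "pos y < pos v"
    have V: "x \<in> V" "y \<in> V" "u \<in> V" "v \<in> V" using simple_graph_edge[OF s h(1)] simple_graph_edge[OF s h(2)] by blast+
    have c: "cell x = cell y" "cell u = cell v" using cell h(1,2) by blast+
    have p: "4 * idx (cell y) + l x < 4 * idx (cell v) + l u" "4 * idx (cell v) + l u < 4 * idx (cell y) + l y"
      "4 * idx (cell y) + l y < 4 * idx (cell v) + l v"
      using h(3-5) unfolding pos_def c by linarith+
    note L = l[OF V(1)] l[OF V(2)] l[OF V(3)] l[OF V(4)]
    have "idx (cell y) = idx (cell v)" using p L by linarith
    then have "l x = 0" "l u = 1" "l y = 2" "l v = 3" using p L by linarith+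
    then have "{u, v} \<in> D" "{x, y} \<notin> D" unfolding D_def by (auto simp: doubleton_eq_iff)
    then show "({x, y} \<in> D) \<noteq> ({u, v} \<in> D)" by blast
  qed
qed

text \<open>The pairs that are not excluded form the prism with triangles 0, 1, 2 and 3, 4, 5 and
  rungs 0-5, 1-4, 2-3. In the order 0, ..., 5 the rung 1-4 interleaves with 0-2 and with 3-5, and no
  other two edges interleave; so it gets a page of its own.\<close>

lemma planar_prism:
  fixes p :: "nat \<Rightarrow> 'a"
  assumes s: "simple_graph (p ` {..<6}, E)" and p: "inj_on p {..<6}"
    and E: "{p 0, p 3} \<notin> E" "{p 0, p 4} \<notin> E" "{p 1, p 3} \<notin> E" "{p 1, p 5} \<notin> E" "{p 2, p 4} \<notin> E" "{p 2, p 5} \<notin> E"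
  shows "embeds_in (p ` {..<6}, E) (UNIV :: complex set)"
proof -
  define pos where "pos v = real (inv_into {..<6} p v)" for v
  have pos: "pos (p i) = real i" if "i < 6" for i using p that unfolding pos_def by simp
  have inj: "p i = p j \<longleftrightarrow> i = j" if "i < 6" "j < 6" for i j using inj_on_eq_iff[OF p] that by auto
  show ?thesis
  proof (rule planar_of_two_page_book[OF s, of pos "{{p 1, p 4}}"])
    show "inj_on pos (p ` {..<6})" by (auto simp: inj_on_def pos)
    fix x y u v assume h: "{x, y} \<in> E" "{u, v} \<in> E" "pos x < pos u" "pos u < pos y" "pos y < pos v"
    have "x \<in> p ` {..<6}" "y \<in> p ` {..<6}" "u \<in> p ` {..<6}" "v \<in> p ` {..<6}"
      using simple_graph_edge[OF s h(1)] simple_graph_edge[OF s h(2)] by blast+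
    then obtain i j k l where I: "x = p i" "y = p j" "u = p k" "v = p l" "i < 6" "j < 6" "k < 6" "l < 6" by auto
    have o: "i < k" "k < j" "j < l" using h(3-5) unfolding I by (simp_all add: pos I)
    have iv: "i \<in> {0, 1, 2}" "k \<in> {1, 2, 3}" "j \<in> {2, 3, 4}" "l \<in> {3, 4, 5}" using o I(8) by auto
    have "(i = 0 \<and> j = 2) \<or> (i = 1 \<and> j = 4)" using iv(1,3) o h(1) E unfolding I(1,2) by auto
    moreover have "(k = 1 \<and> l = 4) \<or> (k = 3 \<and> l = 5)" using iv(2,4) o h(2) E unfolding I(3,4) by auto
    ultimately have "(i = 0 \<and> j = 2 \<and> k = 1 \<and> l = 4) \<or> (i = 1 \<and> j = 4 \<and> k = 3 \<and> l = 5)"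
      using o by linarith
    then show "({x, y} \<in> {{p 1, p 4}}) \<noteq> ({u, v} \<in> {{p 1, p 4}})"
    proof
      have "{p 0, p 2} \<noteq> {p 1, p 4}" by (simp add: doubleton_eq_iff inj)
      moreover assume "i = 0 \<and> j = 2 \<and> k = 1 \<and> l = 4"
      ultimately show ?thesis unfolding I(1-4) by simp
    next
      have "{p 3, p 5} \<noteq> {p 1, p 4}" by (simp add: doubleton_eq_iff inj)
      moreover assume "i = 1 \<and> j = 4 \<and> k = 3 \<and> l = 5"
      ultimately show ?thesis unfolding I(1-4) by simp
    qed
  qed
qed

section \<open>Two further obstructions\<close>

text \<open>This is a K33 whose edges from \<open>u 1\<close> to \<open>v 2\<close> and from
  \<open>u 2\<close> to \<open>v 1\<close> pass through \<open>s\<close> and \<open>t\<close>. Two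
  rows of a 4 by 4 rook's graph contain it, using all eight vertices.\<close>

lemma nonplanar_on_K33_subdivided:
  fixes u v :: "nat \<Rightarrow> 'a"
  assumes u: "inj_on u {..<3}" and v: "inj_on v {..<3}" and uv: "u ` {..<3} \<inter> v ` {..<3} = {}"
    and st: "s \<noteq> t" "s \<notin> u ` {..<3} \<union> v ` {..<3}" "t \<notin> u ` {..<3} \<union> v ` {..<3}"
    and E: "\<And>i j. \<lbrakk>i < 3; j < 3; (i, j) \<noteq> (1, 2); (i, j) \<noteq> (2, 1)\<rbrakk> \<Longrightarrow> {u i, v j} \<in> E"
    and E2: "{u 1, s} \<in> E" "{s, v 2} \<in> E" "{u 2, t} \<in> E" "{t, v 1} \<in> E"
  shows "nonplanar_on E (insert s (insert t (u ` {..<3} \<union> v ` {..<3})))"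
proof -
  define Fs where "Fs i j = (if (i, j) = (1, 2) then {{u 1, s}, {s, v 2}}
      else if (i, j) = (2, 1) then {{u 2, t}, {t, v 1}} else {{u i, v j}})" for i j :: nat
  define F where "F = (\<Union>i\<in>{..<3}. \<Union>j\<in>{..<3}. Fs i j)"
  let ?W = "insert s (insert t (u ` {..<3} \<union> v ` {..<3}))"
  have inF: "e \<in> F" if "i < 3" "j < 3" "e \<in> Fs i j" for e i j using that unfolding F_def by blast
  have ne: "u i \<noteq> v j" "v j \<noteq> u i" if "i < 3" "j < 3" for i j using uv that by auto
  have inj: "u a = u b \<longleftrightarrow> a = b" "v a = v b \<longleftrightarrow> a = b" if "a < 3" "b < 3" for a b
    using inj_on_eq_iff[OF u] inj_on_eq_iff[OF v] that by auto
  have ns: "s \<noteq> u i" "s \<noteq> v i" "u i \<noteq> s" "v i \<noteq> s" "t \<noteq> u i" "t \<noteq> v i" "u i \<noteq> t" "v i \<noteq> t" if "i < 3" for i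
    using st that by auto
  have mem: "x = u i \<or> x = v j \<or> (i = 1 \<and> j = 2 \<and> x = s) \<or> (i = 2 \<and> j = 1 \<and> x = t)"
    if "x \<in> e" "e \<in> Fs i j" for x e i j using that unfolding Fs_def by (auto split: if_splits)
  have pick: "\<exists>a\<in>?W. \<exists>b\<in>?W. a \<noteq> b \<and> e = {a, b}" if "e = {a, b}" "a \<in> ?W" "b \<in> ?W" "a \<noteq> b" for e a b
    using that by blast
  have W: "s \<in> ?W" "t \<in> ?W" "i < 3 \<Longrightarrow> u i \<in> ?W" "i < 3 \<Longrightarrow> v i \<in> ?W" for i by simp_all
  have two: "\<exists>a\<in>?W. \<exists>b\<in>?W. a \<noteq> b \<and> e = {a, b}" if e: "i < 3" "j < 3" "e \<in> Fs i j" for e i j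
  proof -
    consider "(i, j) = (1, 2)" | "(i, j) = (2, 1)" | "(i, j) \<noteq> (1, 2)" "(i, j) \<noteq> (2, 1)" by blast
    then show ?thesis
    proof cases
      case 1
      then have "e = {u 1, s} \<or> e = {s, v 2}" using e(3) unfolding Fs_def by auto
      then show ?thesis
      proof
        assume "e = {u 1, s}" then show ?thesis by (rule pick[OF _ W(3) W(1) ns(3)]) simp_all
      next
        assume "e = {s, v 2}" then show ?thesis by (rule pick[OF _ W(1) W(4) ns(2)]) simp_all
      qed
    next
      case 2
      then have "e = {u 2, t} \<or> e = {t, v 1}" using e(3) unfolding Fs_def by auto
      then show ?thesis
      proof
        assume "e = {u 2, t}" then show ?thesis by (rule pick[OF _ W(3) W(2) ns(7)]) simp_all
      next
        assume "e = {t, v 1}" then show ?thesis by (rule pick[OF _ W(2) W(4) ns(6)]) simp_all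
      qed
    next
      case 3
      then have "e = {u i, v j}" using e(3) unfolding Fs_def by (simp split: if_splits)
      then show ?thesis by (rule pick[OF _ W(3)[OF e(1)] W(4)[OF e(2)] ne(1)[OF e(1,2)]])
    qed
  qed
  \<comment> \<open>Paths that replace different edges of K33 share at most a branch vertex, so the
    joined curves satisfy \<open>K33_arcs\<close>.\<close>
  have meet: "e \<inter> e' \<subseteq> (if i = k then {u i} else {}) \<union> (if j = l then {v j} else {})"
    if ij: "i < 3" "j < 3" "e \<in> Fs i j" and kl: "k < 3" "l < 3" "e' \<in> Fs k l" and d: "(i, j) \<noteq> (k, l)" for e e' i j k l
  proof
    fix x assume "x \<in> e \<inter> e'"
    then have m: "x = u i \<or> x = v j \<or> (i = 1 \<and> j = 2 \<and> x = s) \<or> (i = 2 \<and> j = 1 \<and> x = t)"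
      "x = u k \<or> x = v l \<or> (k = 1 \<and> l = 2 \<and> x = s) \<or> (k = 2 \<and> l = 1 \<and> x = t)"
      using mem ij(3) kl(3) by blast+
    have "(x = u i \<and> i = k) \<or> (x = v j \<and> j = l)"
      using m d by (auto simp: ne[OF ij(1) kl(2)] ne[OF kl(1) ij(2)] inj(1)[OF ij(1) kl(1)]
          inj(2)[OF ij(2) kl(2)] ns[OF ij(1)] ns[OF ij(2)] ns[OF kl(1)] ns[OF kl(2)] st(1) st(1)[symmetric])
    then show "x \<in> (if i = k then {u i} else {}) \<union> (if j = l then {v j} else {})" by auto
  qed
  have diff: "e \<noteq> e'"
    if ij: "i < 3" "j < 3" "e \<in> Fs i j" and kl: "k < 3" "l < 3" "e' \<in> Fs k l" and d: "(i, j) \<noteq> (k, l)" for e e' i j k l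
  proof
    assume "e = e'"
    then have "e \<subseteq> (if i = k then {u i} else {}) \<union> (if j = l then {v j} else {})" using meet[OF that] by simp
    moreover obtain a b where "a \<noteq> b" "e = {a, b}" using two[OF ij] by blast
    ultimately show False using d by (auto split: if_splits)
  qed
  have "F \<subseteq> E"
  proof
    fix e assume "e \<in> F"
    then obtain i j where "i < 3" "j < 3" "e \<in> Fs i j" unfolding F_def by auto
    then show "e \<in> E" using E[of i j] E2 unfolding Fs_def by (auto split: if_splits)
  qed
  moreover have "simple_graph (?W, F)"
    unfolding simple_graph_def fst_conv snd_conv
  proof
    fix e assume "e \<in> F"
    then obtain i j where "i < 3" "j < 3" "e \<in> Fs i j" unfolding F_def by auto
    then show "\<exists>x\<in>?W. \<exists>y\<in>?W. x \<noteq> y \<and> e = {x, y}" by (rule two)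
  qed
  moreover have "connected_graph (?W, F)"
  proof -
    let ?R = "{(x, y). {x, y} \<in> F}"
    have e: "{u i, v j} \<in> F" if "i < 3" "j < 3" "(i, j) \<noteq> (1, 2)" "(i, j) \<noteq> (2, 1)" for i j
      using that by (intro inF[of i j]) (auto simp: Fs_def)
    have v: "(u 0, v j) \<in> ?R\<^sup>*" if "j < 3" for j using e[of 0 j] that by auto
    have e': "(v j, u i) \<in> ?R" if "i < 3" "j < 3" "(i, j) \<noteq> (1, 2)" "(i, j) \<noteq> (2, 1)" for i j
      using e[OF that] by (simp add: insert_commute)
    have u: "(u 0, u i) \<in> ?R\<^sup>*" if "i < 3" for i
      using rtrancl.rtrancl_into_rtrancl[OF v[of 0] e'[of i 0]] that by simp
    have "{u 1, s} \<in> F" "{u 2, t} \<in> F" by (intro inF[of 1 2] inF[of 2 1]; simp add: Fs_def)+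
    then have "(u 0, s) \<in> ?R\<^sup>*" "(u 0, t) \<in> ?R\<^sup>*"
      using rtrancl.rtrancl_into_rtrancl[OF u[of 1], of s] rtrancl.rtrancl_into_rtrancl[OF u[of 2], of t] by simp_all
    then show ?thesis using u v unfolding connected_graph_def by (intro bexI[of _ "u 0"]) auto
  qed
  moreover have "\<not> embeds_in (?W, F) (UNIV :: complex set)"
  proof
    assume "embeds_in (?W, F) (UNIV :: complex set)"
    then obtain pt :: "'a \<Rightarrow> complex" and curve where d: "drawing (?W, F) UNIV pt curve"
      unfolding embeds_in_iff_drawing by blast
    define o' where "o' = oriented pt curve"
    define g where "g i j = (if (i, j) = (1, 2) then o' (u 1) s +++ o' s (v 2)
       else if (i, j) = (2, 1) then o' (u 2) t +++ o' t (v 1) else o' (u i) (v j))" for i j :: nat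
    have g: "arc (g i j) \<and> pathstart (g i j) = pt (u i) \<and> pathfinish (g i j) = pt (v j) \<and>
        path_image (g i j) = (\<Union>e\<in>Fs i j. path_image (curve e))" if ij: "i < 3" "j < 3" for i j
    proof -
      have join: "arc (o' a b +++ o' b c) \<and> pathstart (o' a b +++ o' b c) = pt a \<and> pathfinish (o' a b +++ o' b c) = pt c \<and>
           path_image (o' a b +++ o' b c) = (\<Union>e\<in>{{a, b}, {b, c}}. path_image (curve e))"
        if abc: "{a, b} \<in> F" "{b, c} \<in> F" "a \<noteq> c" for a b c
      proof -
        note o1 = oriented[OF d abc(1), folded o'_def] and o2 = oriented[OF d abc(2), folded o'_def]
        have "{a, b} \<noteq> {b, c}" using abc(3) by (auto simp: doubleton_eq_iff)
        then have "path_image (o' a b) \<inter> path_image (o' b c) = pt ` ({a, b} \<inter> {b, c})"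
          unfolding o'_def by (rule oriented_disjoint[OF d abc(1,2)])
        also have "\<dots> \<subseteq> {pt b}" using abc(3) by auto
        finally have "arc (o' a b +++ o' b c)" using o1 o2 by (intro arc_join) auto
        then show ?thesis using o1 o2 by (simp add: path_image_join)
      qed
      consider "(i, j) = (1, 2)" | "(i, j) = (2, 1)" | "(i, j) \<noteq> (1, 2)" "(i, j) \<noteq> (2, 1)" by blast
      then show ?thesis
      proof cases
        case 1
        then have F: "Fs i j = {{u 1, s}, {s, v 2}}" and G: "g i j = o' (u 1) s +++ o' s (v 2)"
          unfolding Fs_def g_def by simp_all
        show ?thesis using join[of "u 1" s "v 2"] inF[OF ij] ne[of 1 2] 1 unfolding F G by simp
      next
        case 2
        then have F: "Fs i j = {{u 2, t}, {t, v 1}}" and G: "g i j = o' (u 2) t +++ o' t (v 1)"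
          unfolding Fs_def g_def by simp_all
        show ?thesis using join[of "u 2" t "v 1"] inF[OF ij] ne[of 2 1] 2 unfolding F G by simp
      next
        case 3
        then have F: "Fs i j = {{u i, v j}}" and G: "g i j = o' (u i) (v j)"
          unfolding Fs_def g_def by auto
        have "{u i, v j} \<in> F" using inF[OF ij] F by simp
        then show ?thesis using oriented[OF d] unfolding F G o'_def by simp
      qed
    qed
    have "K33_arcs (pt \<circ> u) (pt \<circ> v) g"
      unfolding K33_arcs_def
    proof (intro allI impI conjI)
      fix i j :: nat assume ij: "i < 3" "j < 3"
      show "arc (g i j)" "pathstart (g i j) = (pt \<circ> u) i" "pathfinish (g i j) = (pt \<circ> v) j"
        using g[OF ij] by auto
      fix k l :: nat assume kl: "k < 3" "l < 3" "(i, j) \<noteq> (k, l)"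
      show "path_image (g i j) \<inter> path_image (g k l)
         \<subseteq> (if i = k then {(pt \<circ> u) i} else {}) \<union> (if j = l then {(pt \<circ> v) j} else {})"
      proof
        fix z assume "z \<in> path_image (g i j) \<inter> path_image (g k l)"
        then obtain e e' where e: "e \<in> Fs i j" "e' \<in> Fs k l" and z: "z \<in> path_image (curve e) \<inter> path_image (curve e')"
          using g[OF ij] g[OF kl(1,2)] by auto
        have "path_image (curve e) \<inter> path_image (curve e') = pt ` (e \<inter> e')"
          by (rule drawingD(7)[OF d inF[OF ij e(1)] inF[OF kl(1,2) e(2)] diff[OF ij e(1) kl(1,2) e(2) kl(3)]])
        then have "z \<in> pt ` ((if i = k then {u i} else {}) \<union> (if j = l then {v j} else {}))"
          using z meet[OF ij e(1) kl(1,2) e(2) kl(3)] by blast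
        then show "z \<in> (if i = k then {(pt \<circ> u) i} else {}) \<union> (if j = l then {(pt \<circ> v) j} else {})"
          by (auto split: if_splits)
      qed
    qed
    then show False using K33_nonplanar_arcs by blast
  qed
  ultimately show ?thesis unfolding nonplanar_on_def by blast
qed

text \<open>Removing \<open>x e\<close> and \<open>y f\<close> from the \<open>K\<^sub>4\<^sub>,\<^sub>4\<close> leaves a \<open>K\<^sub>3\<^sub>,\<^sub>3\<close>, which forces all periods of the
  remaining part \<open>W' e f\<close> to vanish. As \<open>e\<close> and \<open>f\<close> are arbitrary, the whole \<open>K\<^sub>4\<^sub>,\<^sub>4\<close> lifts to the
  universal cover.\<close>

lemma torus_no_K4_linked_K44:
  fixes c x y :: "nat \<Rightarrow> 'a"
  assumes d: "drawing (V, E) torus pt curve"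
    and inj: "inj_on c {..<4}" "inj_on x {..<4}" "inj_on y {..<4}"
    and disj: "c ` {..<4} \<inter> x ` {..<4} = {}" "c ` {..<4} \<inter> y ` {..<4} = {}" "x ` {..<4} \<inter> y ` {..<4} = {}"
    and V: "c ` {..<4} \<subseteq> V" "x ` {..<4} \<subseteq> V" "y ` {..<4} \<subseteq> V"
    and cc: "\<And>i j. \<lbrakk>i < 4; j < 4; i \<noteq> j\<rbrakk> \<Longrightarrow> {c i, c j} \<in> E"
    and cx: "\<And>i. i < 4 \<Longrightarrow> {c i, x i} \<in> E" and cy: "\<And>i. i < 4 \<Longrightarrow> {c i, y i} \<in> E"
    and xy: "\<And>i j. \<lbrakk>i < 4; j < 4\<rbrakk> \<Longrightarrow> {x i, y j} \<in> E"
  shows False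
proof -
  \<comment> \<open>Each piece consists of the K4 and one vertex from either side of the K44;
    besides the K4 it keeps the path \<open>c e\<close>, \<open>x e\<close>, \<open>y f\<close>,
    \<open>c f\<close>.\<close>
  define W' where "W' e f = insert (x e) (insert (y f) (c ` {..<4}))" for e f
  define E' where "E' e f = {{c i, c j} | i j. i < 4 \<and> j < 4 \<and> i \<noteq> j} \<union> {{c e, x e}, {c f, y f}, {x e, y f}}" for e f
  define Y where "Y e f = torus_cover -` drawn (W' e f, E' e f) pt curve" for e f
  have ne: "c i \<noteq> x j" "c i \<noteq> y j" "x i \<noteq> y j" if "i < 4" "j < 4" for i j using disj that by auto
  have cne: "c i \<noteq> c j" if "i < 4" "j < 4" "i \<noteq> j" for i j using inj_on_eq_iff[OF inj(1)] that by auto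
  have curve_Y: "torus_cover -` path_image (curve a) \<subseteq> Y e f" if "a \<in> E' e f" for a e f
    using that unfolding Y_def drawn_def by auto
  have E'E: "E' e f \<subseteq> E" if "e < 4" "f < 4" for e f
    using cc cx cy xy that unfolding E'_def by auto
  have simple: "simple_graph (W' e f, E' e f)" if ef: "e < 4" "f < 4" for e f
    unfolding simple_graph_def fst_conv snd_conv
  proof
    fix a assume "a \<in> E' e f"
    then consider i j where "i < 4" "j < 4" "i \<noteq> j" "a = {c i, c j}" | "a = {c e, x e}" | "a = {c f, y f}" | "a = {x e, y f}"
      unfolding E'_def by blast
    then show "\<exists>p\<in>W' e f. \<exists>q\<in>W' e f. p \<noteq> q \<and> a = {p, q}"
    proof cases
      case (1 i j)
      then show ?thesis using cne[OF 1(1-3)] unfolding W'_def by (intro bexI[of _ "c i"] bexI[of _ "c j"]) auto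
    next
      case 2
      then show ?thesis using ne[of e e] ef unfolding W'_def by (intro bexI[of _ "c e"] bexI[of _ "x e"]) auto
    next
      case 3
      then show ?thesis using ne[of f f] ef unfolding W'_def by (intro bexI[of _ "c f"] bexI[of _ "y f"]) auto
    next
      case 4
      then show ?thesis using ne[of e f] ef unfolding W'_def by (intro bexI[of _ "x e"] bexI[of _ "y f"]) auto
    qed
  qed
  \<comment> \<open>\<open>sk e\<close> enumerates the indices below 4 other than \<open>e\<close>.
    Thus \<open>x\<close> without \<open>x e\<close> and \<open>y\<close> without \<open>y f\<close>
    form a K33 disjoint from the piece.\<close>
  define sk where "sk e i = (if i < e then i else Suc i)" for e i :: nat
  have sk: "inj_on (sk e) {..<3}" "sk e ` {..<3} = {..<4} - {e}" if e: "e < 4" for e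
  proof -
    show inj: "inj_on (sk e) {..<3}" by (auto simp: inj_on_def sk_def split: if_splits)
    have "sk e ` {..<3} \<subseteq> {..<4} - {e}" by (auto simp: sk_def)
    moreover have "card (sk e ` {..<3}) = card ({..<4} - {e})" using card_image[OF inj] e by simp
    ultimately show "sk e ` {..<3} = {..<4} - {e}" by (intro card_subset_eq) auto
  qed
  \<comment> \<open>As the periods of the piece vanish, a path component of its preimage contains at
    most one lift of each point.\<close>
  have trivial: "a = b" if ef: "e < 4" "f < 4" and ab: "path_component (Y e f) a b" "torus_cover a = torus_cover b" for e f a b
  proof -
    have sk4: "sk e i < 4" "sk f i < 4" if "i < 3" for i using sk(2)[OF ef(1)] sk(2)[OF ef(2)] that by auto
    have "nonplanar_on E ((x \<circ> sk e) ` {..<3} \<union> (y \<circ> sk f) ` {..<3})"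
    proof (rule nonplanar_on_K33)
      show "inj_on (x \<circ> sk e) {..<3}" "inj_on (y \<circ> sk f) {..<3}"
        using sk ef inj by (auto intro!: comp_inj_on intro: inj_on_subset)
      show "(x \<circ> sk e) ` {..<3} \<inter> (y \<circ> sk f) ` {..<3} = {}"
        unfolding image_comp[symmetric] sk(2)[OF ef(1)] sk(2)[OF ef(2)] using disj(3) by blast
      show "{(x \<circ> sk e) i, (y \<circ> sk f) j} \<in> E" if "i < 3" "j < 3" for i j using xy sk4 that by simp
    qed
    then have np: "nonplanar_on E (x ` ({..<4} - {e}) \<union> y ` ({..<4} - {f}))"
      unfolding image_comp[symmetric] sk(2)[OF ef(1)] sk(2)[OF ef(2)] .
    have "periods (drawn (W' e f, E' e f) pt curve) \<subseteq> {0}"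
    proof (rule periods_trivial_of_disjoint_nonplanar[OF d _ np _ _ E'E[OF ef] simple[OF ef]])
      show "x ` ({..<4} - {e}) \<union> y ` ({..<4} - {f}) \<subseteq> V" using V by blast
      show "W' e f \<subseteq> V" using V ef unfolding W'_def by auto
      show "(x ` ({..<4} - {e}) \<union> y ` ({..<4} - {f})) \<inter> W' e f = {}"
        using disj ef inj_on_eq_iff[OF inj(2)] inj_on_eq_iff[OF inj(3)] unfolding W'_def by auto
    qed
    moreover have "b - a \<in> periods (drawn (W' e f, E' e f) pt curve)"
    proof -
      have "b - a \<in> gauss_ints" using ab(2) torus_cover_eq_iff by metis
      moreover have "path_component (Y e f) a (a + (b - a))" using ab(1) by simp
      ultimately show ?thesis unfolding periods_def Y_def by blast
    qed
    ultimately show "a = b" by auto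
  qed
  \<comment> \<open>The end point is chosen before \<open>e\<close> and \<open>f\<close>, because
    one lift of an edge has to serve all pieces that contain the edge.\<close>
  have extend: "\<exists>r. torus_cover r = pt b \<and> (\<forall>e f. {a, b} \<in> E' e f \<longrightarrow> path_component (Y e f) q r)"
    if ab: "{a, b} \<in> E" "torus_cover q = pt a" for a b q
  proof -
    obtain h where h: "path h" "pathstart h = q" "torus_cover (pathfinish h) = pt b"
      "path_image h \<subseteq> torus_cover -` path_image (curve {a, b})"
      using edge_lift[OF d ab] by metis
    have "path_component (Y e f) q (pathfinish h)" if "{a, b} \<in> E' e f" for e f
      using path_component_of_path_in[OF h(1), of "Y e f"] h(2,4) curve_Y[OF that] by auto
    then show ?thesis using h(3) by blast
  qed
  have c0: "c 0 \<in> V" using V(1) by force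
  then have "pt (c 0) \<in> torus" using drawingD(2)[OF d] by blast
  then obtain q0 where q0: "torus_cover q0 = pt (c 0)" using torus_cover_surj by metis
  have q0Y: "q0 \<in> Y e f" for e f using q0 unfolding Y_def drawn_def W'_def by auto
  have "\<exists>r. torus_cover r = pt (c i) \<and> (\<forall>e f. path_component (Y e f) q0 r)" if i: "i < 4" for i
  proof (cases "i = 0")
    case True then show ?thesis using q0 q0Y path_component_refl by blast
  next
    case False
    have "{c 0, c i} \<in> E' e f" for e f using i False unfolding E'_def by fastforce
    then show ?thesis using extend[OF cc[of 0 i] q0] i False by auto
  qed
  then obtain Qc where Qc: "\<And>i. i < 4 \<Longrightarrow> torus_cover (Qc i) = pt (c i)"
    "\<And>i e f. i < 4 \<Longrightarrow> path_component (Y e f) q0 (Qc i)" by metis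
  have "\<exists>r. torus_cover r = pt (x i) \<and> (\<forall>f. path_component (Y i f) q0 r)" if i: "i < 4" for i
  proof -
    have "{c i, x i} \<in> E' i f" for f unfolding E'_def by blast
    then show ?thesis using extend[OF cx[OF i] Qc(1)[OF i]] Qc(2)[OF i] path_component_trans by blast
  qed
  then obtain Qx where Qx: "\<And>i. i < 4 \<Longrightarrow> torus_cover (Qx i) = pt (x i)"
    "\<And>i f. i < 4 \<Longrightarrow> path_component (Y i f) q0 (Qx i)" by metis
  have "\<exists>r. torus_cover r = pt (y i) \<and> (\<forall>e. path_component (Y e i) q0 r)" if i: "i < 4" for i
  proof -
    have "{c i, y i} \<in> E' e i" for e unfolding E'_def by blast
    then show ?thesis using extend[OF cy[OF i] Qc(1)[OF i]] Qc(2)[OF i] path_component_trans by blast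
  qed
  then obtain Qy where Qy: "\<And>i. i < 4 \<Longrightarrow> torus_cover (Qy i) = pt (y i)"
    "\<And>i e. i < 4 \<Longrightarrow> path_component (Y e i) q0 (Qy i)" by metis
  define W F where "W = x ` {..<4} \<union> y ` {..<4}" and "F = {{x i, y j} | i j. i < 4 \<and> j < 4}"
  define Q where "Q v = (if v \<in> x ` {..<4} then Qx (inv_into {..<4} x v) else Qy (inv_into {..<4} y v))" for v
  have Q: "Q (x i) = Qx i" "Q (y i) = Qy i" if "i < 4" for i
    using that inj disj(3) unfolding Q_def by auto
  have F: "F \<subseteq> E" using xy unfolding F_def by blast
  have simpF: "simple_graph (W, F)"
    unfolding simple_graph_def fst_conv snd_conv
  proof
    fix e assume "e \<in> F"
    then obtain i j where ij: "i < 4" "j < 4" "e = {x i, y j}" unfolding F_def by blast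
    then show "\<exists>p\<in>W. \<exists>q\<in>W. p \<noteq> q \<and> e = {p, q}"
      using ne(3)[OF ij(1,2)] unfolding W_def by (intro bexI[of _ "x i"] bexI[of _ "y j"]) auto
  qed
  have dF: "drawing (W, F) torus pt curve"
    using drawing_mono[OF d _ F simpF] V unfolding W_def by blast
  \<comment> \<open>The chosen lifts of the vertices fit exactly, so the factor \<open>k\<close> is
    always 0, and 1 merely stands for some nonzero lattice vector.\<close>
  have emb: "embeds_in (W, F) (UNIV :: complex set)"
  proof (rule planar_of_lift[OF dF simpF, of Q 1])
    show "torus_cover (Q v) = pt v" if "v \<in> W" for v using that Q Qx(1) Qy(1) unfolding W_def by auto
    show "1 \<in> gauss_ints" "(1 :: complex) \<noteq> 0" by (auto simp: gauss_ints_def)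
    fix e assume "e \<in> F"
    then obtain i j where ij: "i < 4" "j < 4" "e = {x i, y j}" unfolding F_def by blast
    obtain h where h: "path h" "pathstart h = Qx i" "\<forall>t\<in>{0..1}. torus_cover (h t) = oriented pt curve (x i) (y j) t"
      "torus_cover (pathfinish h) = pt (y j)" "path_image h \<subseteq> torus_cover -` path_image (curve {x i, y j})"
      using edge_lift[OF d xy[OF ij(1,2)] Qx(1)[OF ij(1)]] by metis
    \<comment> \<open>The edge lies in the piece belonging to \<open>i\<close> and \<open>j\<close>.
      In its preimage the end of the lifted edge and \<open>Qy j\<close> are lifts of one vertex in
      one path component, hence equal.\<close>
    have "{x i, y j} \<in> E' i j" unfolding E'_def by blast
    then have "path_component (Y i j) (Qx i) (pathfinish h)"
      using path_component_of_path_in[OF h(1), of "Y i j"] h(2,5) curve_Y[of "{x i, y j}" i j] by auto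
    then have "path_component (Y i j) (Qy j) (pathfinish h)"
      using Qx(2)[OF ij(1)] Qy(2)[OF ij(2)] by (meson path_component_sym path_component_trans)
    then have "Qy j = pathfinish h" using trivial[OF ij(1,2)] Qy(1)[OF ij(2)] h(4) by simp
    then have "e = {x i, y j} \<and> path h \<and> pathstart h = Q (x i) \<and> pathfinish h = Q (y j) + of_int 0 * 1 \<and>
         (\<forall>t\<in>{0..1}. torus_cover (h t) = oriented pt curve (x i) (y j) t)"
      using h(1-3) ij Q by simp
    then show "\<exists>p q h k. e = {p, q} \<and> path h \<and> pathstart h = Q p \<and> pathfinish h = Q q + of_int k * 1 \<and>
         (\<forall>t\<in>{0..1}. torus_cover (h t) = oriented pt curve p q t)"
      by blast
  qed
  have "nonplanar_on F (x ` {..<3} \<union> y ` {..<3})"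
  proof (rule nonplanar_on_K33)
    show "inj_on x {..<3}" "inj_on y {..<3}" using inj by (auto intro: inj_on_subset)
    have "x ` {..<3} \<subseteq> x ` {..<4}" "y ` {..<3} \<subseteq> y ` {..<4}" by auto
    then show "x ` {..<3} \<inter> y ` {..<3} = {}" using disj(3) by blast
    show "{x i, y j} \<in> F" if "i < 3" "j < 3" for i j using that unfolding F_def by force
  qed
  then obtain F' where F': "F' \<subseteq> F" "simple_graph (x ` {..<3} \<union> y ` {..<3}, F')"
      "\<not> embeds_in (x ` {..<3} \<union> y ` {..<3}, F') (UNIV :: complex set)"
    unfolding nonplanar_on_def by blast
  have "x ` {..<3} \<union> y ` {..<3} \<subseteq> W" unfolding W_def by auto
  then show False using embeds_in_mono[OF emb _ F'(1,2)] F'(3) by blast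
qed

section \<open>Small commutative rings\<close>

lemma is_ring_iso_sym: "ring R \<Longrightarrow> R \<simeq> S \<Longrightarrow> S \<simeq> R"
  using ring_iso_set_sym unfolding is_ring_iso_def by blast

lemma RDirProd_iso_cong: "R \<simeq> R' \<Longrightarrow> S \<simeq> S' \<Longrightarrow> RDirProd R S \<simeq> RDirProd R' S'"
  using RDirProd_iso6 unfolding is_ring_iso_def by blast

context ring
begin

definition int_elem :: "int \<Rightarrow> 'a" where "int_elem k = add_pow R k \<one>"

lemma int_elem_closed [simp, intro]: "int_elem k \<in> carrier R"
  unfolding int_elem_def by simp

lemma int_elem_add: "int_elem (i + j) = int_elem i \<oplus> int_elem j"
  unfolding int_elem_def by (rule add.int_pow_mult) simp

lemma int_elem_mult: "int_elem (i * j) = int_elem i \<otimes> int_elem j"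
proof -
  have "int_elem i \<otimes> int_elem j = add_pow R i (\<one> \<otimes> int_elem j)"
    unfolding int_elem_def by (rule add_pow_ldistr_int) simp_all
  also have "\<dots> = add_pow R i (add_pow R j \<one>)" unfolding int_elem_def by simp
  also have "\<dots> = add_pow R (j * i) \<one>" by (rule add.int_pow_pow) simp
  finally show ?thesis unfolding int_elem_def by (simp add: mult.commute)
qed

lemma int_elem_0 [simp]: "int_elem 0 = \<zero>" and int_elem_1 [simp]: "int_elem 1 = \<one>"
  unfolding int_elem_def by (simp_all add: add_pow_int_ge)

lemma int_elem_minus: "int_elem (- i) = \<ominus> int_elem i"
proof -
  have "int_elem (- i) \<oplus> int_elem i = \<zero>" using int_elem_add[of "- i" i] by simp
  then show ?thesis by (simp add: minus_equality)
qed

lemma int_elem_diff: "int_elem (i - j) = int_elem i \<ominus> int_elem j"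
  using int_elem_add[of i "- j"] by (simp add: int_elem_minus a_minus_def)

lemma card_int_elem:
  assumes "finite (carrier R)" shows "int_elem (int (card (carrier R))) = \<zero>"
  using add.pow_order_eq_1[of \<one>] unfolding int_elem_def
  by (simp add: order_def add_pow_int_ge)

lemma int_elem_mod:
  assumes "int_elem n = \<zero>" shows "int_elem (k mod n) = int_elem k"
proof -
  have "int_elem k = int_elem (n * (k div n) + k mod n)" by simp
  also have "\<dots> = int_elem (k mod n)" unfolding int_elem_add int_elem_mult assms by simp
  finally show ?thesis ..
qed

lemma int_elem_gcd:
  assumes "int_elem k = \<zero>" "int_elem n = \<zero>" shows "int_elem (gcd k n) = \<zero>"
proof -
  obtain u v where "u * k + v * n = gcd k n" using bezout_int by blast
  then have "int_elem (gcd k n) = int_elem (u * k + v * n)" by simp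
  then show ?thesis unfolding int_elem_add int_elem_mult assms by simp
qed

text \<open>The kernel of \<open>int_elem\<close> contains \<open>n\<close>, and with any
  \<open>k\<close> also \<open>gcd k n\<close>. So it is enough to keep the proper divisors of
  \<open>n\<close> out of it.\<close>

lemma iso_residue_ring:
  assumes n: "1 < n" and card: "card (carrier R) = n"
    and ord: "\<And>d. \<lbrakk>d dvd n; d < n\<rbrakk> \<Longrightarrow> int_elem (int d) \<noteq> \<zero>"
  shows "R \<simeq> Zmod (int n)"
proof -
  have fin: "finite (carrier R)" using n card card.infinite by force
  have n0: "int_elem (int n) = \<zero>" using card_int_elem[OF fin] card by simp
  have ker: "int n dvd k" if k: "int_elem k = \<zero>" for k
  proof -
    define d where "d = nat (gcd k (int n))"
    have d: "int d = gcd k (int n)" by (simp add: d_def)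
    then have "int_elem (int d) = \<zero>" using int_elem_gcd[OF k n0] by simp
    moreover have "d dvd n" using gcd_dvd2[of k "int n"] unfolding d[symmetric] by simp
    ultimately have "\<not> d < n" using ord by blast
    then have "d = n" using \<open>d dvd n\<close> n dvd_imp_le[of d n] by simp
    then show ?thesis using d gcd_dvd1[of k "int n"] by simp
  qed
  have carr: "carrier (Zmod (int n)) = {0..int n - 1}" by (simp add: residue_ring_def)
  have inj: "inj_on int_elem {0..int n - 1}"
  proof (rule inj_onI)
    fix i j assume ij: "i \<in> {0..int n - 1}" "j \<in> {0..int n - 1}" "int_elem i = int_elem j"
    then have "int_elem (i - j) = \<zero>" unfolding int_elem_diff by (simp add: a_minus_def r_neg)
    then have "int n dvd i - j" by (rule ker)
    moreover have "\<bar>i - j\<bar> < int n" using ij by auto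
    ultimately have "i - j = 0" using zdvd_not_zless[of "\<bar>i - j\<bar>" "int n"] by (metis abs_ge_zero abs_eq_0 dvd_abs_iff le_less)
    then show "i = j" by simp
  qed
  have "int_elem ` {0..int n - 1} = carrier R"
    by (rule card_subset_eq[OF fin]) (auto simp: card_image[OF inj] card)
  then have bij: "bij_betw int_elem (carrier (Zmod (int n))) (carrier R)"
    unfolding carr bij_betw_def using inj by simp
  have "int_elem \<in> ring_iso (Zmod (int n)) R"
  proof (rule ring_iso_memI)
    show "int_elem \<one>\<^bsub>Zmod (int n)\<^esub> = \<one>" by (simp add: residue_ring_def)
  qed (use bij int_elem_mod[OF n0] in \<open>auto simp: residue_ring_def int_elem_add int_elem_mult\<close>)
  then have "Zmod (int n) \<simeq> R" unfolding is_ring_iso_def by blast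
  moreover have "ring (Zmod (int n))"
    using residues.cring[of "int n"] n by (simp add: residues_def cring.axioms(1))
  ultimately show ?thesis using is_ring_iso_sym by blast
qed

end

text \<open>The isomorphism comes from evaluating polynomials at \<open>t\<close>. Since
  \<open>t\<close> has square zero, only the two lowest coefficients matter. The map is onto by
  counting, as the \<open>p ^ 2\<close> pairs of residues have different values, and its kernel
  consists of the multiples of the square of X.\<close>

lemma (in cring) iso_Zmod_dual:
  assumes p: "Factorial_Ring.prime p" and card: "card (carrier R) = p ^ 2" and char: "int_elem (int p) = \<zero>"
    and t: "t \<in> carrier R" "t \<otimes> t = \<zero>" "\<And>k. t \<noteq> int_elem k" and nontriv: "\<one> \<noteq> \<zero>"
  shows "R \<simeq> Zmod_dual (int p)"
proof -
  define Z where "Z = Zmod (int p)"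
  have p1: "1 < p" using p prime_gt_1_nat by blast
  have fin: "finite (carrier R)" using card p1 card.infinite by force
  interpret K: field Z unfolding Z_def using residues_prime.is_field[of p] p by (simp add: residues_prime_def)
  have Z: "carrier Z = {0..int p - 1}" "\<And>x y. x \<otimes>\<^bsub>Z\<^esub> y = (x * y) mod int p" "\<And>x y. x \<oplus>\<^bsub>Z\<^esub> y = (x + y) mod int p"
    "\<zero>\<^bsub>Z\<^esub> = 0" "\<one>\<^bsub>Z\<^esub> = 1" unfolding Z_def residue_ring_def by auto
  define P where "P = univ_poly Z (carrier Z)"
  have P: "ring P" "cring P" unfolding P_def
    using K.univ_poly_is_ring[OF K.carrier_is_subring] K.univ_poly_is_cring[OF K.carrier_is_subring] by auto
  interpret P: cring P by (rule P(2))
  have Pc: "q \<in> carrier P \<longleftrightarrow> polynomial\<^bsub>Z\<^esub> (carrier Z) q" for q unfolding P_def univ_poly_carrier ..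
  have Pset: "set q \<subseteq> carrier Z" if "q \<in> carrier P" for q
    using that K.polynomial_in_carrier[OF K.carrier_is_subring] unfolding Pc by blast
  have Pop: "\<zero>\<^bsub>P\<^esub> = []" "\<one>\<^bsub>P\<^esub> = [1]" "\<And>q r. q \<otimes>\<^bsub>P\<^esub> r = K.poly_mult q r" "\<And>q r. q \<oplus>\<^bsub>P\<^esub> r = K.poly_add q r"
    unfolding P_def univ_poly_def by (auto simp: Z)
  define f where "f q = int_elem (K.coeff q 0) \<oplus> int_elem (K.coeff q 1) \<otimes> t" for q
  have coeffZ: "K.coeff q i \<in> carrier Z" if "q \<in> carrier P" for q i using K.coeff_in_carrier[OF Pset[OF that]] .
  note mods = int_elem_mod[OF char]
  have f_add: "f (q \<oplus>\<^bsub>P\<^esub> r) = f q \<oplus> f r" if "q \<in> carrier P" "r \<in> carrier P" for q r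
  proof -
    have "K.coeff (q \<oplus>\<^bsub>P\<^esub> r) i = (K.coeff q i + K.coeff r i) mod int p" for i
      unfolding Pop K.poly_add_coeff[OF Pset[OF that(1)] Pset[OF that(2)]] Z ..
    then have "f (q \<oplus>\<^bsub>P\<^esub> r) = (int_elem (K.coeff q 0) \<oplus> int_elem (K.coeff r 0)) \<oplus>
        (int_elem (K.coeff q 1) \<oplus> int_elem (K.coeff r 1)) \<otimes> t"
      unfolding f_def by (simp add: mods int_elem_add)
    also have "\<dots> = f q \<oplus> f r" unfolding f_def using t(1) int_elem_closed by algebra
    finally show ?thesis .
  qed
  have f_mult: "f (q \<otimes>\<^bsub>P\<^esub> r) = f q \<otimes> f r" if qr: "q \<in> carrier P" "r \<in> carrier P" for q r
  proof -
    have c: "K.coeff (q \<otimes>\<^bsub>P\<^esub> r) = (\<lambda>i. \<Oplus>\<^bsub>Z\<^esub>k\<in>{..i}. K.coeff q k \<otimes>\<^bsub>Z\<^esub> K.coeff r (i - k))"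
      unfolding Pop using K.poly_mult_coeff[OF Pset[OF qr(1)] Pset[OF qr(2)]] .
    have cl: "(\<lambda>k. K.coeff q k \<otimes>\<^bsub>Z\<^esub> K.coeff r (i - k)) \<in> A \<rightarrow> carrier Z" for i A
      using coeffZ[OF qr(1)] coeffZ[OF qr(2)] by blast
    have c0: "K.coeff (q \<otimes>\<^bsub>P\<^esub> r) 0 = K.coeff q 0 \<otimes>\<^bsub>Z\<^esub> K.coeff r 0"
      unfolding c using K.finsum_0[of "\<lambda>k. K.coeff q k \<otimes>\<^bsub>Z\<^esub> K.coeff r (0 - k)"] cl[of 0 "{..0}"]
        coeffZ[OF qr(1)] coeffZ[OF qr(2)] by simp
    have c1: "K.coeff (q \<otimes>\<^bsub>P\<^esub> r) 1 = K.coeff q 1 \<otimes>\<^bsub>Z\<^esub> K.coeff r 0 \<oplus>\<^bsub>Z\<^esub> K.coeff q 0 \<otimes>\<^bsub>Z\<^esub> K.coeff r 1"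
      unfolding c One_nat_def
      using K.finsum_Suc[of "\<lambda>k. K.coeff q k \<otimes>\<^bsub>Z\<^esub> K.coeff r (Suc 0 - k)" 0] cl[of 1 "{..Suc 0}"] cl[of 1 "{..0}"]
        K.finsum_0[of "\<lambda>k. K.coeff q k \<otimes>\<^bsub>Z\<^esub> K.coeff r (Suc 0 - k)"]
        coeffZ[OF qr(1)] coeffZ[OF qr(2)] by simp
    define a0 a1 b0 b1 where "a0 = int_elem (K.coeff q 0)" and "a1 = int_elem (K.coeff q 1)"
      and "b0 = int_elem (K.coeff r 0)" and "b1 = int_elem (K.coeff r 1)"
    have cl': "a0 \<in> carrier R" "a1 \<in> carrier R" "b0 \<in> carrier R" "b1 \<in> carrier R"
      unfolding a0_def a1_def b0_def b1_def by auto
    have "f (q \<otimes>\<^bsub>P\<^esub> r) = a0 \<otimes> b0 \<oplus> (a1 \<otimes> b0 \<oplus> a0 \<otimes> b1) \<otimes> t"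
      unfolding f_def c0 c1 a0_def a1_def b0_def b1_def Z by (simp add: mods int_elem_add int_elem_mult)
    also have "\<dots> = a0 \<otimes> b0 \<oplus> (a1 \<otimes> b0 \<oplus> a0 \<otimes> b1) \<otimes> t \<oplus> a1 \<otimes> b1 \<otimes> (t \<otimes> t)"
      unfolding t(2) using cl' t(1) by simp
    also have "\<dots> = (a0 \<oplus> a1 \<otimes> t) \<otimes> (b0 \<oplus> b1 \<otimes> t)" using cl' t(1) by algebra
    finally show ?thesis unfolding f_def a0_def a1_def b0_def b1_def .
  qed
  have f_hom: "f \<in> ring_hom P R"
  proof (rule ring_hom_memI)
    show "f \<one>\<^bsub>P\<^esub> = \<one>" unfolding Pop f_def using t(1) by (simp add: Z)
    show "f q \<in> carrier R" for q unfolding f_def using t(1) by simp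
  qed (use f_add f_mult in auto)
  interpret H: ring_hom_ring P R f
    by (intro ring_hom_ringI2 P(1) f_hom ring_axioms)
  \<comment> \<open>If \<open>b\<close> and \<open>b'\<close> differed, their difference would be
    invertible modulo \<open>p\<close>, and \<open>t\<close> would be an integer multiple of
    one.\<close>
  have indep: "a = a' \<and> b = b'" if ab: "a \<in> carrier Z" "a' \<in> carrier Z" "b \<in> carrier Z" "b' \<in> carrier Z"
      and eq: "int_elem a \<oplus> int_elem b \<otimes> t = int_elem a' \<oplus> int_elem b' \<otimes> t" for a b a' b'
  proof -
    have tb: "int_elem (b - b') \<otimes> t = int_elem (a' - a)"
    proof -
      define A B A' B' where "A = int_elem a" and "B = int_elem b" and "A' = int_elem a'" and "B' = int_elem b'"
      have cl: "A \<in> carrier R" "B \<in> carrier R" "A' \<in> carrier R" "B' \<in> carrier R" unfolding A_def B_def A'_def B'_def by auto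
      have "(B \<ominus> B') \<otimes> t = (A \<oplus> B \<otimes> t) \<ominus> A \<ominus> B' \<otimes> t" using cl t(1) by algebra
      also have "A \<oplus> B \<otimes> t = A' \<oplus> B' \<otimes> t" using eq unfolding A_def B_def A'_def B'_def .
      also have "(A' \<oplus> B' \<otimes> t) \<ominus> A \<ominus> B' \<otimes> t = A' \<ominus> A" using cl t(1) by algebra
      finally show ?thesis unfolding int_elem_diff A_def B_def A'_def B'_def .
    qed
    have small: "k = 0" if "\<bar>k\<bar> < int p" "int p dvd k" for k
      using that zdvd_not_zless[of "\<bar>k\<bar>" "int p"] by (metis abs_ge_zero abs_eq_0 dvd_abs_iff le_less)
    have inv: "int p dvd k \<or> (\<exists>u. int_elem (u * k) = \<one>)" for k
    proof (cases "int p dvd k")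
      case False
      then have "coprime (int p) k" using p by (simp add: prime_imp_coprime)
      then obtain u v where "u * int p + v * k = 1" using bezout_int[of "int p" k] by auto
      then have "int_elem (u * int p + v * k) = \<one>" by simp
      then have "int_elem (v * k) = \<one>" unfolding int_elem_add int_elem_mult[of u] char by simp
      then show ?thesis by blast
    qed simp
    have b: "b = b'"
    proof (rule ccontr)
      assume "b \<noteq> b'"
      then have "\<not> int p dvd b - b'" using small[of "b - b'"] ab unfolding Z atLeastAtMost_iff by linarith
      then obtain u where u: "int_elem (u * (b - b')) = \<one>" using inv by blast
      have "t = int_elem (u * (b - b')) \<otimes> t" using u t(1) by simp
      also have "\<dots> = int_elem u \<otimes> (int_elem (b - b') \<otimes> t)"
        unfolding int_elem_mult using t(1) by (simp add: m_assoc)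
      also have "\<dots> = int_elem (u * (a' - a))" unfolding tb int_elem_mult ..
      finally show False using t(3) by blast
    qed
    then have "int_elem (a' - a) = \<zero>" using tb t(1) by simp
    moreover have "int_elem (u * (a' - a)) = int_elem u \<otimes> int_elem (a' - a)" for u by (rule int_elem_mult)
    ultimately have "int p dvd a' - a" using inv[of "a' - a"] nontriv by auto
    moreover have "\<bar>a' - a\<bar> < int p" using ab unfolding Z by auto
    ultimately have "a' - a = 0" by (intro small)
    then show ?thesis using b by simp
  qed
  have X: "X\<^bsub>Z\<^esub> \<in> carrier P" unfolding P_def using K.var_closed(1)[OF K.carrier_is_subring] .
  have fX: "f X\<^bsub>Z\<^esub> = t" unfolding f_def var_def using t(1) by (simp add: Z)
  have const: "\<exists>q\<in>carrier P. f q = int_elem a" if a: "a \<in> carrier Z" for a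
  proof (cases "a = 0")
    case True
    have "f \<zero>\<^bsub>P\<^esub> = int_elem a" using True H.hom_zero by simp
    then show ?thesis using P.zero_closed by blast
  next
    case False
    have "[a] \<in> carrier P" unfolding Pc polynomial_def using False a by (simp add: Z)
    moreover have "f [a] = int_elem a" unfolding f_def using t(1) by (simp add: Z)
    ultimately show ?thesis by blast
  qed
  define S where "S = (\<lambda>(a, b). int_elem a \<oplus> int_elem b \<otimes> t) ` (carrier Z \<times> carrier Z)"
  have "inj_on (\<lambda>(a, b). int_elem a \<oplus> int_elem b \<otimes> t) (carrier Z \<times> carrier Z)"
    using indep by (auto simp: inj_on_def)
  then have "card S = card (carrier Z \<times> carrier Z)" unfolding S_def by (rule card_image)
  also have "\<dots> = p ^ 2" by (simp add: card_cartesian_product Z power2_eq_square)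
  finally have "card S = card (carrier R)" using card by simp
  moreover have "S \<subseteq> carrier R" unfolding S_def using t(1) by auto
  ultimately have SR: "S = carrier R" using card_subset_eq[OF fin] by blast
  have "carrier R \<subseteq> f ` carrier P"
  proof
    fix x assume "x \<in> carrier R"
    then have "x \<in> S" using SR by simp
    then obtain a b where ab: "a \<in> carrier Z" "b \<in> carrier Z" "x = int_elem a \<oplus> int_elem b \<otimes> t"
      unfolding S_def by auto
    obtain q r where qr: "q \<in> carrier P" "f q = int_elem a" "r \<in> carrier P" "f r = int_elem b"
      using const[OF ab(1)] const[OF ab(2)] by blast
    have "f (q \<oplus>\<^bsub>P\<^esub> r \<otimes>\<^bsub>P\<^esub> X\<^bsub>Z\<^esub>) = x" using qr X fX ab(3) by simp
    then show "x \<in> f ` carrier P" using qr X by (metis P.add.m_closed P.m_closed imageI)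
  qed
  then have surj: "f ` carrier P = carrier R" by auto
  define X2 where "X2 = X\<^bsub>Z\<^esub> [^]\<^bsub>P\<^esub> (2::nat)"
  have X2: "X2 = X\<^bsub>Z\<^esub> \<otimes>\<^bsub>P\<^esub> X\<^bsub>Z\<^esub>" unfolding X2_def using X by (simp add: numeral_2_eq_2)
  have "a_kernel P R f = PIdl\<^bsub>P\<^esub> X2"
  proof (intro equalityI subsetI)
    fix q assume "q \<in> PIdl\<^bsub>P\<^esub> X2"
    then obtain r where r: "r \<in> carrier P" "q = r \<otimes>\<^bsub>P\<^esub> X2" unfolding cgenideal_def by blast
    have "f q = f r \<otimes> (f X\<^bsub>Z\<^esub> \<otimes> f X\<^bsub>Z\<^esub>)" unfolding r(2) X2 using r(1) X by simp
    also have "\<dots> = \<zero>" unfolding fX t(2) using r(1) by simp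
    finally show "q \<in> a_kernel P R f" unfolding a_kernel_def' using r X X2 by simp
  next
    fix q assume "q \<in> a_kernel P R f"
    then have q: "q \<in> carrier P" "f q = \<zero>" unfolding a_kernel_def' by auto
    have "int_elem (K.coeff q 0) \<oplus> int_elem (K.coeff q 1) \<otimes> t = int_elem 0 \<oplus> int_elem 0 \<otimes> t"
      using q(2) t(1) unfolding f_def by simp
    moreover have "0 \<in> carrier Z" using K.zero_closed by (simp add: Z)
    ultimately have c: "K.coeff q 0 = 0" "K.coeff q 1 = 0"
      using indep coeffZ[OF q(1)] by blast+
    have "\<exists>r\<in>carrier P. q = r \<otimes>\<^bsub>P\<^esub> X2"
    proof (cases "q = []")
      case True
      then have "q = \<zero>\<^bsub>P\<^esub> \<otimes>\<^bsub>P\<^esub> X2" using X X2 by (simp add: Pop(1)[symmetric])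
      then show ?thesis using P.zero_closed by blast
    next
      case False
      then have lead: "hd q \<noteq> 0" "set q \<subseteq> carrier Z" using q(1) unfolding Pc polynomial_def by (auto simp: Z)
      \<comment> \<open>Coefficients are listed from the leading one downwards. Vanishing lowest
        coefficients are therefore zeros at the end of the list, and multiplication by X appends a
        zero; something remains in front because the leading coefficient is not 0.\<close>
      have "\<exists>r. r \<noteq> [] \<and> q = r @ [0, 0]"
      proof -
        have coeff_nth: "K.coeff l i = l ! (length l - 1 - i)" if "i < length l" for l i
          using that by (induction l) (auto simp: nth_Cons' )
        obtain y ys where y: "q = ys @ [y]" using False by (metis rev_exhaust)
        have "y = 0" using c(1) coeff_nth[of 0 q] unfolding y by simp
        moreover have "ys \<noteq> []" using lead(1) \<open>y = 0\<close> y by auto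
        then obtain z zs where z: "ys = zs @ [z]" by (metis rev_exhaust)
        moreover have "z = 0" using c(2) coeff_nth[of 1 q] unfolding y z by (simp add: nth_append)
        moreover have "zs \<noteq> []" using lead(1) \<open>z = 0\<close> y z by auto
        ultimately show ?thesis using y by auto
      qed
      then obtain r where r: "r \<noteq> []" "q = r @ [0, 0]" by blast
      have rP: "r \<in> carrier P" unfolding Pc polynomial_def using r lead by (auto simp: Z)
      have vm: "s \<otimes>\<^bsub>P\<^esub> X\<^bsub>Z\<^esub> = s @ [0]" if "s \<in> carrier P" "s \<noteq> []" for s
        using K.poly_mult_var[OF K.carrier_is_subring, of s] that unfolding P_def by (simp add: Z)
      have "r \<otimes>\<^bsub>P\<^esub> X2 = (r \<otimes>\<^bsub>P\<^esub> X\<^bsub>Z\<^esub>) \<otimes>\<^bsub>P\<^esub> X\<^bsub>Z\<^esub>" unfolding X2 using rP X by (simp add: P.m_assoc)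
      moreover have "r @ [0] \<in> carrier P" using P.m_closed[OF rP X] vm[OF rP r(1)] by simp
      ultimately have "r \<otimes>\<^bsub>P\<^esub> X2 = q" using vm[of "r @ [0]"] vm[OF rP r(1)] r(2) by simp
      then show ?thesis using rP by auto
    qed
    then show "q \<in> PIdl\<^bsub>P\<^esub> X2" unfolding cgenideal_def by blast
  qed
  then have "P Quot (PIdl\<^bsub>P\<^esub> X2) \<simeq> R" using H.FactRing_iso[OF surj] by simp
  moreover have "Zmod_dual (int p) = P Quot (PIdl\<^bsub>P\<^esub> X2)"
    unfolding Zmod_dual_def Let_def X2_def P_def Z_def ..
  moreover have "ring (P Quot (PIdl\<^bsub>P\<^esub> X2))"
    using ideal.quotient_is_ring[OF P.cgenideal_ideal] X X2 by simp
  ultimately show ?thesis using is_ring_iso_sym by simp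
qed

section \<open>Zero-divisors and maximal ideals of finite rings\<close>

lemma (in cring) finite_nonunit_zero_divisor:
  assumes fin: "finite (carrier R)" and I: "ideal I R" "\<one> \<notin> I" "a \<in> I"
  shows "a \<in> zero_divisors R"
proof -
  have a: "a \<in> carrier R" using ideal.Icarr[OF I(1,3)] .
  define f where "f x = a \<otimes> x" for x
  \<comment> \<open>Multiplication by \<open>a\<close> stays in a proper ideal, so it is not onto;
    on a finite ring it is then not injective, and \<open>a\<close> kills a difference.\<close>
  have "f ` carrier R \<subseteq> I" unfolding f_def using ideal.I_r_closed[OF I(1,3)] by blast
  then have "f ` carrier R \<noteq> carrier R" using I(2) by blast
  moreover have "f ` carrier R \<subseteq> carrier R" unfolding f_def using a by blast
  ultimately have "\<not> inj_on f (carrier R)" using fin endo_inj_surj by blast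
  then obtain x y where xy: "x \<in> carrier R" "y \<in> carrier R" "x \<noteq> y" "a \<otimes> x = a \<otimes> y"
    unfolding inj_on_def f_def by blast
  have "a \<otimes> (x \<ominus> y) = a \<otimes> x \<ominus> a \<otimes> y" using a xy(1,2) by algebra
  then have "a \<otimes> (x \<ominus> y) = \<zero>" using xy a by (simp add: a_minus_def r_neg)
  moreover have "x \<ominus> y \<noteq> \<zero>" using xy(1-3) by (simp add: r_right_minus_eq)
  ultimately show ?thesis unfolding zero_divisors_def using a xy by (blast intro: minus_closed)
qed

lemma (in cring) unit_not_zero_divisor:
  assumes "a \<in> carrier R" "b \<in> carrier R" "a \<otimes> b = \<one>"
  shows "a \<notin> zero_divisors R"
proof
  assume "a \<in> zero_divisors R"
  then obtain c where c: "c \<in> carrier R" "c \<noteq> \<zero>" "a \<otimes> c = \<zero>" unfolding zero_divisors_def by blast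
  have "c = (a \<otimes> b) \<otimes> c" using assms c by simp
  also have "\<dots> = b \<otimes> (a \<otimes> c)" using assms(1,2) c(1) by algebra
  also have "\<dots> = \<zero>" using c assms by simp
  finally show False using c by simp
qed

lemma (in cring) finite_exists_maximalideal:
  assumes fin: "finite (carrier R)" and I: "ideal I R" "\<one> \<notin> I"
  shows "\<exists>M. maximalideal M R \<and> I \<subseteq> M"
proof -
  define F where "F = {J. ideal J R \<and> I \<subseteq> J \<and> \<one> \<notin> J}"
  have "F \<subseteq> Pow (carrier R)"
  proof
    fix J assume "J \<in> F"
    then have "ideal J R" unfolding F_def by simp
    then show "J \<in> Pow (carrier R)" using ideal.Icarr by fastforce
  qed
  then have "finite F" using fin finite_subset by blast
  moreover have "I \<in> F" unfolding F_def using I by blast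
  ultimately obtain M where M: "M \<in> F" "\<And>J. J \<in> F \<Longrightarrow> M \<subseteq> J \<Longrightarrow> J = M"
    using finite_has_maximal[of F] by blast
  have M': "ideal M R" "I \<subseteq> M" "\<one> \<notin> M" using M(1) unfolding F_def by auto
  have "maximalideal M R"
  proof (rule maximalidealI[OF M'(1)])
    show "carrier R \<noteq> M" using M'(3) by blast
    fix J assume J: "ideal J R" "M \<subseteq> J" "J \<subseteq> carrier R"
    show "J = M \<or> J = carrier R"
    proof (cases "\<one> \<in> J")
      case True then show ?thesis using ideal.one_imp_carrier[OF J(1)] by blast
    next
      case False
      then have "J \<in> F" unfolding F_def using J M' by blast
      then show ?thesis using M(2) J(2) by blast
    qed
  qed
  then show ?thesis using M' by blast
qed

lemma (in cring) one_notin_maximalideal: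
  assumes M: "maximalideal M R"
  shows "\<one> \<notin> M"
proof
  assume "\<one> \<in> M"
  then have "M = carrier R" using ideal.one_imp_carrier[OF maximalideal.axioms(1)[OF M]] by blast
  then show False using maximalideal.I_notcarr[OF M] by simp
qed

text \<open>A zero-divisor is not invertible, so the principal ideal it generates is proper and lies
  in a maximal ideal, of which there is only one.\<close>

lemma (in cring) local_zero_divisors:
  assumes fin: "finite (carrier R)" and loc: "local_ring R"
  obtains M where "ideal M R" "\<one> \<notin> M" "zero_divisors R = M"
proof -
  obtain M where M: "maximalideal M R" "\<And>J. maximalideal J R \<Longrightarrow> J = M"
    using loc unfolding local_ring_def by blast
  note M' = maximalideal.axioms(1)[OF M(1)] one_notin_maximalideal[OF M(1)]
  have "zero_divisors R = M"
  proof (intro equalityI subsetI)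
    fix a assume a: "a \<in> zero_divisors R"
    then have ac: "a \<in> carrier R" unfolding zero_divisors_def by blast
    have "\<one> \<notin> PIdl a"
    proof
      assume "\<one> \<in> PIdl a"
      then obtain x where "x \<in> carrier R" "\<one> = x \<otimes> a" unfolding cgenideal_def by blast
      then show False using unit_not_zero_divisor[of a x] ac a by (simp add: m_comm)
    qed
    then obtain J where "maximalideal J R" "PIdl a \<subseteq> J"
      using finite_exists_maximalideal[OF fin cgenideal_ideal[OF ac]] by blast
    then show "a \<in> M" using M(2) cgenideal_self[OF ac] by blast
  qed (use finite_nonunit_zero_divisor[OF fin M'] in blast)
  then show ?thesis using that M' by blast
qed

section \<open>Idempotents of nonlocal rings\<close>

lemma (in monoid) finite_idempotent_power:
  assumes fin: "finite (carrier G)" and a: "a \<in> carrier G"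
  shows "\<exists>n::nat. a [^] Suc n \<otimes> a [^] Suc n = a [^] Suc n"
proof -
  have "\<not> inj_on (\<lambda>k::nat. a [^] k) UNIV"
    using fin a finite_imageD[of "\<lambda>k::nat. a [^] k" UNIV] finite_subset[of "range (\<lambda>k::nat. a [^] k)" "carrier G"] by auto
  then obtain i j :: nat where ij: "i < j" "a [^] i = a [^] j"
    unfolding inj_on_def by (metis linorder_neqE_nat)
  define d where "d = j - i"
  have step: "a [^] (i + k + d) = a [^] (i + k)" for k
  proof -
    have "a [^] (i + k + d) = a [^] j \<otimes> a [^] k" using ij(1) a by (simp add: nat_pow_mult d_def add.commute add.left_commute)
    also have "\<dots> = a [^] (i + k)" using ij(2)[symmetric] a by (simp add: nat_pow_mult)
    finally show ?thesis .
  qed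
  have many: "a [^] (i + k + m * d) = a [^] (i + k)" for k m
  proof (induction m)
    case (Suc m)
    have "a [^] (i + k + Suc m * d) = a [^] (i + (k + m * d) + d)" by (simp add: add.assoc add.commute add.left_commute)
    also have "\<dots> = a [^] (i + k + m * d)" using step[of "k + m * d"] by (simp add: add.assoc)
    finally show ?case using Suc by simp
  qed simp
  \<comment> \<open>From exponent \<open>i\<close> on the powers repeat with period
    \<open>d\<close>. A multiple of \<open>d\<close> that is at least \<open>i\<close> can be
    doubled without changing the power. The factor \<open>Suc i\<close> also makes it positive, so
    that the idempotent stays in every ideal containing \<open>a\<close>.\<close>
  define n where "n = Suc i * d"
  have d1: "d \<ge> 1" using ij(1) d_def by simp
  have n1: "n \<ge> Suc i" unfolding n_def using d1 mult_le_mono2[of 1 d "Suc i"] by simp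
  have "a [^] n \<otimes> a [^] n = a [^] (i + (n - i) + Suc i * d)" using n1 a by (simp add: nat_pow_mult n_def)
  also have "\<dots> = a [^] n" unfolding many using n1 by simp
  finally have "a [^] n \<otimes> a [^] n = a [^] n" .
  moreover obtain m where "n = Suc m" using n1 by (cases n) auto
  ultimately show ?thesis by blast
qed

text \<open>Two different maximal ideals \<open>M\<close> and \<open>N\<close> add up to the ring,
  so 1 is a sum of some \<open>a\<close> in \<open>M\<close> and \<open>b\<close> in
  \<open>N\<close>. An idempotent power of \<open>a\<close> lies in \<open>M\<close> and is
  congruent to 1 modulo \<open>N\<close>; hence it is neither 1 nor 0.\<close>

lemma (in cring) nonlocal_idempotent:
  assumes fin: "finite (carrier R)" and nontriv: "\<one> \<noteq> \<zero>" and nl: "\<not> local_ring R"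
  obtains e where "e \<in> carrier R" "e \<otimes> e = e" "e \<noteq> \<zero>" "e \<noteq> \<one>"
proof -
  have "\<one> \<notin> {\<zero>}" using nontriv by simp
  then obtain M where M: "maximalideal M R" using finite_exists_maximalideal[OF fin zeroideal] by blast
  then obtain N where N: "maximalideal N R" "N \<noteq> M" using nl unfolding local_ring_def by blast
  note Mi = maximalideal.axioms(1)[OF M] and Ni = maximalideal.axioms(1)[OF N(1)]
  have sub: "M \<subseteq> M <+> N" "N \<subseteq> M <+> N" "M <+> N \<subseteq> carrier R"
  proof -
    have z: "\<zero> \<in> M" "\<zero> \<in> N" using Mi Ni by (simp_all add: additive_subgroup.zero_closed ideal.axioms(1))
    show "M \<subseteq> M <+> N"
    proof
      fix x assume x: "x \<in> M"
      then have "x = x \<oplus> \<zero>" using ideal.Icarr[OF Mi] by simp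
      then show "x \<in> M <+> N" unfolding set_add_def' using x z by blast
    qed
    show "N \<subseteq> M <+> N"
    proof
      fix x assume x: "x \<in> N"
      then have "x = \<zero> \<oplus> x" using ideal.Icarr[OF Ni] by simp
      then show "x \<in> M <+> N" unfolding set_add_def' using x z by blast
    qed
    show "M <+> N \<subseteq> carrier R" unfolding set_add_def' using ideal.Icarr[OF Mi] ideal.Icarr[OF Ni] by blast
  qed
  have "M <+> N = carrier R"
  proof (rule ccontr)
    assume "M <+> N \<noteq> carrier R"
    then have "M <+> N = M" using maximalideal.I_maximal[OF M add_ideals[OF Mi Ni] sub(1,3)] by blast
    then have "N \<subseteq> M" using sub(2) by simp
    then have "M = N \<or> M = carrier R"
      using maximalideal.I_maximal[OF N(1) Mi] ideal.Icarr[OF Mi] by blast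
    then show False using N(2) maximalideal.I_notcarr[OF M] by blast
  qed
  then obtain a b where ab: "a \<in> M" "b \<in> N" "\<one> = a \<oplus> b" unfolding set_add_def' by blast
  have c: "a \<in> carrier R" "b \<in> carrier R" using ab ideal.Icarr[OF Mi] ideal.Icarr[OF Ni] by auto
  obtain n where n: "a [^] Suc n \<otimes> a [^] Suc n = a [^] Suc n" using finite_idempotent_power[OF fin c(1)] by blast
  define e where "e = a [^] Suc n"
  have pN: "\<one> \<ominus> a [^] k \<in> N" for k :: nat
  proof (induction k)
    case 0
    have "\<one> \<ominus> a [^] (0::nat) = \<zero>" by (simp add: a_minus_def r_neg)
    moreover have "\<zero> \<in> N" using Ni by (simp add: additive_subgroup.zero_closed ideal.axioms(1))
    ultimately show ?case by (simp only:)
  next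
    case (Suc k)
    define p where "p = a [^] k"
    have p: "p \<in> carrier R" unfolding p_def using c by simp
    have "a [^] Suc k = p \<otimes> a" unfolding p_def using c by simp
    have "p = p \<otimes> (a \<oplus> b)" using ab(3)[symmetric] p by simp
    then have "\<one> \<ominus> p \<otimes> a = (\<one> \<ominus> p) \<oplus> p \<otimes> b"
    proof -
      have "\<one> \<ominus> p \<otimes> a = (\<one> \<ominus> p \<otimes> (a \<oplus> b)) \<oplus> p \<otimes> b" using p c by algebra
      then show ?thesis using \<open>p = p \<otimes> (a \<oplus> b)\<close> by simp
    qed
    moreover have "\<one> \<ominus> p \<in> N" using Suc unfolding p_def .
    moreover have "p \<otimes> b \<in> N" using ideal.I_l_closed[OF Ni ab(2) p] .
    ultimately show ?case unfolding \<open>a [^] Suc k = p \<otimes> a\<close>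
      using additive_subgroup.a_closed[OF ideal.axioms(1)[OF Ni]] by simp
  qed
  have "e \<in> M"
  proof -
    have "e = a [^] n \<otimes> a" unfolding e_def by simp
    then show ?thesis using ideal.I_l_closed[OF Mi ab(1), of "a [^] n"] c by simp
  qed
  then have "e \<noteq> \<one>" using one_notin_maximalideal[OF M] by blast
  moreover have "e \<noteq> \<zero>"
  proof
    assume "e = \<zero>"
    then have "\<one> \<in> N" using pN[of "Suc n"] unfolding e_def[symmetric] by (simp add: a_minus_def)
    then show False using one_notin_maximalideal[OF N(1)] by blast
  qed
  moreover have "e \<in> carrier R" unfolding e_def using c by simp
  ultimately show ?thesis using that n unfolding e_def[symmetric] by blast
qed

text \<open>The Peirce corner of an idempotent. The operations remain those of \<open>R\<close> and
  only the unit changes, so the factors of the decomposition are at the same time ideals of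
  \<open>R\<close>, to which the bound on ideals applies.\<close>

definition corner :: "('a, 'b) ring_scheme \<Rightarrow> 'a \<Rightarrow> ('a, 'b) ring_scheme" where
  "corner R e = R\<lparr>carrier := {x \<in> carrier R. x \<otimes>\<^bsub>R\<^esub> e = x}, one := e\<rparr>"

lemma corner_simps [simp]:
  "carrier (corner R e) = {x \<in> carrier R. x \<otimes>\<^bsub>R\<^esub> e = x}" "mult (corner R e) = mult R"
  "\<one>\<^bsub>corner R e\<^esub> = e" "\<zero>\<^bsub>corner R e\<^esub> = \<zero>\<^bsub>R\<^esub>" "add (corner R e) = add R"
  by (simp_all add: corner_def)

context cring
begin

lemma corner_cring:
  assumes e: "e \<in> carrier R" "e \<otimes> e = e"
  shows "cring (corner R e)"
proof (intro cringI abelian_groupI comm_monoidI)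
  fix x y z assume x: "x \<in> carrier (corner R e)"
  then have x': "x \<in> carrier R" "x \<otimes> e = x" by auto
  show "\<exists>y\<in>carrier (corner R e). y \<oplus>\<^bsub>corner R e\<^esub> x = \<zero>\<^bsub>corner R e\<^esub>"
  proof (rule bexI[of _ "\<ominus> x"])
    show "\<ominus> x \<oplus>\<^bsub>corner R e\<^esub> x = \<zero>\<^bsub>corner R e\<^esub>" using x' by (simp add: l_neg)
    have "\<ominus> x \<otimes> e = \<ominus> (x \<otimes> e)" using x'(1) e by algebra
    then show "\<ominus> x \<in> carrier (corner R e)" using x' by simp
  qed
  show "\<one>\<^bsub>corner R e\<^esub> \<otimes>\<^bsub>corner R e\<^esub> x = x" using x' e by (simp add: m_comm)
  assume y: "y \<in> carrier (corner R e)"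
  then have y': "y \<in> carrier R" "y \<otimes> e = y" by auto
  show "x \<otimes>\<^bsub>corner R e\<^esub> y \<in> carrier (corner R e)" using x' y' e by (simp add: m_assoc)
  show "x \<oplus>\<^bsub>corner R e\<^esub> y \<in> carrier (corner R e)" using x' y' e by (simp add: l_distr)
qed (use e in \<open>auto simp: a_assoc m_assoc l_distr intro: a_comm m_comm\<close>)

lemma corner_ideal:
  assumes e: "e \<in> carrier R" "e \<otimes> e = e" "e \<noteq> \<one>"
  shows "ideal (carrier (corner R e)) R" "\<one> \<notin> carrier (corner R e)"
proof -
  have "carrier (corner R e) = PIdl e"
    unfolding cgenideal_def using e by (auto simp: m_assoc) (metis)
  then show "ideal (carrier (corner R e)) R" using cgenideal_ideal[OF e(1)] by simp
  show "\<one> \<notin> carrier (corner R e)" using e by auto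
qed

lemma complement_idempotent:
  assumes e: "e \<in> carrier R" "e \<otimes> e = e"
  shows "(\<one> \<ominus> e) \<otimes> (\<one> \<ominus> e) = \<one> \<ominus> e" "e \<otimes> (\<one> \<ominus> e) = \<zero>" "e \<oplus> (\<one> \<ominus> e) = \<one>"
proof -
  have "(\<one> \<ominus> e) \<otimes> (\<one> \<ominus> e) = \<one> \<ominus> e \<ominus> e \<oplus> e \<otimes> e" using e(1) by algebra
  also have "\<dots> = \<one> \<ominus> e" unfolding e(2) using e(1) by algebra
  finally show "(\<one> \<ominus> e) \<otimes> (\<one> \<ominus> e) = \<one> \<ominus> e" .
  have "e \<otimes> (\<one> \<ominus> e) = e \<ominus> e \<otimes> e" using e(1) by algebra
  then show "e \<otimes> (\<one> \<ominus> e) = \<zero>" unfolding e(2) using e(1) by (simp add: a_minus_def r_neg)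
  show "e \<oplus> (\<one> \<ominus> e) = \<one>" using e(1) by algebra
qed

text \<open>The inverse map is addition, since \<open>e\<close> and its complement are orthogonal
  and add up to 1.\<close>

lemma corner_decomposition:
  assumes e: "e \<in> carrier R" "e \<otimes> e = e"
  shows "R \<simeq> RDirProd (corner R e) (corner R (\<one> \<ominus> e))"
proof -
  define f where "f = \<one> \<ominus> e"
  note c = complement_idempotent[OF e, folded f_def]
  have f: "f \<in> carrier R" unfolding f_def using e by simp
  define h where "h x = (x \<otimes> e, x \<otimes> f)" for x
  have fe: "f \<otimes> e = \<zero>" using c(2) e f by (simp add: m_comm)
  have "h \<in> ring_iso R (RDirProd (corner R e) (corner R f))"
  proof (rule ring_iso_memI)
    have "bij_betw h (carrier R) (carrier (corner R e) \<times> carrier (corner R f))"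
    proof (rule bij_betw_byWitness[where f' = "\<lambda>(x, y). x \<oplus> y"])
      show "\<forall>x\<in>carrier R. (case h x of (x, y) \<Rightarrow> x \<oplus> y) = x"
        unfolding h_def using e f c(3) by (simp flip: r_distr)
      show "\<forall>p\<in>carrier (corner R e) \<times> carrier (corner R f). h (case p of (x, y) \<Rightarrow> x \<oplus> y) = p"
      proof clarify
        fix x y assume "x \<in> carrier (corner R e)" "y \<in> carrier (corner R f)"
        then have x: "x \<in> carrier R" "x \<otimes> e = x" and y: "y \<in> carrier R" "y \<otimes> f = y" by auto
        have "x \<otimes> f = x \<otimes> (e \<otimes> f)" using x e f by (metis m_assoc)
        then have xf: "x \<otimes> f = \<zero>" using c(2) x by simp
        have "y \<otimes> e = y \<otimes> (f \<otimes> e)" using y e f by (metis m_assoc)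
        then have ye: "y \<otimes> e = \<zero>" using fe y by simp
        show "h (x \<oplus> y) = (x, y)" unfolding h_def using x y e f xf ye by (simp add: l_distr)
      qed
      show "h ` carrier R \<subseteq> carrier (corner R e) \<times> carrier (corner R f)"
        unfolding h_def using e f c by (auto simp: m_assoc)
      show "(\<lambda>(x, y). x \<oplus> y) ` (carrier (corner R e) \<times> carrier (corner R f)) \<subseteq> carrier R" by auto
    qed
    then show "bij_betw h (carrier R) (carrier (RDirProd (corner R e) (corner R f)))"
      by (simp add: RDirProd_carrier)
    show "h \<one> = \<one>\<^bsub>RDirProd (corner R e) (corner R f)\<^esub>"
      unfolding h_def RDirProd_def DirProd_def using e f by (simp add: monoid.defs)
    fix x y assume xy: "x \<in> carrier R" "y \<in> carrier R"
    have xe: "(x \<otimes> y) \<otimes> e = (x \<otimes> e) \<otimes> (y \<otimes> e)"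
    proof -
      have "(x \<otimes> e) \<otimes> (y \<otimes> e) = (x \<otimes> y) \<otimes> (e \<otimes> e)" using xy e(1) by algebra
      then show ?thesis unfolding e(2) by simp
    qed
    have xf: "(x \<otimes> y) \<otimes> f = (x \<otimes> f) \<otimes> (y \<otimes> f)"
    proof -
      have "(x \<otimes> f) \<otimes> (y \<otimes> f) = (x \<otimes> y) \<otimes> (f \<otimes> f)" using xy f by algebra
      then show ?thesis unfolding c(1) by simp
    qed
    show "h (x \<otimes> y) = h x \<otimes>\<^bsub>RDirProd (corner R e) (corner R f)\<^esub> h y"
      unfolding h_def RDirProd_def DirProd_def using xe xf by (simp add: monoid.defs)
    show "h (x \<oplus> y) = h x \<oplus>\<^bsub>RDirProd (corner R e) (corner R f)\<^esub> h y"
      unfolding h_def RDirProd_def DirProd_def using xy e f by (simp add: monoid.defs l_distr)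
    show "h x \<in> carrier (RDirProd (corner R e) (corner R f))"
      unfolding h_def RDirProd_carrier using e f c xy by (auto simp: m_assoc)
  qed
  then show ?thesis unfolding f_def is_ring_iso_def by blast
qed

section \<open>Rings of prime order and of order 4\<close>

lemma iso_prime_order:
  assumes p: "Factorial_Ring.prime p" and card: "card (carrier R) = p"
  shows "R \<simeq> Zmod (int p)"
proof (rule iso_residue_ring[OF _ card])
  show "1 < p" using p prime_gt_1_nat by blast
  have "\<one> \<noteq> \<zero>"
  proof
    assume "\<one> = \<zero>"
    then have "carrier R = {\<zero>}" using one_zeroD by simp
    then show False using card \<open>1 < p\<close> by simp
  qed
  moreover fix d assume "d dvd p" "d < p"
  then have "d = 1" using p by (auto simp: prime_nat_iff)
  ultimately show "int_elem (int d) \<noteq> \<zero>" by simp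
qed

text \<open>If 2 is not 0, the additive group is generated by 1. Otherwise the elements are 0, 1,
  \<open>t\<close> and 1 + \<open>t\<close>, and the square of \<open>t\<close> decides: for 0 or 1
  there is an element of square zero that is not a multiple of 1, for \<open>t\<close> an
  idempotent, and for 1 + \<open>t\<close> the ring is a field.\<close>

lemma iso_order_4:
  assumes card: "card (carrier R) = 4"
  shows "R \<simeq> Zmod 4 \<or> R \<simeq> Zmod_dual 2 \<or> R \<simeq> RDirProd (Zmod 2) (Zmod 2) \<or>
    (\<exists>F4 :: nat ring. field F4 \<and> card (carrier F4) = 4 \<and> R \<simeq> F4)"
proof -
  have fin: "finite (carrier R)" using card card.infinite by fastforce
  have nontriv: "\<one> \<noteq> \<zero>"
  proof
    assume "\<one> = \<zero>"
    then have "carrier R = {\<zero>}" using one_zeroD by simp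
    then show False using card by simp
  qed
  have two: "int_elem 2 = \<one> \<oplus> \<one>" using int_elem_add[of 1 1] by simp
  show ?thesis
  proof (cases "\<one> \<oplus> \<one> = \<zero>")
    case False
    have "R \<simeq> Zmod (int 4)"
    proof (rule iso_residue_ring[OF _ card])
      fix d :: nat assume d: "d dvd 4" "d < 4"
      then have "d \<noteq> 0" "d \<noteq> 3" by auto
      then have "d = 1 \<or> d = 2" using d(2) by linarith
      then show "int_elem (int d) \<noteq> \<zero>" using nontriv False two by auto
    qed simp
    then show ?thesis by simp
  next
    case True
    have dbl: "x \<oplus> x = \<zero>" if "x \<in> carrier R" for x
    proof -
      have "x \<oplus> x = (\<one> \<oplus> \<one>) \<otimes> x" using that by algebra
      then show ?thesis using True that by simp
    qed
    have char: "int_elem (int 2) = \<zero>" using two True by simp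
    have ints: "int_elem k = \<zero> \<or> int_elem k = \<one>" for k
    proof -
      have "k mod 2 = 0 \<or> k mod 2 = 1" by presburger
      then show ?thesis using int_elem_mod[OF char, of k] by auto
    qed
    have "card {\<zero>, \<one>} < card (carrier R)" using card nontriv by simp
    then obtain t where t: "t \<in> carrier R" "t \<noteq> \<zero>" "t \<noteq> \<one>"
      by (metis card_mono finite.emptyI finite.insertI insertCI linorder_not_less subsetI)
    have s: "\<one> \<oplus> t \<in> carrier R" "\<one> \<oplus> t \<noteq> \<zero>" "\<one> \<oplus> t \<noteq> \<one>" "\<one> \<oplus> t \<noteq> t"
    proof -
      show "\<one> \<oplus> t \<in> carrier R" using t by simp
      show "\<one> \<oplus> t \<noteq> \<zero>"
      proof
        assume "\<one> \<oplus> t = \<zero>"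
        then have "\<ominus> t = \<one>" using t by (simp add: minus_equality)
        moreover have "\<ominus> t = t" using dbl[OF t(1)] t by (simp add: minus_equality)
        ultimately show False using t by simp
      qed
      show "\<one> \<oplus> t \<noteq> \<one>"
      proof
        assume eq: "\<one> \<oplus> t = \<one>"
        have "t = (\<one> \<oplus> \<one>) \<oplus> t" using True t by simp
        also have "\<dots> = \<one> \<oplus> (\<one> \<oplus> t)" using t by (simp add: a_assoc)
        finally show False using True t unfolding eq by simp
      qed
      show "\<one> \<oplus> t \<noteq> t"
      proof
        assume eq: "\<one> \<oplus> t = t"
        have "\<one> = \<one> \<oplus> (t \<oplus> t)" using dbl[OF t(1)] by simp
        also have "\<dots> = (\<one> \<oplus> t) \<oplus> t" using t by (simp add: a_assoc)
        finally show False using dbl[OF t(1)] nontriv unfolding eq by simp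
      qed
    qed
    have els: "{\<zero>, \<one>, t, \<one> \<oplus> t} = carrier R"
      by (rule card_subset_eq[OF fin]) (use t s nontriv card in auto)
    have tt: "t \<otimes> t \<in> carrier R" using t by simp
    have card': "card (carrier R) = 2 ^ 2" using card by simp
    have tn: "t \<noteq> int_elem k" and sn: "\<one> \<oplus> t \<noteq> int_elem k" for k
      using ints[of k] t s by auto
    from els tt consider "t \<otimes> t = \<zero>" | "t \<otimes> t = \<one>" | "t \<otimes> t = t" | "t \<otimes> t = \<one> \<oplus> t" by blast
    then show ?thesis
    proof cases
      case 1
      have "R \<simeq> Zmod_dual (int 2)"
        by (rule iso_Zmod_dual[OF two_is_prime_nat card' char t(1) 1 tn nontriv])
      then show ?thesis by simp
    next
      case 2
      have "(\<one> \<oplus> t) \<otimes> (\<one> \<oplus> t) = (\<one> \<oplus> t \<otimes> t) \<oplus> (t \<oplus> t)" using t by algebra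
      then have ss: "(\<one> \<oplus> t) \<otimes> (\<one> \<oplus> t) = \<zero>" unfolding 2 using True dbl[OF t(1)] by simp
      have "R \<simeq> Zmod_dual (int 2)"
        by (rule iso_Zmod_dual[OF two_is_prime_nat card' char s(1) ss sn nontriv])
      then show ?thesis by simp
    next
      case 3
      let ?A = "corner R t" and ?B = "corner R (\<one> \<ominus> t)"
      have f: "\<one> \<ominus> t \<in> carrier R" "(\<one> \<ominus> t) \<otimes> (\<one> \<ominus> t) = \<one> \<ominus> t" "\<one> \<ominus> t \<noteq> \<zero>"
        using complement_idempotent[OF t(1) 3] t by (auto simp: r_right_minus_eq)
      have iso: "R \<simeq> RDirProd ?A ?B" by (rule corner_decomposition[OF t(1) 3])
      then have "card (carrier ?A \<times> carrier ?B) = 4"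
        using ring_iso_same_card[OF iso] card unfolding RDirProd_carrier by simp
      then have prod: "card (carrier ?A) * card (carrier ?B) = 4" by (simp only: card_cartesian_product)
      have "card {\<zero>, t} \<le> card (carrier ?A)" by (rule card_mono) (use fin t 3 in auto)
      moreover have "card {\<zero>, \<one> \<ominus> t} \<le> card (carrier ?B)" by (rule card_mono) (use fin f in auto)
      ultimately have ge: "2 \<le> card (carrier ?A)" "2 \<le> card (carrier ?B)" using t(2) f(3) by auto
      have "card (carrier ?A) * 2 \<le> 4" using prod ge(2) by (metis mult_le_mono2)
      moreover have "2 * card (carrier ?B) \<le> 4" using prod ge(1) by (metis mult_le_mono1)
      ultimately have cards: "card (carrier ?A) = 2" "card (carrier ?B) = 2" using ge by linarith+
      have "?A \<simeq> Zmod (int 2)"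
        by (rule cring.iso_prime_order[OF corner_cring[OF t(1) 3] two_is_prime_nat cards(1)])
      moreover have "?B \<simeq> Zmod (int 2)"
        by (rule cring.iso_prime_order[OF corner_cring[OF f(1,2)] two_is_prime_nat cards(2)])
      ultimately have "RDirProd ?A ?B \<simeq> RDirProd (Zmod 2) (Zmod 2)"
        using RDirProd_iso_cong by fastforce
      then show ?thesis using ring_iso_trans[OF iso] by blast
    next
      case 4
      have "(\<one> \<oplus> t) \<otimes> t = t \<oplus> t \<otimes> t" using t by algebra
      also have "\<dots> = \<one> \<oplus> (t \<oplus> t)" unfolding 4 using t by algebra
      finally have inv: "(\<one> \<oplus> t) \<otimes> t = \<one>" "t \<otimes> (\<one> \<oplus> t) = \<one>" using dbl t s(1) by (auto simp: m_comm)
      have "Units R = carrier R - {\<zero>}"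
      proof (intro equalityI subsetI)
        fix x assume "x \<in> Units R"
        then show "x \<in> carrier R - {\<zero>}" using nontriv unfolding Units_def by auto
      next
        fix x assume "x \<in> carrier R - {\<zero>}"
        then have "x = \<one> \<or> x = t \<or> x = \<one> \<oplus> t" using els by blast
        then show "x \<in> Units R" using inv t s(1) unfolding Units_def by auto
      qed
      then have fld: "field R" by (rule cring_fieldI)
      \<comment> \<open>The field is copied to the natural numbers, because the existential
        quantifier ranges over rings of one fixed type.\<close>
      obtain g :: "'a \<Rightarrow> nat" where g: "inj_on g (carrier R)"
        using finite_imp_inj_to_nat_seg[OF fin] by metis
      have "field (image_ring g R)" using field.inj_imp_image_ring_is_field[OF fld g] .
      moreover have "card (carrier (image_ring g R)) = 4" unfolding image_ring_carrier using card_image[OF g] card by simp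
      moreover have "R \<simeq> image_ring g R" using inj_imp_image_ring_iso[OF g] unfolding is_ring_iso_def by blast
      ultimately show ?thesis by blast
    qed
  qed
qed

end

section \<open>Total graphs\<close>

text \<open>An infimum equal to 1 is taken over a nonempty set and is attained. So the graph embeds
  in the surface with one handle, and not in the sphere, which contains a copy of the plane.\<close>

lemma toroidal_embeddings:
  assumes "toroidal G"
  shows "embeds_in G torus" "\<not> embeds_in G (UNIV :: complex set)"
proof -
  define K where "K = {k. embeds_in G (handle_sphere k)}"
  have inf: "Inf (enat ` K) = 1" using assms unfolding toroidal_def genus_def K_def .
  then have ne: "enat ` K \<noteq> {}" by (metis Inf_empty enat_1 infinity_ne_i1 top_enat_def)
  then have "Inf (enat ` K) \<in> enat ` K"
    unfolding Inf_enat_def by (metis (mono_tags, lifting) LeastI ex_in_conv)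
  then have "1 \<in> K" unfolding inf by (auto simp: one_enat_def)
  then have "embeds_in G (handle_sphere 1)" unfolding K_def by simp
  moreover obtain f g where fg: "homeomorphism (handle_sphere 1) torus f g"
    using handle_sphere_1 unfolding homeomorphic_def torus_def by blast
  moreover have "inj_on f (handle_sphere 1)"
    using homeomorphism_apply1[OF fg] by (rule inj_on_inverseI)
  ultimately show "embeds_in G torus"
    using embeds_in_continuous_injection[of G "handle_sphere 1" f torus] homeomorphism_cont1[OF fg]
      homeomorphism_image1[OF fg] by simp
  have "0 \<notin> K"
  proof
    assume "0 \<in> K"
    then have "Inf (enat ` K) \<le> enat 0" by (intro Inf_lower imageI)
    then show False unfolding inf by (simp add: one_enat_def)
  qed
  then show "\<not> embeds_in G (UNIV :: complex set)" using embeds_in_sphere_of_planar unfolding K_def by blast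
qed

lemma ex_injection_lessThan:
  assumes "n \<le> card A" shows "\<exists>p::nat \<Rightarrow> 'a. inj_on p {..<n} \<and> p ` {..<n} \<subseteq> A"
proof (cases "n = 0")
  case False
  then have "finite A" using assms card.infinite by force
  then obtain p :: "nat \<Rightarrow> 'a" where "p ` {..<n} \<subseteq> A" "inj_on p {..<n}"
    using card_le_inj[of "{..<n}" A] assms by auto
  then show ?thesis by blast
qed simp

lemma nonplanar_on_clique:
  assumes A: "5 \<le> card A" and E: "\<And>x y. \<lbrakk>x \<in> A; y \<in> A; x \<noteq> y\<rbrakk> \<Longrightarrow> {x, y} \<in> E"
  shows "\<exists>W\<subseteq>A. nonplanar_on E W"
proof -
  obtain p :: "nat \<Rightarrow> 'a" where p: "inj_on p {..<5}" "p ` {..<5} \<subseteq> A"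
    using ex_injection_lessThan[OF A] by blast
  have "nonplanar_on E (p ` {..<5})"
  proof (rule nonplanar_on_K5[OF p(1)])
    fix i j :: nat assume ij: "i < 5" "j < 5" "i \<noteq> j"
    then have "p i \<noteq> p j" using inj_on_eq_iff[OF p(1), of i j] by simp
    then show "{p i, p j} \<in> E" using E p(2) ij by blast
  qed
  then show ?thesis using p(2) by blast
qed

lemma nonplanar_on_biclique:
  assumes A: "3 \<le> card A" and B: "3 \<le> card B" and AB: "A \<inter> B = {}"
    and E: "\<And>x y. \<lbrakk>x \<in> A; y \<in> B\<rbrakk> \<Longrightarrow> {x, y} \<in> E"
  shows "\<exists>W\<subseteq>A \<union> B. nonplanar_on E W"
proof -
  obtain u :: "nat \<Rightarrow> 'a" where u: "inj_on u {..<3}" "u ` {..<3} \<subseteq> A"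
    using ex_injection_lessThan[OF A] by blast
  obtain v :: "nat \<Rightarrow> 'a" where v: "inj_on v {..<3}" "v ` {..<3} \<subseteq> B"
    using ex_injection_lessThan[OF B] by blast
  have "nonplanar_on E (u ` {..<3} \<union> v ` {..<3})"
  proof (rule nonplanar_on_K33[OF u(1) v(1)])
    show "u ` {..<3} \<inter> v ` {..<3} = {}" using u v AB by blast
    fix i j :: nat assume "i < 3" "j < 3"
    then show "{u i, v j} \<in> E" using E u(2) v(2) by blast
  qed
  moreover have "u ` {..<3} \<union> v ` {..<3} \<subseteq> A \<union> B" using u(2) v(2) by blast
  ultimately show ?thesis by (intro exI[of _ "u ` {..<3} \<union> v ` {..<3}"] conjI)
qed

locale finite_cring = cring +
  assumes fin: "finite (carrier R)" and nontriv: "\<one> \<noteq> \<zero>"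
begin

definition edges :: "'a set set" where "edges = snd (total_graph R)"

lemma total_graph_eq: "total_graph R = (carrier R, edges)"
  unfolding edges_def total_graph_def by simp

lemma edge_iff: "{x, y} \<in> edges \<longleftrightarrow> x \<in> carrier R \<and> y \<in> carrier R \<and> x \<noteq> y \<and> x \<oplus> y \<in> zero_divisors R"
proof
  assume "{x, y} \<in> edges"
  then obtain a b where ab: "a \<in> carrier R" "b \<in> carrier R" "a \<noteq> b" "a \<oplus> b \<in> zero_divisors R" "{x, y} = {a, b}"
    unfolding edges_def total_graph_def by auto
  then have "(x = a \<and> y = b) \<or> (x = b \<and> y = a)" by (auto simp: doubleton_eq_iff)
  then show "x \<in> carrier R \<and> y \<in> carrier R \<and> x \<noteq> y \<and> x \<oplus> y \<in> zero_divisors R"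
    using ab(1-4) a_comm[OF ab(1,2)] by auto
next
  assume "x \<in> carrier R \<and> y \<in> carrier R \<and> x \<noteq> y \<and> x \<oplus> y \<in> zero_divisors R"
  then show "{x, y} \<in> edges" unfolding edges_def total_graph_def by auto
qed

lemma simple_total_graph: "simple_graph (carrier R, edges)"
  unfolding simple_graph_def edges_def total_graph_def by auto

lemma ideal_edge:
  assumes "ideal I R" "\<one> \<notin> I" "x \<in> carrier R" "y \<in> carrier R" "x \<noteq> y" "x \<oplus> y \<in> I"
  shows "{x, y} \<in> edges"
  using assms finite_nonunit_zero_divisor[OF fin assms(1,2,6)] unfolding edge_iff by blast

text \<open>The coset \<open>I\<close> is a clique, and the coset of \<open>1\<close> is a clique or is completely joined to
  the coset of \<open>-1\<close>.\<close>

lemma toroidal_ideal_card: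
  assumes d: "drawing (carrier R, edges) torus pt curve" and I: "ideal I R" "\<one> \<notin> I"
  shows "card I \<le> 4"
proof (rule ccontr)
  assume "\<not> card I \<le> 4"
  then have I5: "5 \<le> card I" by simp
  interpret I: ideal I R by (rule I(1))
  note Ic = I.Icarr
  have "\<exists>W\<subseteq>I. nonplanar_on edges W"
    using I5 ideal_edge[OF I] Ic I.a_closed by (intro nonplanar_on_clique) auto
  then obtain W where W: "W \<subseteq> I" "nonplanar_on edges W" by blast
  define co where "co c = (\<lambda>i. c \<oplus> i) ` I" for c
  have co: "card (co c) = card I" "co c \<subseteq> carrier R" if c: "c \<in> carrier R" for c
  proof -
    have "inj_on (\<lambda>i. c \<oplus> i) I" using c Ic by (auto simp: inj_on_def)
    then show "card (co c) = card I" unfolding co_def by (rule card_image)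
    show "co c \<subseteq> carrier R" unfolding co_def using c Ic by auto
  qed
  have co_notin: "co c \<inter> I = {}" if c: "c \<in> carrier R" "c \<notin> I" for c
  proof (rule ccontr)
    assume "co c \<inter> I \<noteq> {}"
    then obtain i where i: "i \<in> I" "c \<oplus> i \<in> I" unfolding co_def by blast
    have "c = (c \<oplus> i) \<oplus> (\<ominus> i)" using c(1) Ic[OF i(1)] by algebra
    then show False using c(2) i I.a_closed I.a_inv_closed by metis
  qed
  have m1: "\<ominus> \<one> \<notin> I" using I.a_inv_closed[of "\<ominus> \<one>"] I(2) by auto
  \<comment> \<open>The cosets of 1 and -1 coincide exactly if 2 lies in \<open>I\<close>. In either
    case they are disjoint from \<open>I\<close>, which already carries a K5.\<close>
  have "\<exists>W'\<subseteq>co \<one> \<union> co (\<ominus> \<one>). nonplanar_on edges W'"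
  proof (cases "\<one> \<oplus> \<one> \<in> I")
    case True
    have "\<exists>W'\<subseteq>co \<one>. nonplanar_on edges W'"
    proof (rule nonplanar_on_clique)
      show "5 \<le> card (co \<one>)" using co I5 by simp
      fix x y assume xy: "x \<in> co \<one>" "y \<in> co \<one>" "x \<noteq> y"
      then obtain i j where ij: "i \<in> I" "j \<in> I" "x = \<one> \<oplus> i" "y = \<one> \<oplus> j" unfolding co_def by blast
      have "x \<oplus> y = (\<one> \<oplus> \<one>) \<oplus> (i \<oplus> j)" unfolding ij(3,4) using Ic[OF ij(1)] Ic[OF ij(2)] by algebra
      also have "\<dots> \<in> I" using True ij(1,2) I.a_closed by blast
      finally show "{x, y} \<in> edges" using ideal_edge[OF I] xy co(2) by blast
    qed
    then show ?thesis by blast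
  next
    case False
    show ?thesis
    proof (rule nonplanar_on_biclique)
      show "3 \<le> card (co \<one>)" "3 \<le> card (co (\<ominus> \<one>))" using co I5 by auto
      show "co \<one> \<inter> co (\<ominus> \<one>) = {}"
      proof (rule ccontr)
        assume "co \<one> \<inter> co (\<ominus> \<one>) \<noteq> {}"
        then obtain i j where ij: "i \<in> I" "j \<in> I" "\<one> \<oplus> i = \<ominus> \<one> \<oplus> j" unfolding co_def by blast
        have "\<one> \<oplus> \<one> = (\<one> \<oplus> i) \<oplus> \<one> \<oplus> \<ominus> i" using Ic[OF ij(1)] by algebra
        also have "\<dots> = j \<oplus> \<ominus> i" unfolding ij(3) using Ic[OF ij(1)] Ic[OF ij(2)] by algebra
        also have "\<dots> \<in> I" using ij(1,2) I.a_closed I.a_inv_closed by blast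
        finally show False using False by blast
      qed
      then have ne: "x \<noteq> y" if "x \<in> co \<one>" "y \<in> co (\<ominus> \<one>)" for x y using that by blast
      fix x y assume xy: "x \<in> co \<one>" "y \<in> co (\<ominus> \<one>)"
      then obtain i j where ij: "i \<in> I" "j \<in> I" "x = \<one> \<oplus> i" "y = \<ominus> \<one> \<oplus> j" unfolding co_def by blast
      have "x \<oplus> y = i \<oplus> j" unfolding ij(3,4) using Ic[OF ij(1)] Ic[OF ij(2)] by algebra
      also have "\<dots> \<in> I" using ij(1,2) I.a_closed by blast
      finally show "{x, y} \<in> edges" using ideal_edge[OF I] xy co(2)[of \<one>] co(2)[of "\<ominus> \<one>"] ne[OF xy] by blast
    qed
  qed
  then obtain W' where W': "W' \<subseteq> co \<one> \<union> co (\<ominus> \<one>)" "nonplanar_on edges W'" by blast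
  show False
  proof (rule torus_no_disjoint_nonplanar[OF d _ W(2) _ W'(2)])
    show "W \<subseteq> carrier R" using W(1) Ic by blast
    show "W' \<subseteq> carrier R" using W'(1) co(2)[of \<one>] co(2)[of "\<ominus> \<one>"] by blast
    show "W \<inter> W' = {}" using W(1) W'(1) co_notin[of \<one>] co_notin[of "\<ominus> \<one>"] I(2) m1 by blast
  qed
qed

section \<open>Planarity from small cells, and local rings\<close>

lemma planar_of_cells:
  assumes "\<And>x y. \<lbrakk>x \<in> carrier R; y \<in> carrier R; x \<noteq> y; x \<oplus> y \<in> zero_divisors R\<rbrakk> \<Longrightarrow> cell x = cell y"
    and "\<And>x. x \<in> carrier R \<Longrightarrow> card {y \<in> carrier R. cell y = cell x} \<le> 4"
  shows "embeds_in (carrier R, edges) (UNIV :: complex set)"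
  by (rule planar_of_small_cells[OF simple_total_graph fin, of cell]) (use assms edge_iff in auto)

text \<open>The zero-divisors form the maximal ideal \<open>M\<close>. If \<open>M\<close> is zero
  or contains 2, the graph falls into small pieces and is planar. Otherwise 2 can be cancelled,
  which excludes orders 2 and 4 and leaves three elements in \<open>M\<close>. Multiplication by a
  nonzero \<open>m\<close> in \<open>M\<close> bounds the ring by nine elements, and the cosets of
  0, 1 and -1 supply nine.\<close>

lemma toroidal_local:
  assumes loc: "local_ring R" and d: "drawing (carrier R, edges) torus pt curve"
    and np: "\<not> embeds_in (carrier R, edges) (UNIV :: complex set)"
  shows "R \<simeq> Zmod 9 \<or> R \<simeq> Zmod_dual 3"
proof -
  obtain M where M: "ideal M R" "\<one> \<notin> M" "zero_divisors R = M" using local_zero_divisors[OF fin loc] .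
  interpret M: ideal M R by (rule M(1))
  note Mc = M.Icarr
  have finM: "finite M" using fin Mc by (meson finite_subset subsetI)
  have zd: "a \<in> M" if "a \<in> carrier R" "b \<in> carrier R" "b \<noteq> \<zero>" "a \<otimes> b = \<zero>" for a b
    using that unfolding M(3)[symmetric] zero_divisors_def by blast
  have M4: "card M \<le> 4" by (rule toroidal_ideal_card[OF d M(1,2)])
  have "M \<noteq> {\<zero>}"
  proof
    assume M0: "M = {\<zero>}"
    \<comment> \<open>The only possible neighbour of an element is its negative.\<close>
    have "embeds_in (carrier R, edges) (UNIV :: complex set)"
    proof (rule planar_of_cells[of "\<lambda>x. {x, \<ominus> x}"])
      fix x y assume "x \<in> carrier R" "y \<in> carrier R" "x \<oplus> y \<in> zero_divisors R"
      then have "y \<oplus> x = \<zero>" "x \<in> carrier R" "y \<in> carrier R" unfolding M(3) M0 by (auto simp: a_comm)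
      then have "\<ominus> x = y" by (simp add: minus_equality)
      then show "{x, \<ominus> x} = {y, \<ominus> y}" using \<open>x \<in> carrier R\<close> by auto
    next
      fix x assume "x \<in> carrier R"
      have "{y \<in> carrier R. {y, \<ominus> y} = {x, \<ominus> x}} \<subseteq> {x, \<ominus> x}" by blast
      then have "card {y \<in> carrier R. {y, \<ominus> y} = {x, \<ominus> x}} \<le> card {x, \<ominus> x}" by (intro card_mono) auto
      also have "\<dots> \<le> 2" by (simp add: card_insert_if)
      finally show "card {y \<in> carrier R. {y, \<ominus> y} = {x, \<ominus> x}} \<le> 4" by simp
    qed
    then show False using np by blast
  qed
  then obtain m where m: "m \<in> M" "m \<noteq> \<zero>" using M.zero_closed by blast
  have mc: "m \<in> carrier R" using Mc m by blast
  have two: "\<one> \<oplus> \<one> \<notin> M"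
  proof
    assume two: "\<one> \<oplus> \<one> \<in> M"
    \<comment> \<open>Modulo \<open>M\<close> sums and differences agree, so adjacent elements lie
      in the same coset of \<open>M\<close>.\<close>
    have "embeds_in (carrier R, edges) (UNIV :: complex set)"
    proof (rule planar_of_cells[of "\<lambda>x. M +> x"])
      fix x y assume xy: "x \<in> carrier R" "y \<in> carrier R" "x \<oplus> y \<in> zero_divisors R"
      have "x \<ominus> y = (x \<oplus> y) \<ominus> (\<one> \<oplus> \<one>) \<otimes> y" using xy(1,2) by algebra
      moreover have "(\<one> \<oplus> \<one>) \<otimes> y \<in> M" using M.I_r_closed[OF two xy(2)] .
      ultimately have "x \<ominus> y \<in> M"
        using xy(3) unfolding M(3) a_minus_def using M.a_closed M.a_inv_closed by auto
      then show "M +> x = M +> y" using quotient_eq_iff_same_a_r_cos[OF M(1) xy(1,2)] by simp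
    next
      fix x assume x: "x \<in> carrier R"
      have "{y \<in> carrier R. M +> y = M +> x} \<subseteq> M +> x" using M.a_rcos_self by auto
      moreover have "M +> x = (\<lambda>i. i \<oplus> x) ` M" unfolding a_r_coset_def' by auto
      ultimately have "card {y \<in> carrier R. M +> y = M +> x} \<le> card ((\<lambda>i. i \<oplus> x) ` M)"
        using finM by (intro card_mono) auto
      also have "\<dots> \<le> card M" by (rule card_image_le[OF finM])
      finally show "card {y \<in> carrier R. M +> y = M +> x} \<le> 4" using M4 by simp
    qed
    then show False using np by blast
  qed
  \<comment> \<open>Lagrange's theorem for the additive group of \<open>M\<close>. With 2 or 4
    elements, \<open>m\<close> or its double would have additive order 2, contrary to
    \<open>dbl\<close>.\<close>
  have nm: "add_pow R (card M) m = \<zero>"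
  proof -
    have "subgroup M (add_monoid R)" using additive_subgroup.a_subgroup[OF M.additive_subgroup_axioms] .
    then have "group ((add_monoid R)\<lparr>carrier := M\<rparr>)" by (rule add.subgroup_imp_group)
    from group.pow_order_eq_1[OF this, of m] show ?thesis
      using m(1) by (simp add: order_def add_pow_def nat_pow_def)
  qed
  have dbl: "x \<oplus> x \<noteq> \<zero>" if "x \<in> carrier R" "x \<noteq> \<zero>" for x
  proof
    assume "x \<oplus> x = \<zero>"
    moreover have "x \<oplus> x = (\<one> \<oplus> \<one>) \<otimes> x" using that(1) by algebra
    ultimately show False using zd[of "\<one> \<oplus> \<one>" x] that two by simp
  qed
  have pow: "add_pow R (Suc (Suc 0)) m = m \<oplus> m" "add_pow R (Suc (Suc (Suc (Suc 0)))) m = (m \<oplus> m) \<oplus> (m \<oplus> m)"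
    using mc by (simp_all add: add_pow_def a_assoc)
  have "card M \<noteq> 2" using nm dbl[OF mc m(2)] pow(1) by (auto simp: numeral_2_eq_2)
  moreover have "card M \<noteq> 4"
    using nm dbl[of "m \<oplus> m"] dbl[OF mc m(2)] pow(2) mc by (auto simp: numeral_eq_Suc)
  moreover have "card {\<zero>, m} \<le> card M" using m M.zero_closed finM by (intro card_mono) auto
  ultimately have M3: "card M = 3" using M4 m(2) by auto
  have mn: "m \<noteq> \<ominus> m" using dbl[OF mc m(2)] mc by (metis r_neg)
  have m0: "\<ominus> m \<noteq> \<zero>" using m(2) mc by (metis minus_minus minus_zero)
  have Meq: "{\<zero>, m, \<ominus> m} = M"
    by (rule card_subset_eq[OF finM]) (use m mn m0[symmetric] M.zero_closed M.a_inv_closed mc M3 in auto)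
  have "card (carrier R) \<le> 9"
  proof -
    \<comment> \<open>\<open>fb b\<close> is a fibre of multiplication by \<open>m\<close>, which
      maps the ring into \<open>M\<close>. Elements of one fibre differ by an annihilator of
      \<open>m\<close>, hence by an element of \<open>M\<close>.\<close>
    define fb where "fb b = {x \<in> carrier R. x \<otimes> m = b}" for b
    have fb: "card (fb b) \<le> 3" for b
    proof (cases "fb b = {}")
      case False
      then obtain x0 where x0: "x0 \<in> carrier R" "x0 \<otimes> m = b" unfolding fb_def by blast
      have "fb b \<subseteq> (\<lambda>i. i \<oplus> x0) ` M"
      proof
        fix x assume "x \<in> fb b"
        then have x: "x \<in> carrier R" "x \<otimes> m = b" unfolding fb_def by auto
        have "(x \<ominus> x0) \<otimes> m = x \<otimes> m \<ominus> x0 \<otimes> m" using x(1) x0(1) mc by algebra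
        then have "(x \<ominus> x0) \<otimes> m = \<zero>" using x x0 mc by (auto simp: a_minus_def r_neg)
        then have "x \<ominus> x0 \<in> M" using zd[OF _ mc m(2)] x(1) x0(1) by simp
        moreover have "x = (x \<ominus> x0) \<oplus> x0" using x(1) x0(1) by algebra
        ultimately show "x \<in> (\<lambda>i. i \<oplus> x0) ` M" by blast
      qed
      then have "card (fb b) \<le> card ((\<lambda>i. i \<oplus> x0) ` M)" using finM by (intro card_mono) auto
      also have "\<dots> \<le> card M" by (rule card_image_le[OF finM])
      finally show ?thesis using M3 by simp
    qed simp
    have "carrier R = (\<Union>b\<in>M. fb b)" unfolding fb_def using M.I_l_closed[OF m(1)] by auto
    then have "card (carrier R) \<le> (\<Sum>b\<in>M. card (fb b))" using card_UN_le[OF finM, of fb] by simp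
    also have "\<dots> \<le> (\<Sum>b\<in>M. 3)" by (rule sum_mono) (rule fb)
    finally show ?thesis using M3 by simp
  qed
  moreover have "9 \<le> card (carrier R)"
  proof -
    define g where "g = (\<lambda>(c, i). c \<oplus> i)"
    have inj: "inj_on g ({\<zero>, \<one>, \<ominus> \<one>} \<times> M)"
    proof (rule inj_onI, clarify)
      fix c i c' i' assume c: "c \<in> {\<zero>, \<one>, \<ominus> \<one>}" "c' \<in> {\<zero>, \<one>, \<ominus> \<one>}" and i: "i \<in> M" "i' \<in> M"
        and eq: "g (c, i) = g (c', i')"
      have cc: "c \<in> carrier R" "c' \<in> carrier R" "i \<in> carrier R" "i' \<in> carrier R" using c i Mc by auto
      have e: "c \<oplus> i = c' \<oplus> i'" using eq unfolding g_def by simp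
      have "c \<ominus> c' = (c \<oplus> i) \<ominus> i \<ominus> c'" using cc by algebra
      also have "\<dots> = i' \<ominus> i" unfolding e using cc by algebra
      finally have D: "c \<ominus> c' \<in> M" using i M.a_closed M.a_inv_closed unfolding a_minus_def by auto
      have D': "\<ominus> (c \<ominus> c') \<in> M" using D M.a_inv_closed by blast
      \<comment> \<open>Up to sign, two different elements among 0, 1, -1 have difference 1 or 2,
        and neither of these is in \<open>M\<close>.\<close>
      have "\<one> \<ominus> \<zero> = \<one>" "\<zero> \<ominus> \<ominus> \<one> = \<one>" "\<ominus> (\<zero> \<ominus> \<one>) = \<one>" "\<ominus> (\<ominus> \<one> \<ominus> \<zero>) = \<one>" "\<one> \<ominus> \<ominus> \<one> = \<one> \<oplus> \<one>"
        "\<ominus> (\<ominus> \<one> \<ominus> \<one>) = \<one> \<oplus> \<one>" by (simp_all add: a_minus_def minus_add)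
      then have "c = c'" using c D D' M(2) two by (elim insertE emptyE) simp_all
      then show "c = c' \<and> i = i'" using e cc by simp
    qed
    have "\<one> \<noteq> \<ominus> \<one>" using dbl[of \<one>] nontriv by (metis one_closed r_neg)
    moreover have "\<zero> \<noteq> \<ominus> \<one>" using nontriv by (metis minus_minus minus_zero one_closed)
    ultimately have "card {\<zero>, \<one>, \<ominus> \<one>} = 3" using nontriv by simp
    then have "card (g ` ({\<zero>, \<one>, \<ominus> \<one>} \<times> M)) = 9" using card_image[OF inj] M3 by (simp add: card_cartesian_product)
    moreover have "g ` ({\<zero>, \<one>, \<ominus> \<one>} \<times> M) \<subseteq> carrier R" unfolding g_def using Mc by auto
    ultimately show ?thesis using card_mono[OF fin, of "g ` ({\<zero>, \<one>, \<ominus> \<one>} \<times> M)"] by simp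
  qed
  ultimately have card9: "card (carrier R) = 9" by simp
  show ?thesis
  proof (cases "int_elem 3 = \<zero>")
    case False
    have "R \<simeq> Zmod (int 9)"
    proof (rule iso_residue_ring[OF _ card9])
      fix d :: nat assume d: "d dvd 9" "d < 9"
      then obtain k where "k \<le> 2" "d = 3 ^ k" using divides_primepow_nat[of 3 d 2] by auto
      then have "d = 1 \<or> d = 3" using d(2) by (auto simp: le_Suc_eq numeral_2_eq_2)
      then show "int_elem (int d) \<noteq> \<zero>" using nontriv False by auto
    qed simp
    then show ?thesis by simp
  next
    case True
    have "m \<otimes> m \<in> M" using M.I_l_closed[OF m(1) mc] .
    then consider "m \<otimes> m = \<zero>" | "m \<otimes> m = m" | "m \<otimes> m = \<ominus> m" using Meq by blast
    \<comment> \<open>If the square of \<open>m\<close> were \<open>m\<close> or its negative, then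
      m - 1 or m + 1 would be a zero-divisor, and \<open>M\<close> would contain 1.\<close>
    then have mm: "m \<otimes> m = \<zero>"
    proof cases
      case 2
      have "(m \<ominus> \<one>) \<otimes> m = m \<otimes> m \<ominus> m" using mc by algebra
      then have "(m \<ominus> \<one>) \<otimes> m = \<zero>" unfolding 2 using mc by (simp add: a_minus_def r_neg)
      then have "m \<ominus> \<one> \<in> M" using zd[OF _ mc m(2)] mc by simp
      then have "m \<oplus> \<ominus> (m \<ominus> \<one>) \<in> M" using m M.a_closed M.a_inv_closed by blast
      moreover have "m \<oplus> \<ominus> (m \<ominus> \<one>) = \<one>" using mc by algebra
      ultimately show ?thesis using M(2) by simp
    next
      case 3
      have "(m \<oplus> \<one>) \<otimes> m = m \<otimes> m \<oplus> m" using mc by algebra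
      then have "(m \<oplus> \<one>) \<otimes> m = \<zero>" unfolding 3 using mc by (simp add: l_neg)
      then have "m \<oplus> \<one> \<in> M" using zd[OF _ mc m(2)] mc by simp
      then have "(m \<oplus> \<one>) \<oplus> \<ominus> m \<in> M" using m M.a_closed M.a_inv_closed by blast
      moreover have "(m \<oplus> \<one>) \<oplus> \<ominus> m = \<one>" using mc by algebra
      ultimately show ?thesis using M(2) by simp
    qed
    have "R \<simeq> Zmod_dual (int 3)"
    proof (rule iso_Zmod_dual[OF _ _ _ mc mm _ nontriv])
      show "Factorial_Ring.prime (3::nat)" by simp
      show "card (carrier R) = 3 ^ 2" using card9 by simp
      show "int_elem (int 3) = \<zero>" using True by simp
      fix k :: int
      have ch: "int_elem 3 = \<zero>" by (rule True)
      \<comment> \<open>The multiples of 1 are 0, 1 and 2, and of these only 0 lies in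
        \<open>M\<close>.\<close>
      have "k mod 3 = 0 \<or> k mod 3 = 1 \<or> k mod 3 = 2" by presburger
      then have "int_elem k = \<zero> \<or> int_elem k = \<one> \<or> int_elem k = \<one> \<oplus> \<one>"
        using int_elem_mod[OF ch, of k] int_elem_add[of 1 1] by auto
      then show "m \<noteq> int_elem k" using m M(2) two by auto
    qed
    then show ?thesis by simp
  qed
qed

end

section \<open>Rings with a nontrivial idempotent\<close>

locale split_cring = finite_cring +
  fixes e f
  assumes e: "e \<in> carrier R" "e \<otimes> e = e" "e \<noteq> \<zero>" "e \<noteq> \<one>" and f: "f = \<one> \<ominus> e"
begin

definition A where "A = carrier (corner R e)"
definition B where "B = carrier (corner R f)"

lemma f_idem: "f \<in> carrier R" "f \<otimes> f = f" "f \<noteq> \<zero>" "f \<noteq> \<one>"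
proof -
  show fc: "f \<in> carrier R" "f \<otimes> f = f" unfolding f using complement_idempotent[OF e(1,2)] e(1) by auto
  have sum: "e \<oplus> f = \<one>" unfolding f using complement_idempotent[OF e(1,2)] by simp
  show "f \<noteq> \<zero>" using sum e by auto
  show "f \<noteq> \<one>"
  proof
    assume "f = \<one>"
    then have "e \<oplus> \<one> = \<one>" using sum by simp
    then have "e = \<zero>" using e(1) by (metis add.r_cancel_one' one_closed)
    then show False using e(3) by simp
  qed
qed

lemma ef: "e \<otimes> f = \<zero>" "f \<otimes> e = \<zero>" "e \<oplus> f = \<one>"
  using complement_idempotent[OF e(1,2)] e(1) f_idem(1) unfolding f by (auto simp: m_comm)

lemma memA: "x \<in> A \<longleftrightarrow> x \<in> carrier R \<and> x \<otimes> e = x"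
  and memB: "x \<in> B \<longleftrightarrow> x \<in> carrier R \<and> x \<otimes> f = x"
  unfolding A_def B_def by auto

lemma idealA: "ideal A R" "\<one> \<notin> A" and idealB: "ideal B R" "\<one> \<notin> B"
  unfolding A_def B_def
  using corner_ideal[OF e(1,2,4)] corner_ideal[OF f_idem(1,2,4)] by auto

lemma A_f: "x \<in> A \<Longrightarrow> x \<otimes> f = \<zero>"
proof -
  assume x: "x \<in> A"
  then have "x \<otimes> f = x \<otimes> e \<otimes> f" unfolding memA by simp
  also have "\<dots> = x \<otimes> (e \<otimes> f)" by (rule m_assoc) (use x e(1) f_idem(1) memA in auto)
  finally show ?thesis using x ef unfolding memA by simp
qed

lemma B_e: "x \<in> B \<Longrightarrow> x \<otimes> e = \<zero>"
proof -
  assume x: "x \<in> B"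
  then have "x \<otimes> e = x \<otimes> f \<otimes> e" unfolding memB by simp
  also have "\<dots> = x \<otimes> (f \<otimes> e)" by (rule m_assoc) (use x e(1) f_idem(1) memB in auto)
  finally show ?thesis using x ef unfolding memB by simp
qed

lemma A_carr: "x \<in> A \<Longrightarrow> x \<in> carrier R" and B_carr: "x \<in> B \<Longrightarrow> x \<in> carrier R"
  unfolding memA memB by auto

lemma A_int_B: "x \<in> A \<Longrightarrow> x \<in> B \<Longrightarrow> x = \<zero>"
  using A_f memB by auto

lemma A_closed: "\<zero> \<in> A" "x \<in> A \<Longrightarrow> y \<in> A \<Longrightarrow> x \<oplus> y \<in> A" "x \<in> A \<Longrightarrow> \<ominus> x \<in> A"
  and B_closed: "\<zero> \<in> B" "x \<in> B \<Longrightarrow> y \<in> B \<Longrightarrow> x \<oplus> y \<in> B" "x \<in> B \<Longrightarrow> \<ominus> x \<in> B"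
  using additive_subgroup.zero_closed[OF ideal.axioms(1)[OF idealA(1)]] additive_subgroup.a_closed[OF ideal.axioms(1)[OF idealA(1)]]
    additive_subgroup.a_inv_closed[OF ideal.axioms(1)[OF idealA(1)]]
    additive_subgroup.zero_closed[OF ideal.axioms(1)[OF idealB(1)]] additive_subgroup.a_closed[OF ideal.axioms(1)[OF idealB(1)]]
    additive_subgroup.a_inv_closed[OF ideal.axioms(1)[OF idealB(1)]] by blast+

lemma eA: "e \<in> A" and fB: "f \<in> B" using e f_idem unfolding memA memB by auto

lemma decomp:
  assumes "x \<in> A" "y \<in> B" "x' \<in> A" "y' \<in> B" "x \<oplus> y = x' \<oplus> y'"
  shows "x = x' \<and> y = y'"
proof -
  note c = assms(1,3)[THEN A_carr] assms(2,4)[THEN B_carr]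
  have "(x \<oplus> y) \<otimes> e = x" "(x' \<oplus> y') \<otimes> e = x'"
    using c assms(1-4) B_e e(1) unfolding memA by (simp_all add: l_distr)
  then have "x = x'" using assms(5) by simp
  then show ?thesis using assms(5) c by simp
qed

lemma finAB: "finite A" "finite B"
  using fin A_carr B_carr by (meson finite_subset subsetI)+

lemma iso: "R \<simeq> RDirProd (corner R e) (corner R f)"
  using corner_decomposition[OF e(1,2)] unfolding f .

lemma card_R: "card (carrier R) = card A * card B"
  using ring_iso_same_card[OF iso] unfolding RDirProd_carrier A_def[symmetric] B_def[symmetric]
  by (simp add: card_cartesian_product)

lemma cards_ge2: "2 \<le> card A" "2 \<le> card B"
proof -
  have "card {\<zero>, e} \<le> card A" using finAB A_closed eA by (intro card_mono) auto
  then show "2 \<le> card A" using e(3) by simp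
  have "card {\<zero>, f} \<le> card B" using finAB B_closed fB by (intro card_mono) auto
  then show "2 \<le> card B" using f_idem(3) by simp
qed

lemma corner_crings: "cring (corner R e)" "cring (corner R f)"
  using corner_cring[OF e(1,2)] corner_cring[OF f_idem(1,2)] .

lemma edgeA: "\<lbrakk>x \<in> carrier R; y \<in> carrier R; x \<noteq> y; x \<oplus> y \<in> A\<rbrakk> \<Longrightarrow> {x, y} \<in> edges"
  and edgeB: "\<lbrakk>x \<in> carrier R; y \<in> carrier R; x \<noteq> y; x \<oplus> y \<in> B\<rbrakk> \<Longrightarrow> {x, y} \<in> edges"
  by (rule ideal_edge[OF idealA], assumption+) (rule ideal_edge[OF idealB], assumption+)

lemma planar_2_2:
  assumes "card A = 2" "card B = 2"
  shows "embeds_in (carrier R, edges) (UNIV :: complex set)"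
proof (rule planar_of_cells[of "\<lambda>_. ()"])
  fix x :: 'a
  show "card {y \<in> carrier R. () = ()} \<le> 4" using card_R assms by simp
qed simp

text \<open>The sum of the two nonzero elements cannot be one of them, since the other would then be
  zero.\<close>

lemma order_3_opposite:
  assumes "card S = 3" "\<zero> \<in> S" "c \<in> S" "c \<noteq> \<zero>" "S \<subseteq> carrier R"
    and closed: "\<And>x y. x \<in> S \<Longrightarrow> y \<in> S \<Longrightarrow> x \<oplus> y \<in> S"
  obtains z where "S = {\<zero>, c, z}" "z \<noteq> \<zero>" "z \<noteq> c" "c \<oplus> z = \<zero>"
proof -
  have "card (S - {\<zero>, c}) = 1" using assms by (simp add: card_Diff_subset)
  then obtain z where "S - {\<zero>, c} = {z}" using card_1_singletonE by blast
  then have z: "S = {\<zero>, c, z}" "z \<noteq> \<zero>" "z \<noteq> c" using assms(2,3) by auto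
  have zc: "z \<in> carrier R" "c \<in> carrier R" using z(1) assms(5) by auto
  have "c \<oplus> z \<in> S" using closed z(1) by blast
  moreover have "c \<oplus> z \<noteq> c" "c \<oplus> z \<noteq> z" using z zc assms(4) by (auto simp: add.r_cancel_one add.l_cancel_one)
  ultimately have "c \<oplus> z = \<zero>" using z(1) by blast
  then show ?thesis using that z by blast
qed

text \<open>The ring consists of 0, \<open>f\<close>, \<open>g\<close> and their translates by
  \<open>e\<close>, where \<open>g\<close> is the negative of \<open>f\<close>. The pairs that a
  prism must leave unjoined have sum 1 or \<open>e \<oplus> g\<close>, and each of these is its own
  inverse.\<close>

lemma planar_2_3:
  assumes "card A = 2" "card B = 3"
  shows "embeds_in (carrier R, edges) (UNIV :: complex set)"
proof -
  obtain g where g: "B = {\<zero>, f, g}" "g \<noteq> \<zero>" "g \<noteq> f" "f \<oplus> g = \<zero>"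
    by (rule order_3_opposite[OF assms(2) B_closed(1) fB f_idem(3)]) (use B_carr B_closed in auto)
  have gc: "g \<in> carrier R" "g \<in> B" using g(1) B_carr by auto
  note ec = e(1) and fc = f_idem(1)
  have gf: "g = \<ominus> f" using g(4) fc gc by (metis a_comm minus_equality minus_minus)
  have gg: "g \<otimes> g = f"
  proof -
    have "g \<otimes> g = f \<otimes> f" unfolding gf using fc by algebra
    then show ?thesis using f_idem by simp
  qed
  have ff: "f \<oplus> f = g"
  proof -
    have "f \<oplus> f \<in> B" using fB B_closed by blast
    moreover have "f \<oplus> f \<noteq> f" using fc f_idem(3) by (simp add: add.r_cancel_one)
    moreover have "f \<oplus> f \<noteq> \<zero>"
    proof
      assume "f \<oplus> f = \<zero>"
      then have "f = \<ominus> f" using fc by (simp add: minus_equality)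
      then show False using g(3) gf by simp
    qed
    ultimately show ?thesis using g(1) by blast
  qed
  have eg: "e \<oplus> g \<notin> zero_divisors R"
  proof (rule unit_not_zero_divisor)
    show "e \<oplus> g \<in> carrier R" using ec gc by auto
    then show "e \<oplus> g \<in> carrier R" .
    have "(e \<oplus> g) \<otimes> (e \<oplus> g) = e \<otimes> e \<oplus> (g \<otimes> e \<oplus> g \<otimes> e) \<oplus> g \<otimes> g" using ec gc(1) by algebra
    also have "\<dots> = e \<oplus> f" unfolding e(2) gg B_e[OF gc(2)] using ec fc by simp
    finally show "(e \<oplus> g) \<otimes> (e \<oplus> g) = \<one>" using ef(3) by simp
  qed
  have one: "\<one> \<notin> zero_divisors R" by (rule unit_not_zero_divisor[of \<one> \<one>]) auto
  \<comment> \<open>The order fits \<open>planar_prism\<close>: the triangles are the cosets of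
    \<open>B\<close>, and the rungs pair 0 with \<open>e\<close>, \<open>f\<close> with
    \<open>e \<oplus> g\<close>, and \<open>g\<close> with \<open>e \<oplus> f\<close>.\<close>
  define p where "p i = ([\<zero>, f, g, e \<oplus> f, e \<oplus> g, e] ! i)" for i :: nat
  have p: "p 0 = \<zero>" "p 1 = f" "p 2 = g" "p 3 = e \<oplus> f" "p 4 = e \<oplus> g" "p 5 = e"
    unfolding p_def by (simp_all add: numeral_eq_Suc)
  have six: "{..<6::nat} = {0, 1, 2, 3, 4, 5}" by auto
  have nz: "e \<oplus> f \<noteq> \<zero>" "e \<oplus> f \<noteq> f" "e \<oplus> f \<noteq> g" "e \<oplus> f \<noteq> e" "e \<oplus> g \<noteq> \<zero>" "e \<oplus> g \<noteq> f" "e \<oplus> g \<noteq> g" "e \<oplus> g \<noteq> e"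
    "e \<oplus> f \<noteq> e \<oplus> g" "e \<noteq> f" "e \<noteq> g"
  proof -
    have 0: "\<zero> = \<zero> \<oplus> \<zero>" "f = \<zero> \<oplus> f" "g = \<zero> \<oplus> g" "e = e \<oplus> \<zero>" using ec fc gc by auto
    note D = decomp[OF eA fB] decomp[OF eA gc(2)] decomp[OF eA B_closed(1)]
    show "e \<oplus> f \<noteq> \<zero>" "e \<oplus> g \<noteq> \<zero>"
      using D(1)[OF A_closed(1) B_closed(1)] D(2)[OF A_closed(1) B_closed(1)] 0(1) e(3) by auto
    show "e \<oplus> f \<noteq> f" "e \<oplus> g \<noteq> f" "e \<noteq> f"
      using D(1)[OF A_closed(1) fB] D(2)[OF A_closed(1) fB] D(3)[OF A_closed(1) fB] 0(2,4) e(3) by auto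
    show "e \<oplus> f \<noteq> g" "e \<oplus> g \<noteq> g" "e \<noteq> g"
      using D(1)[OF A_closed(1) gc(2)] D(2)[OF A_closed(1) gc(2)] D(3)[OF A_closed(1) gc(2)] 0(3,4) e(3) by auto
    show "e \<oplus> f \<noteq> e" "e \<oplus> g \<noteq> e"
      using D(1)[OF eA B_closed(1)] D(2)[OF eA B_closed(1)] 0(4) f_idem(3) g(2) by auto
    show "e \<oplus> f \<noteq> e \<oplus> g" using D(1)[OF eA gc(2)] g(3) by auto
  qed
  have inj: "inj_on p {..<6}"
    unfolding six inj_on_def using nz e(3) f_idem(3) g(2,3)
    by (auto simp: p p[simplified])
  have "p ` {..<6} \<subseteq> carrier R" unfolding six using p ec fc gc by (auto simp: p p[simplified])
  then have pR: "p ` {..<6} = carrier R"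
    by (rule card_subset_eq[OF fin]) (simp add: card_image[OF inj] card_R assms)
  have "embeds_in (p ` {..<6}, edges) (UNIV :: complex set)"
  proof (rule planar_prism[OF _ inj])
    show "simple_graph (p ` {..<6}, edges)" unfolding pR by (rule simple_total_graph)
    have s: "\<zero> \<oplus> (e \<oplus> f) = \<one>" "\<zero> \<oplus> (e \<oplus> g) = e \<oplus> g" "f \<oplus> e = \<one>" "g \<oplus> e = e \<oplus> g"
      using ef(3) ec fc gc by (auto simp: a_comm)
    have s2: "f \<oplus> (e \<oplus> f) = e \<oplus> g"
    proof -
      have "f \<oplus> (e \<oplus> f) = e \<oplus> (f \<oplus> f)" using ec fc by algebra
      then show ?thesis unfolding ff .
    qed
    have s3: "g \<oplus> (e \<oplus> g) = \<one>"
    proof -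
      have "g \<oplus> (e \<oplus> g) = e \<oplus> (g \<oplus> g)" using ec gc by algebra
      also have "g \<oplus> g = \<ominus> (f \<oplus> f)" unfolding gf using fc by algebra
      also have "\<dots> = f" unfolding ff gf using fc by simp
      finally show ?thesis using ef(3) by simp
    qed
    show "{p 0, p 3} \<notin> edges" "{p 0, p 4} \<notin> edges" "{p 1, p 3} \<notin> edges" "{p 1, p 5} \<notin> edges"
      "{p 2, p 4} \<notin> edges" "{p 2, p 5} \<notin> edges"
      unfolding p edge_iff s s2 s3 using eg one by auto
  qed
  then show ?thesis unfolding pR .
qed

text \<open>\<open>B\<close> is the K4, and the cosets of \<open>e\<close> and of its negative
  \<open>z\<close> form the K44. Numbering these by \<open>e \<ominus> b i\<close> and
  \<open>z \<ominus> b i\<close> puts the sum of \<open>b i\<close> and either partner into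
  \<open>A\<close>, whatever the characteristic of the factor \<open>B\<close>.\<close>

lemma not_toroidal_3_4:
  assumes d: "drawing (carrier R, edges) torus pt curve" and "card A = 3" "card B = 4"
  shows False
proof -
  obtain z where z: "A = {\<zero>, e, z}" "z \<noteq> \<zero>" "z \<noteq> e" "e \<oplus> z = \<zero>"
    by (rule order_3_opposite[OF assms(2) A_closed(1) eA e(3)]) (use A_carr A_closed in auto)
  have zA: "z \<in> A" "z \<in> carrier R" using z(1) A_carr by auto
  obtain b :: "nat \<Rightarrow> 'a" where b: "inj_on b {..<4}" "b ` {..<4} \<subseteq> B"
    using ex_injection_lessThan[of 4 B] assms(3) by auto
  have bB: "b i \<in> B" "b i \<in> carrier R" if "i < 4" for i using b(2) B_carr that by auto
  have nb: "\<ominus> b i \<in> B" "\<ominus> b i \<in> carrier R" if "i < 4" for i using bB[OF that] B_closed by auto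
  have inj': "inj_on (\<lambda>i. c \<ominus> b i) {..<4}" if c: "c \<in> A" for c
  proof (rule inj_onI)
    fix i j assume ij: "i \<in> {..<4}" "j \<in> {..<4}" "c \<ominus> b i = c \<ominus> b j"
    then have "\<ominus> b i = \<ominus> b j"
      using decomp[OF c nb(1)[of i] c nb(1)[of j]] unfolding a_minus_def by auto
    then have "b i = b j" using bB[of i] bB[of j] ij(1,2) by (metis lessThan_iff minus_minus)
    then show "i = j" using b(1) ij by (auto dest: inj_onD)
  qed
  have dis: "b i \<noteq> c \<ominus> b j" if "i < 4" "j < 4" "c \<in> A" "c \<noteq> \<zero>" for i j c
  proof
    assume "b i = c \<ominus> b j"
    then have "\<zero> \<oplus> b i = c \<oplus> \<ominus> b j" using bB[OF that(1)] unfolding a_minus_def by simp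
    then show False using decomp[OF A_closed(1) bB(1)[OF that(1)] that(3) nb(1)[OF that(2)]] that(4) by simp
  qed
  have dis': "e \<ominus> b i \<noteq> z \<ominus> b j" if "i < 4" "j < 4" for i j
    using decomp[OF eA nb(1)[OF that(1)] zA(1) nb(1)[OF that(2)]] z(3) unfolding a_minus_def by auto
  show False
  proof (rule torus_no_K4_linked_K44[OF d b(1) inj'[OF eA] inj'[OF zA(1)]])
    show "b ` {..<4} \<inter> (\<lambda>i. e \<ominus> b i) ` {..<4} = {}" using dis[OF _ _ eA e(3)] by auto
    show "b ` {..<4} \<inter> (\<lambda>i. z \<ominus> b i) ` {..<4} = {}" using dis[OF _ _ zA(1) z(2)] by auto
    show "(\<lambda>i. e \<ominus> b i) ` {..<4} \<inter> (\<lambda>i. z \<ominus> b i) ` {..<4} = {}" using dis' by auto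
    show "b ` {..<4} \<subseteq> carrier R" "(\<lambda>i. e \<ominus> b i) ` {..<4} \<subseteq> carrier R" "(\<lambda>i. z \<ominus> b i) ` {..<4} \<subseteq> carrier R"
      using bB(2) e(1) zA(2) by auto
    fix i j :: nat assume ij: "i < 4" "j < 4"
    show "{b i, b j} \<in> edges" if "i \<noteq> j"
      using edgeB[of "b i" "b j"] bB[OF ij(1)] bB[OF ij(2)] B_closed(2) inj_on_eq_iff[OF b(1), of i j] ij that by simp
    show "{e \<ominus> b i, z \<ominus> b j} \<in> edges"
    proof (rule edgeB)
      have "(e \<ominus> b i) \<oplus> (z \<ominus> b j) = (e \<oplus> z) \<oplus> (\<ominus> b i \<oplus> \<ominus> b j)"
        using e(1) zA(2) bB(2)[OF ij(1)] bB(2)[OF ij(2)] by algebra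
      then have "(e \<ominus> b i) \<oplus> (z \<ominus> b j) = \<ominus> b i \<oplus> \<ominus> b j" unfolding z(4) using nb ij by simp
      then show "(e \<ominus> b i) \<oplus> (z \<ominus> b j) \<in> B" using nb(1)[OF ij(1)] nb(1)[OF ij(2)] B_closed(2) by simp
    qed (use dis' ij bB(2) e(1) zA(2) in auto)
  next
    fix i :: nat assume i: "i < 4"
    have link: "{b i, c \<ominus> b i} \<in> edges" if c: "c \<in> A" "c \<noteq> \<zero>" for c
    proof (rule edgeA)
      have "b i \<oplus> (c \<ominus> b i) = c" using bB(2)[OF i] A_carr[OF c(1)] by algebra
      then show "b i \<oplus> (c \<ominus> b i) \<in> A" using c by simp
    qed (use dis[OF i i c] bB(2)[OF i] A_carr[OF c(1)] in auto)
    show "{b i, e \<ominus> b i} \<in> edges" "{b i, z \<ominus> b i} \<in> edges" using link[OF eA e(3)] link[OF zA(1) z(2)] .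
  qed
qed

text \<open>If \<open>2e \<noteq> 0\<close> then the annihilator of \<open>2e\<close> is a proper ideal strictly larger than \<open>B\<close>.\<close>

lemma toroidal_double_e:
  assumes d: "drawing (carrier R, edges) torus pt curve" and "card A = 4" "card B = 4"
  shows "e \<oplus> e = \<zero>"
proof (rule ccontr)
  assume ne: "e \<oplus> e \<noteq> \<zero>"
  note ec = e(1)
  \<comment> \<open>The factor \<open>A\<close> has order 4, so four times its unit is 0. This is
    also the square of \<open>e \<oplus> e\<close>, which therefore annihilates itself although it
    is not in \<open>B\<close>.\<close>
  have quad: "(e \<oplus> e) \<oplus> (e \<oplus> e) = \<zero>"
  proof -
    interpret C: cring "corner R e" by (rule corner_crings(1))
    have "finite (carrier (corner R e))" using finAB unfolding A_def by simp
    from C.card_int_elem[OF this] have "C.int_elem (int 4) = \<zero>" using assms(2) unfolding A_def by simp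
    moreover have "C.int_elem 2 = e \<oplus> e" using C.int_elem_add[of 1 1] by simp
    then have "C.int_elem 4 = (e \<oplus> e) \<oplus> (e \<oplus> e)" using C.int_elem_add[of 2 2] by simp
    ultimately show ?thesis by simp
  qed
  have A2: "e \<oplus> e \<in> A" using eA A_closed by blast
  define I where "I = {x \<in> carrier R. x \<otimes> (e \<oplus> e) = \<zero>}"
  have "ideal I R"
  proof (rule idealI[OF ring_axioms])
    show "subgroup I (add_monoid R)"
    proof (rule add.subgroupI)
      show "I \<subseteq> carrier R" unfolding I_def by blast
      have "\<zero> \<in> I" unfolding I_def using ec by simp
      then show "I \<noteq> {}" by blast
      fix x y assume x: "x \<in> I"
      then show "\<ominus> x \<in> I" unfolding I_def using ec by (simp add: l_minus)
      assume "y \<in> I"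
      then show "x \<oplus> y \<in> I" using x ec unfolding I_def by (simp add: l_distr)
    qed
    fix x y assume x: "x \<in> I" and y: "y \<in> carrier R"
    have "(y \<otimes> x) \<otimes> (e \<oplus> e) = y \<otimes> (x \<otimes> (e \<oplus> e))" using x y ec unfolding I_def by (simp add: m_assoc)
    then show "y \<otimes> x \<in> I" using x y unfolding I_def by simp
    then show "x \<otimes> y \<in> I" using x y unfolding I_def by (simp add: m_comm)
  qed
  moreover have "\<one> \<notin> I" unfolding I_def using ne ec by simp
  ultimately have "card I \<le> 4" by (rule toroidal_ideal_card[OF d])
  moreover have "insert (e \<oplus> e) B \<subseteq> I"
  proof -
    have "(e \<oplus> e) \<otimes> (e \<oplus> e) = (e \<otimes> e \<oplus> e \<otimes> e) \<oplus> (e \<otimes> e \<oplus> e \<otimes> e)" using ec by algebra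
    then have "e \<oplus> e \<in> I" unfolding I_def e(2) quad using ec by simp
    moreover have "B \<subseteq> I"
    proof
      fix x assume x: "x \<in> B"
      have "x \<otimes> (e \<oplus> e) = x \<otimes> e \<oplus> x \<otimes> e" using B_carr[OF x] ec by (simp add: r_distr)
      then show "x \<in> I" unfolding I_def using B_e[OF x] B_carr[OF x] by simp
    qed
    ultimately show ?thesis by blast
  qed
  then have "card (insert (e \<oplus> e) B) \<le> card I" using fin unfolding I_def by (intro card_mono) auto
  moreover have "e \<oplus> e \<notin> B" using A_int_B[OF A2] ne by blast
  ultimately show False using assms(3) finAB by simp
qed

end

context split_cring
begin

text \<open>\<open>f\<close> is a parameter of the locale tied to \<open>e\<close> by an equation,
  so the two idempotents can exchange roles, and what is shown for one factor carries over to the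
  other.\<close>

lemma swap: "split_cring R f e"
proof unfold_locales
  have "\<one> \<ominus> (\<one> \<ominus> e) = e" using e(1) by algebra
  then show "e = \<one> \<ominus> f" unfolding f by simp
qed (use f_idem in auto)

text \<open>The total graph contains the rook's graph on a 4 by 4 board, and the union of two rows of it
  is a prism over \<open>K\<^sub>4\<close>, which contains a subdivided \<open>K\<^sub>3\<^sub>,\<^sub>3\<close>.\<close>

lemma not_toroidal_4_4:
  assumes d: "drawing (carrier R, edges) torus pt curve" and cards: "card A = 4" "card B = 4"
  shows False
proof -
  interpret S: split_cring R f e by (rule swap)
  have SAB: "S.A = B" "S.B = A" unfolding S.A_def S.B_def A_def B_def by simp_all
  have ee: "e \<oplus> e = \<zero>" by (rule toroidal_double_e[OF d cards])
  have ff: "f \<oplus> f = \<zero>" by (rule S.toroidal_double_e[OF d]) (simp_all add: SAB cards)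
  have "(e \<oplus> f) \<oplus> (e \<oplus> f) = (e \<oplus> e) \<oplus> (f \<oplus> f)" using e(1) f_idem(1) by algebra
  \<comment> \<open>In characteristic 2 the sum of two elements in one row or one column of the
    board has a zero component, which makes them adjacent.\<close>
  then have two: "\<one> \<oplus> \<one> = \<zero>" unfolding ef(3) ee ff by simp
  have dbl: "x \<oplus> x = \<zero>" if "x \<in> carrier R" for x
  proof -
    have "x \<oplus> x = (\<one> \<oplus> \<one>) \<otimes> x" using that by algebra
    then show ?thesis using two that by simp
  qed
  obtain a :: "nat \<Rightarrow> 'a" where a: "inj_on a {..<4}" "a ` {..<4} \<subseteq> A"
    using ex_injection_lessThan[of 4 A] cards by auto
  obtain b :: "nat \<Rightarrow> 'a" where b: "inj_on b {..<4}" "b ` {..<4} \<subseteq> B"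
    using ex_injection_lessThan[of 4 B] cards by auto
  have aA: "a i \<in> A" "a i \<in> carrier R" and bB: "b i \<in> B" "b i \<in> carrier R" if "i < 4" for i
    using a(2) b(2) A_carr B_carr that by auto
  define v where "v i j = a i \<oplus> b j" for i j
  have vR: "v i j \<in> carrier R" if "i < 4" "j < 4" for i j unfolding v_def using aA bB that by simp
  have v_eq: "v i j = v k l \<longleftrightarrow> i = k \<and> j = l" if "i < 4" "j < 4" "k < 4" "l < 4" for i j k l
  proof
    assume "v i j = v k l"
    then have "a i = a k" "b j = b l"
      using decomp[OF aA(1)[OF that(1)] bB(1)[OF that(2)] aA(1)[OF that(3)] bB(1)[OF that(4)]] unfolding v_def by auto
    then show "i = k \<and> j = l" using inj_onD[OF a(1), of i k] inj_onD[OF b(1), of j l] that by simp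
  qed simp
  have row: "{v i j, v i l} \<in> edges" if "i < 4" "j < 4" "l < 4" "j \<noteq> l" for i j l
  proof (rule edgeB)
    note c = aA(2)[OF that(1)] bB[OF that(2)] bB[OF that(3)]
    have "v i j \<oplus> v i l = (a i \<oplus> a i) \<oplus> (b j \<oplus> b l)" unfolding v_def using c by algebra
    then have "v i j \<oplus> v i l = b j \<oplus> b l" unfolding dbl[OF c(1)] using c by simp
    then show "v i j \<oplus> v i l \<in> B" using c B_closed by simp
  qed (use that vR v_eq in auto)
  have col: "{v i j, v k j} \<in> edges" if "i < 4" "k < 4" "j < 4" "i \<noteq> k" for i j k
  proof (rule edgeA)
    note c = aA[OF that(1)] aA[OF that(2)] bB(2)[OF that(3)]
    have "v i j \<oplus> v k j = (b j \<oplus> b j) \<oplus> (a i \<oplus> a k)" unfolding v_def using c by algebra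
    then have "v i j \<oplus> v k j = a i \<oplus> a k" unfolding dbl[OF c(5)] using c by simp
    then show "v i j \<oplus> v k j \<in> A" using c A_closed by simp
  qed (use that vR v_eq in auto)
  have block: "\<exists>W \<subseteq> {v i j | i j. (i = r \<or> i = r') \<and> j < 4}. nonplanar_on edges W"
    if r: "r < 4" "r' < 4" "r \<noteq> r'" for r r'
  proof -
    \<comment> \<open>The branch vertices are all four places of row \<open>r\<close> and the places
      0 and 2 of row \<open>r'\<close>. The two missing edges, from place 1 of \<open>r\<close> to
      place 0 of \<open>r'\<close> and from place 2 of \<open>r'\<close> to place 3 of
      \<open>r\<close>, run through the places 1 and 3 of \<open>r'\<close>.\<close>
    define x where "x k = (if k = 0 then v r 0 else if k = 1 then v r 1 else v r' 2)" for k :: nat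
    define y where "y k = (if k = 0 then v r 2 else if k = 1 then v r 3 else v r' 0)" for k :: nat
    have three: "{..<3::nat} = {0, 1, 2}" by auto
    have xs: "x 0 = v r 0" "x 1 = v r 1" "x 2 = v r' 2" and ys: "y 0 = v r 2" "y 1 = v r 3" "y 2 = v r' 0"
      unfolding x_def y_def by simp_all
    have imx: "x ` {..<3} = {v r 0, v r 1, v r' 2}" and imy: "y ` {..<3} = {v r 2, v r 3, v r' 0}"
      unfolding three using xs ys by auto
    let ?W = "insert (v r' 1) (insert (v r' 3) (x ` {..<3} \<union> y ` {..<3}))"
    have "nonplanar_on edges ?W"
    proof (rule nonplanar_on_K33_subdivided)
      show "inj_on x {..<3}" "inj_on y {..<3}"
        unfolding three inj_on_def x_def y_def using r by (auto simp: v_eq)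
      show "x ` {..<3} \<inter> y ` {..<3} = {}" unfolding imx imy using r by (auto simp: v_eq)
      show "v r' 1 \<noteq> v r' 3" using r by (simp add: v_eq)
      show "v r' 1 \<notin> x ` {..<3} \<union> y ` {..<3}" "v r' 3 \<notin> x ` {..<3} \<union> y ` {..<3}"
        unfolding imx imy using r by (auto simp: v_eq)
      show "{x 1, v r' 1} \<in> edges" unfolding xs by (rule col) (use r in auto)
      show "{v r' 1, y 2} \<in> edges" unfolding ys by (rule row) (use r in auto)
      show "{x 2, v r' 3} \<in> edges" unfolding xs by (rule row) (use r in auto)
      show "{v r' 3, y 1} \<in> edges" unfolding ys by (rule col) (use r in auto)
      fix i j :: nat assume "i < 3" "j < 3" "(i, j) \<noteq> (1, 2)" "(i, j) \<noteq> (2, 1)"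
      then consider "i = 0" "j = 0" | "i = 0" "j = 1" | "i = 0" "j = 2" | "i = 1" "j = 0" | "i = 1" "j = 1"
        | "i = 2" "j = 0" | "i = 2" "j = 2" by (auto simp: less_Suc_eq numeral_eq_Suc)
      then show "{x i, y j} \<in> edges"
        using row[of r 0 2] row[of r 0 3] col[of r r' 0] row[of r 1 2] row[of r 1 3] col[of r' r 2] row[of r' 2 0] r
        by cases (simp_all add: xs ys xs[simplified] ys[simplified])
    qed
    moreover have "?W \<subseteq> {v i j | i j. (i = r \<or> i = r') \<and> j < 4}"
    proof -
      have m: "v r j \<in> {v i j | i j. (i = r \<or> i = r') \<and> j < 4}" "v r' j \<in> {v i j | i j. (i = r \<or> i = r') \<and> j < 4}"
        if "j < 4" for j using that by blast+
      show ?thesis unfolding imx imy using m[of 0] m[of 1] m[of 2] m[of 3] by simp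
    qed
    ultimately show ?thesis by (intro exI[of _ ?W] conjI)
  qed
  obtain W where W: "W \<subseteq> {v i j | i j. (i = 0 \<or> i = 1) \<and> j < 4}" "nonplanar_on edges W" using block[of 0 1] by auto
  obtain W' where W': "W' \<subseteq> {v i j | i j. (i = 2 \<or> i = 3) \<and> j < 4}" "nonplanar_on edges W'" using block[of 2 3] by auto
  show False
  proof (rule torus_no_disjoint_nonplanar[OF d _ W(2) _ W'(2)])
    have v_sub: "{v i j | i j. (i = r \<or> i = r') \<and> j < 4} \<subseteq> carrier R" if "r < 4" "r' < 4" for r r'
      using that vR by blast
    show "W \<subseteq> carrier R" by (rule subset_trans[OF W(1) v_sub]) simp_all
    show "W' \<subseteq> carrier R" by (rule subset_trans[OF W'(1) v_sub]) simp_all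
    have "{v i j | i j. (i = 0 \<or> i = 1) \<and> j < 4} \<inter> {v i j | i j. (i = 2 \<or> i = 3) \<and> j < 4} = {}"
      by (auto simp: v_eq)
    then show "W \<inter> W' = {}" using W(1) W'(1) by blast
  qed
qed

lemma iso_split_Zmod_2:
  assumes "card A = 2" "corner R f \<simeq> C"
  shows "R \<simeq> RDirProd (Zmod 2) C"
proof -
  have "corner R e \<simeq> Zmod (int 2)"
    by (rule cring.iso_prime_order[OF corner_crings(1) two_is_prime_nat]) (use assms(1) in \<open>simp add: A_def\<close>)
  then have "corner R e \<simeq> Zmod 2" by simp
  then show ?thesis using ring_iso_trans[OF iso RDirProd_iso_cong] assms(2) by blast
qed

text \<open>Both factors are proper ideals, so each has 2, 3 or 4 elements. Of the six pairs of
  orders with \<open>A\<close> not the larger, only 2 by 4 and 3 by 3 survive.\<close>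

lemma toroidal_split:
  assumes d: "drawing (carrier R, edges) torus pt curve"
    and np: "\<not> embeds_in (carrier R, edges) (UNIV :: complex set)" and le: "card A \<le> card B"
  shows "(\<exists>F4 :: nat ring. field F4 \<and> card (carrier F4) = 4 \<and> R \<simeq> RDirProd (Zmod 2) F4) \<or>
            R \<simeq> RDirProd (Zmod 3) (Zmod 3) \<or>
            R \<simeq> RDirProd (Zmod 2) (Zmod 4) \<or>
            R \<simeq> RDirProd (Zmod 2) (Zmod_dual 2) \<or>
            R \<simeq> RDirProd (Zmod 2) (RDirProd (Zmod 2) (Zmod 2))"
proof -
  have "card A \<le> 4" "card B \<le> 4"
    using toroidal_ideal_card[OF d idealA] toroidal_ideal_card[OF d idealB] .
  then have "card A \<in> {2, 3, 4}" "card B \<in> {2, 3, 4}" using cards_ge2 by auto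
  then consider "card A = 2" "card B = 2" | "card A = 2" "card B = 3" | "card A = 2" "card B = 4"
    | "card A = 3" "card B = 3" | "card A = 3" "card B = 4" | "card A = 4" "card B = 4"
    using le by force
  then show ?thesis
  proof cases
    case 1
    then show ?thesis using planar_2_2 np by blast
  next
    case 2
    then show ?thesis using planar_2_3 np by blast
  next
    case 3
    have "card (carrier (corner R f)) = 4" using 3 unfolding B_def by simp
    from cring.iso_order_4[OF corner_crings(2) this] show ?thesis
    proof (elim disjE exE conjE)
      assume "corner R f \<simeq> Zmod 4"
      then have "R \<simeq> RDirProd (Zmod 2) (Zmod 4)" by (rule iso_split_Zmod_2[OF 3(1)])
      then show ?thesis by simp
    next
      assume "corner R f \<simeq> Zmod_dual 2"
      then have "R \<simeq> RDirProd (Zmod 2) (Zmod_dual 2)" by (rule iso_split_Zmod_2[OF 3(1)])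
      then show ?thesis by simp
    next
      assume "corner R f \<simeq> RDirProd (Zmod 2) (Zmod 2)"
      then have "R \<simeq> RDirProd (Zmod 2) (RDirProd (Zmod 2) (Zmod 2))" by (rule iso_split_Zmod_2[OF 3(1)])
      then show ?thesis by simp
    next
      fix F4 :: "nat ring" assume F4: "field F4" "card (carrier F4) = 4" "corner R f \<simeq> F4"
      have "R \<simeq> RDirProd (Zmod 2) F4" by (rule iso_split_Zmod_2[OF 3(1) F4(3)])
      then show ?thesis using F4(1,2) by blast
    qed
  next
    case 4
    have "corner R e \<simeq> Zmod (int 3)"
      by (rule cring.iso_prime_order[OF corner_crings(1)]) (use 4 in \<open>simp_all add: A_def\<close>)
    moreover have "corner R f \<simeq> Zmod (int 3)"
      by (rule cring.iso_prime_order[OF corner_crings(2)]) (use 4 in \<open>simp_all add: B_def\<close>)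
    ultimately have "R \<simeq> RDirProd (Zmod 3) (Zmod 3)"
      using ring_iso_trans[OF iso RDirProd_iso_cong] by simp
    then show ?thesis by blast
  next
    case 5
    then show ?thesis using not_toroidal_3_4[OF d] by blast
  next
    case 6
    then show ?thesis using not_toroidal_4_4[OF d] by blast
  qed
qed

end

theorem theorem1p6:
  fixes R :: "('a, 'b) ring_scheme"
  assumes "cring R" and "finite (carrier R)" and "\<one>\<^bsub>R\<^esub> \<noteq> \<zero>\<^bsub>R\<^esub>"
    and "toroidal (total_graph R)"
  shows "(local_ring R \<longrightarrow> R \<simeq> Zmod 9 \<or> R \<simeq> Zmod_dual 3) \<and>
         (\<not> local_ring R \<longrightarrow>
            (\<exists>F4 :: nat ring. field F4 \<and> card (carrier F4) = 4 \<and> R \<simeq> RDirProd (Zmod 2) F4) \<or>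
            R \<simeq> RDirProd (Zmod 3) (Zmod 3) \<or>
            R \<simeq> RDirProd (Zmod 2) (Zmod 4) \<or>
            R \<simeq> RDirProd (Zmod 2) (Zmod_dual 2) \<or>
            R \<simeq> RDirProd (Zmod 2) (RDirProd (Zmod 2) (Zmod 2)))"
proof -
  interpret finite_cring R
    using assms(1-3) by (simp add: finite_cring_def finite_cring_axioms_def)
  have emb: "embeds_in (carrier R, edges) torus" and np: "\<not> embeds_in (carrier R, edges) (UNIV :: complex set)"
    using toroidal_embeddings[OF assms(4)] unfolding total_graph_eq .
  obtain pt curve where d: "drawing (carrier R, edges) torus pt curve"
    using emb unfolding embeds_in_iff_drawing by blast
  show ?thesis
  proof (intro conjI impI)
    assume "local_ring R"
    then show "R \<simeq> Zmod 9 \<or> R \<simeq> Zmod_dual 3" by (rule toroidal_local[OF _ d np])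
  next
    assume "\<not> local_ring R"
    then obtain e where e: "e \<in> carrier R" "e \<otimes>\<^bsub>R\<^esub> e = e" "e \<noteq> \<zero>\<^bsub>R\<^esub>" "e \<noteq> \<one>\<^bsub>R\<^esub>"
      using nonlocal_idempotent[OF assms(2,3)] by metis
    interpret S: split_cring R e "\<one>\<^bsub>R\<^esub> \<ominus>\<^bsub>R\<^esub> e" by unfold_locales (use e in auto)
    \<comment> \<open>Either factor may be the larger one; the interpretation with exchanged roles
      covers the second case.\<close>
    interpret T: split_cring R "\<one>\<^bsub>R\<^esub> \<ominus>\<^bsub>R\<^esub> e" e by (rule S.swap)
    have "S.A = T.B" "S.B = T.A" unfolding S.A_def S.B_def T.A_def T.B_def by simp_all
    then consider "card S.A \<le> card S.B" | "card T.A \<le> card T.B" by fastforce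
    then show "(\<exists>F4 :: nat ring. field F4 \<and> card (carrier F4) = 4 \<and> R \<simeq> RDirProd (Zmod 2) F4) \<or>
            R \<simeq> RDirProd (Zmod 3) (Zmod 3) \<or>
            R \<simeq> RDirProd (Zmod 2) (Zmod 4) \<or>
            R \<simeq> RDirProd (Zmod 2) (Zmod_dual 2) \<or>
            R \<simeq> RDirProd (Zmod 2) (RDirProd (Zmod 2) (Zmod 2))"
      by cases (rule S.toroidal_split[OF d np] T.toroidal_split[OF d np], assumption)+
  qed
qed

end
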